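(* Let $(X,d,m)$ be a compact $\mathrm{RCD}^*(K,N)$ space with $K\in\mathbb{R}$ and $N\in(2,\infty)$, where $m$ is a Borel probability measure with full support. Let $v\in\mathrm{Lip}(X)\cap D(\Delta)$ be such that $-\Delta v=|\nabla v|^2+\alpha v$ for some $\alpha>0$. Then, for all $0<\beta<1$, it holds that $$|\nabla v|^2+(\alpha-\beta K)v\le\frac{N\alpha(1-\beta)}{4\beta}\left(1-\frac{\beta((2-\beta)K-\alpha)}{2\alpha(1-\beta)}\right)^2\quad m\text{-a.e.}$$
   Context: Metric measure spaces: $(X,d,m)$ with $(X,d)$ complete, separable, proper, and $m$ a non-negative Radon measure with full support, finite on bounded sets. For a Lipschitz $f$, $\mathrm{lip} f(x)=\limsup_{y\to x}|f(y)-f(x)|/d(y,x)$ (and $0$ at isolated points). The Cheeger energy is $\mathrm{Ch}(f)=\inf\{\liminf_n \frac12\int (\mathrm{lip} f_n)^2dm: f_n\in \mathrm{Lip}\cap L^2,\ f_n\to f\text{ in }L^2\}$ on $L^2=L^2(X,m)$; $W^{1,2}=\{f \in L^2:\mathrm{Ch}(f)<\infty\}$ with norm $\|f\|_{W^{1,2}}^2=\|f\|_2^2+2\mathrm{Ch}(f)$. For $f\in W^{1,2}$, $|\nabla f|\in L^2$ is the minimal relaxed gradient, so that $\mathrm{Ch}(f)=\frac12\int|\nabla f|^2dm$. The space is infinitesimally Hilbertian if $\mathrm{Ch}$ is a quadratic form; then $\langle\nabla f,\nabla g\rangle:=\lim_{\varepsilon\to0}\frac{|\nabla(f+\varepsilon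 g)|^2-|\nabla f|^2}{2\varepsilon}\in L^1$ is bilinear on $W^{1,2}$. Laplacian: $f\in W^{1,2}$ is in $D(\Delta)$ with $\Delta f=h\in L^2$ if $-\int\langle\nabla f,\nabla g\rangle dm=\int hg\,dm$ for all $g\in W^{1,2}$. $\mathrm{RCD}^*(K,N)$ condition ($K\in\mathbb{R}$, $N\in[1,\infty]$, with $1/\infty=0$): (i) $m(B(x,r))\le Ce^{Cr^2}$ for some $x\in X$, $C>0$; (ii) (Sobolev-to-Lip) every $f\in W^{1,2}$ with $|\nabla f|\in L^\infty$ has a Lipschitz representative with Lipschitz constant $\||\nabla f|\|_\infty$; (iii) infinitesimally Hilbertian; (iv) (weak Bochner) for all $f,g\in D(\Delta)$ with $\Delta f\in W^{1,2}$, $\Delta g\in L^\infty$, $g\ge0$: $\int\Delta g\frac{|\nabla f|^2}{2}dm\ge\int g\left(\frac1N(\Delta f)^2+\langle\nabla f,\nabla\Delta f\rangle+K|\nabla f|^2\right)dm$. $\mathrm{Lip}(X)$ denotes the real-valued Lipschitz functions on $X$. *)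

theory Defs
  imports "HOL-Probability.Probability_Measure" "HOL-Probability.Essential_Supremum"
begin

text \<open>
  The metric space \<open>(X, d)\<close> is a type of class \<open>metric_space\<close> and \<open>m\<close> is a Borel measure on it.
  Elements of \<open>L\<^sup>2(X, m)\<close> are handled through Borel representatives; objects that are determined
  only up to null sets (minimal relaxed gradients, their scalar products, Laplacians) are selected
  with \<open>SOME\<close>, and are only used in contexts that are invariant under a.e. changes.
\<close>

definition metric_measure_space :: "'a::metric_space measure \<Rightarrow> bool" where
  "metric_measure_space m \<longleftrightarrow>
     complete (UNIV :: 'a set) \<and>
     (\<exists>D :: 'a set. countable D \<and> closure D = UNIV) \<and>
     (\<forall>(x :: 'a) r. compact (cball x r)) \<and>
     sets m = sets borel \<and>
     (\<forall>A\<in>sets m. emeasure m A = (SUP C\<in>{C. compact C \<and> C \<subseteq> A}. emeasure m C)) \<and>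
     (\<forall>A\<in>sets m. bounded A \<longrightarrow> emeasure m A < \<infinity>) \<and>
     (\<forall>U. open U \<and> U \<noteq> {} \<longrightarrow> emeasure m U > 0)"

definition Lip :: "('a::metric_space \<Rightarrow> real) set" where
  "Lip = {f. \<exists>L. L-lipschitz_on UNIV f}"

text \<open>Local Lipschitz constant; for \<open>f \<in> Lip\<close>, the only case of interest, the upper limit is finite.\<close>

definition lip :: "('a::metric_space \<Rightarrow> real) \<Rightarrow> 'a \<Rightarrow> real" where
  "lip f x = (if x islimpt UNIV
              then real_of_ereal (Limsup (at x) (\<lambda>y. ereal (\<bar>f y - f x\<bar> / dist y x)))
              else 0)"

definition L2 :: "'a measure \<Rightarrow> ('a \<Rightarrow> real) set" where
  "L2 m = {f \<in> borel_measurable m. integrable m (\<lambda>x. (f x)\<^sup>2)}"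

definition Linf_norm :: "'a measure \<Rightarrow> ('a \<Rightarrow> real) \<Rightarrow> ereal" where
  "Linf_norm m f = esssup m (\<lambda>x. ereal \<bar>f x\<bar>)"

definition Linf :: "'a measure \<Rightarrow> ('a \<Rightarrow> real) set" where
  "Linf m = {f \<in> borel_measurable m. Linf_norm m f < \<infinity>}"

definition L2_tendsto :: "'a measure \<Rightarrow> (nat \<Rightarrow> 'a \<Rightarrow> real) \<Rightarrow> ('a \<Rightarrow> real) \<Rightarrow> bool" where
  "L2_tendsto m fs f \<longleftrightarrow> (\<lambda>n. \<integral>\<^sup>+x. ennreal ((fs n x - f x)\<^sup>2) \<partial>m) \<longlonglongrightarrow> 0"

definition L2_weak_tendsto :: "'a measure \<Rightarrow> (nat \<Rightarrow> 'a \<Rightarrow> real) \<Rightarrow> ('a \<Rightarrow> real) \<Rightarrow> bool" where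
  "L2_weak_tendsto m fs f \<longleftrightarrow>
     (\<forall>n. fs n \<in> L2 m) \<and> f \<in> L2 m \<and>
     (\<forall>h\<in>L2 m. (\<lambda>n. \<integral>x. fs n x * h x \<partial>m) \<longlonglongrightarrow> (\<integral>x. f x * h x \<partial>m))"

definition Cheeger :: "'a::metric_space measure \<Rightarrow> ('a \<Rightarrow> real) \<Rightarrow> ennreal" where
  "Cheeger m f =
     (INF fs\<in>{fs. (\<forall>n. fs n \<in> Lip \<inter> L2 m) \<and> L2_tendsto m fs f}.
        liminf (\<lambda>n. (\<integral>\<^sup>+x. ennreal ((lip (fs n) x)\<^sup>2) \<partial>m) / 2))"

definition W12 :: "'a::metric_space measure \<Rightarrow> ('a \<Rightarrow> real) set" where
  "W12 m = {f \<in> L2 m. Cheeger m f < \<infinity>}"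

text \<open>
  Relaxed gradients in the sense of Ambrosio, Gigli and Savare: \<open>L\<^sup>2\<close> functions that dominate a
  weak \<open>L\<^sup>2\<close> limit of \<open>lip f\<^sub>n\<close> along Lipschitz functions \<open>f\<^sub>n \<rightarrow> f\<close> in \<open>L\<^sup>2\<close>. The minimal
  relaxed gradient is the one of least \<open>L\<^sup>2\<close> norm; it is unique up to a.e. equality.
\<close>

definition relaxed_gradient :: "'a::metric_space measure \<Rightarrow> ('a \<Rightarrow> real) \<Rightarrow> ('a \<Rightarrow> real) \<Rightarrow> bool" where
  "relaxed_gradient m f G \<longleftrightarrow>
     G \<in> L2 m \<and>
     (\<exists>fs H. (\<forall>n. fs n \<in> Lip \<inter> L2 m) \<and> L2_tendsto m fs f \<and>
             L2_weak_tendsto m (\<lambda>n. lip (fs n)) H \<and> (AE x in m. H x \<le> G x))"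

definition minimal_relaxed_gradient ::
    "'a::metric_space measure \<Rightarrow> ('a \<Rightarrow> real) \<Rightarrow> ('a \<Rightarrow> real) \<Rightarrow> bool" where
  "minimal_relaxed_gradient m f G \<longleftrightarrow>
     relaxed_gradient m f G \<and>
     (\<forall>H. relaxed_gradient m f H \<longrightarrow> (\<integral>x. (G x)\<^sup>2 \<partial>m) \<le> (\<integral>x. (H x)\<^sup>2 \<partial>m))"

definition grad_norm :: "'a::metric_space measure \<Rightarrow> ('a \<Rightarrow> real) \<Rightarrow> 'a \<Rightarrow> real" where
  "grad_norm m f = (SOME G. minimal_relaxed_gradient m f G)"

definition quadratic_form_on :: "('a \<Rightarrow> real) set \<Rightarrow> (('a \<Rightarrow> real) \<Rightarrow> ennreal) \<Rightarrow> bool" where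
  "quadratic_form_on V q \<longleftrightarrow>
     (\<exists>B :: ('a \<Rightarrow> real) \<Rightarrow> ('a \<Rightarrow> real) \<Rightarrow> real.
        (\<forall>f\<in>V. \<forall>g\<in>V. B f g = B g f) \<and>
        (\<forall>f\<in>V. \<forall>g\<in>V. \<forall>h\<in>V. \<forall>a b. B (\<lambda>x. a * f x + b * g x) h = a * B f h + b * B g h) \<and>
        (\<forall>f\<in>V. B f f \<ge> 0 \<and> q f = ennreal (B f f)))"

definition infinitesimally_Hilbertian :: "'a::metric_space measure \<Rightarrow> bool" where
  "infinitesimally_Hilbertian m \<longleftrightarrow> quadratic_form_on (W12 m) (Cheeger m)"

text \<open>\<open>\<langle>\<nabla>f, \<nabla>g\<rangle>\<close>; the limit of the difference quotients is taken in \<open>L\<^sup>1(X, m)\<close>.\<close>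

definition is_grad_inner ::
    "'a::metric_space measure \<Rightarrow> ('a \<Rightarrow> real) \<Rightarrow> ('a \<Rightarrow> real) \<Rightarrow> ('a \<Rightarrow> real) \<Rightarrow> bool" where
  "is_grad_inner m f g u \<longleftrightarrow>
     integrable m u \<and>
     ((\<lambda>\<epsilon>. \<integral>x. \<bar>((grad_norm m (\<lambda>y. f y + \<epsilon> * g y) x)\<^sup>2 - (grad_norm m f x)\<^sup>2) / (2 * \<epsilon>) - u x\<bar> \<partial>m)
        \<longlongrightarrow> 0) (at 0)"

definition grad_inner ::
    "'a::metric_space measure \<Rightarrow> ('a \<Rightarrow> real) \<Rightarrow> ('a \<Rightarrow> real) \<Rightarrow> 'a \<Rightarrow> real" where
  "grad_inner m f g = (SOME u. is_grad_inner m f g u)"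

definition is_laplacian :: "'a::metric_space measure \<Rightarrow> ('a \<Rightarrow> real) \<Rightarrow> ('a \<Rightarrow> real) \<Rightarrow> bool" where
  "is_laplacian m f h \<longleftrightarrow>
     f \<in> W12 m \<and> h \<in> L2 m \<and>
     (\<forall>g\<in>W12 m. - (\<integral>x. grad_inner m f g x \<partial>m) = (\<integral>x. h x * g x \<partial>m))"

definition dom_laplacian :: "'a::metric_space measure \<Rightarrow> ('a \<Rightarrow> real) set" where
  "dom_laplacian m = {f. \<exists>h. is_laplacian m f h}"

definition laplacian :: "'a::metric_space measure \<Rightarrow> ('a \<Rightarrow> real) \<Rightarrow> 'a \<Rightarrow> real" where
  "laplacian m f = (SOME h. is_laplacian m f h)"

definition volume_growth :: "'a::metric_space measure \<Rightarrow> bool" where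
  "volume_growth m \<longleftrightarrow>
     (\<exists>(x :: 'a) C. C > 0 \<and> (\<forall>r>0. emeasure m (ball x r) \<le> ennreal (C * exp (C * r\<^sup>2))))"

definition Sobolev_to_Lip :: "'a::metric_space measure \<Rightarrow> bool" where
  "Sobolev_to_Lip m \<longleftrightarrow>
     (\<forall>f\<in>W12 m. grad_norm m f \<in> Linf m \<longrightarrow>
        (\<exists>g. (real_of_ereal (Linf_norm m (grad_norm m f)))-lipschitz_on UNIV g \<and>
             (AE x in m. f x = g x)))"

text \<open>
  Weak Bochner inequality. The left integrand is always integrable, since \<open>\<Delta>g \<in> L\<^sup>\<infinity>\<close>. The
  integrability premise makes sure that the inequality is demanded only where the right-hand
  integral is meaningful (the Bochner integral of a non-integrable function is \<open>0\<close>); it holds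
  automatically when \<open>g\<close> is bounded. The extended real \<open>1 / N\<close> is \<open>0\<close> for \<open>N = \<infinity>\<close>.
\<close>

definition weak_Bochner :: "'a::metric_space measure \<Rightarrow> real \<Rightarrow> ereal \<Rightarrow> bool" where
  "weak_Bochner m K N \<longleftrightarrow>
     (\<forall>f\<in>dom_laplacian m. \<forall>g\<in>dom_laplacian m.
        let R = (\<lambda>x. g x * (real_of_ereal (1 / N) * (laplacian m f x)\<^sup>2
                            + grad_inner m f (laplacian m f) x
                            + K * (grad_norm m f x)\<^sup>2))
        in laplacian m f \<in> W12 m \<and> laplacian m g \<in> Linf m \<and> (AE x in m. g x \<ge> 0) \<and>
           integrable m R \<longrightarrow>
           (\<integral>x. laplacian m g x * ((grad_norm m f x)\<^sup>2 / 2) \<partial>m) \<ge> (\<integral>x. R x \<partial>m))"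

definition RCD_star :: "'a::metric_space measure \<Rightarrow> real \<Rightarrow> ereal \<Rightarrow> bool" where
  "RCD_star m K N \<longleftrightarrow>
     1 \<le> N \<and> metric_measure_space m \<and> volume_growth m \<and> Sobolev_to_Lip m \<and>
     infinitesimally_Hilbertian m \<and> weak_Bochner m K N"

end

theory Submission
  imports Defs
begin

text \<open>
  Write \<open>u = |\<nabla>v|\<^sup>2\<close>, \<open>w = u + (\<alpha> - \<beta>K)v\<close> and \<open>Lf = \<Delta>f + 2\<langle>\<nabla>v, \<nabla>f\<rangle>\<close>. Formally, Bochner's inequality and
  \<open>\<Delta>v = -u - \<alpha>v\<close> give \<open>Lu \<ge> 2(u + \<alpha>v)\<^sup>2/N + 2(K - \<alpha>)u\<close> and \<open>Lv = u - \<alpha>v\<close>, and completing the square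
  yields \<open>Lw \<ge> b(w - w\<^sub>0)\<close> with \<open>b = 2\<alpha>(1 - \<beta>)/\<beta> > 0\<close> and \<open>w\<^sub>0\<close> the constant of the theorem, so that
  \<open>w \<le> w\<^sub>0\<close> at a maximum of \<open>w\<close>. No second order regularity of \<open>v\<close> is needed to make this rigorous: \<open>L\<close> is
  symmetric with respect to \<open>e\<^bsup>2v\<^esup> m\<close>, and the inequality is tested with the nonnegative bounded solution
  \<open>\<psi>\<close> of \<open>(b - L)\<psi> = e\<^bsup>-2v\<^esup> 1\<^bsub>{w > w\<^sub>0}\<^esub>\<close>, a minimiser of a weighted Cheeger energy. Bochner's inequality,
  assumed only for functions with Laplacian in \<open>W\<^bsup>1,2\<^esup>\<close>, reaches \<open>v\<close> by applying resolvents of the Laplacian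
  to both arguments.
\<close>

section \<open>The space \<open>L\<^sup>2\<close>\<close>

text \<open>The function w is merely bounded and measurable, so it can neither be evaluated at a
  maximum nor be used to build test functions; the truncation sits in the equation for \<psi>
  instead. Put \<chi> = 1 where w > w0 and 0 elsewhere, and g = exp(2v) \<psi>. Then \<Delta>g - 2
  div(g \<nabla>v) = b g - \<chi>, and the formal inequality for L w becomes b \<integral>(w - w0) g
  \<le> \<integral>w (b g - \<chi>). Testing with 1 gives b \<integral>g = \<integral>\<chi>, and
  together \<integral>(w - w0) \<chi> \<le> 0. The factor exp(-2v) in the equation for \<psi> makes
  \<chi> appear unweighted here.

  The number b is the one for which the linear terms in the lower bound for L w - b w combine into a
  multiple of u + \<alpha> v, so that a single square remains.

  Gradients are only selected representatives of minimal objects, so locality, the Leibniz rule and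
  the symmetry of \<langle>\<nabla>f, \<nabla>g\<rangle> have to be derived from minimality and from
  the quadratic energy. Products are handled for bounded functions, and for this reason the
  Laplacian of g is known only against bounded test functions.\<close>

lemma inverse_Suc_tendsto: "(\<lambda>n. 1 / real (Suc n)) \<longlonglongrightarrow> 0"
  by (rule LIMSEQ_Suc[OF lim_1_over_n])

text \<open>A Bochner integral that does not exist is 0, so this is the norm only for members of
  \<open>L2 m\<close>.\<close>

definition L2_norm :: "'a measure \<Rightarrow> ('a \<Rightarrow> real) \<Rightarrow> real" where
  "L2_norm m f = sqrt (\<integral>x. (f x)\<^sup>2 \<partial>m)"

lemma L2_measurable: "f \<in> L2 m \<Longrightarrow> f \<in> borel_measurable m"
  and L2_integrable_sq: "f \<in> L2 m \<Longrightarrow> integrable m (\<lambda>x. (f x)\<^sup>2)"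
  by (auto simp: L2_def)

lemma L2_norm_nonneg [simp]: "0 \<le> L2_norm m f"
  by (simp add: L2_norm_def)

lemma L2_norm_sq: "(L2_norm m f)\<^sup>2 = (\<integral>x. (f x)\<^sup>2 \<partial>m)"
  by (simp add: L2_norm_def)

lemma L2_mult_integrable:
  assumes "f \<in> L2 m" "g \<in> L2 m"
  shows "integrable m (\<lambda>x. f x * g x)"
proof (rule Bochner_Integration.integrable_bound)
  show "integrable m (\<lambda>x. (f x)\<^sup>2 + (g x)\<^sup>2)"
    using assms by (auto simp: L2_def)
  show "(\<lambda>x. f x * g x) \<in> borel_measurable m"
    using assms by (auto simp: L2_def)
  have "norm (f x * g x) \<le> norm ((f x)\<^sup>2 + (g x)\<^sup>2)" for x
  proof -
    have "2 * (\<bar>f x\<bar> * \<bar>g x\<bar>) \<le> (f x)\<^sup>2 + (g x)\<^sup>2"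
      using sum_squares_bound[of "\<bar>f x\<bar>" "\<bar>g x\<bar>"] by simp
    moreover have "0 \<le> \<bar>f x\<bar> * \<bar>g x\<bar>" by simp
    ultimately have "\<bar>f x\<bar> * \<bar>g x\<bar> \<le> (f x)\<^sup>2 + (g x)\<^sup>2" by linarith
    then show ?thesis by (simp add: abs_mult)
  qed
  then show "AE x in m. norm (f x * g x) \<le> norm ((f x)\<^sup>2 + (g x)\<^sup>2)" by simp
qed

lemma L2_lincomb:
  assumes "f \<in> L2 m" "g \<in> L2 m"
  shows "(\<lambda>x. a * f x + b * g x) \<in> L2 m"
proof -
  have "integrable m (\<lambda>x. a\<^sup>2 * (f x)\<^sup>2 + b\<^sup>2 * (g x)\<^sup>2 + 2 * a * b * (f x * g x))"
    using assms L2_mult_integrable[OF assms] by (auto simp: L2_def)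
  moreover have "(\<lambda>x. a\<^sup>2 * (f x)\<^sup>2 + b\<^sup>2 * (g x)\<^sup>2 + 2 * a * b * (f x * g x)) = (\<lambda>x. (a * f x + b * g x)\<^sup>2)"
    by (auto simp: power2_eq_square algebra_simps)
  ultimately show ?thesis
    using assms by (auto simp: L2_def)
qed

lemma L2_scale: "f \<in> L2 m \<Longrightarrow> (\<lambda>x. a * f x) \<in> L2 m"
  using L2_lincomb[of f m f a 0] by simp

lemma L2_add: "f \<in> L2 m \<Longrightarrow> g \<in> L2 m \<Longrightarrow> (\<lambda>x. f x + g x) \<in> L2 m"
  using L2_lincomb[of f m g 1 1] by simp

lemma L2_diff: "f \<in> L2 m \<Longrightarrow> g \<in> L2 m \<Longrightarrow> (\<lambda>x. f x - g x) \<in> L2 m"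
  using L2_lincomb[of f m g 1 "-1"] by simp

lemma L2_bound:
  assumes "g \<in> L2 m" "f \<in> borel_measurable m" "AE x in m. \<bar>f x\<bar> \<le> \<bar>g x\<bar>"
  shows "f \<in> L2 m" "L2_norm m f \<le> L2_norm m g"
proof -
  have le: "AE x in m. (f x)\<^sup>2 \<le> (g x)\<^sup>2"
    using assms(3) by eventually_elim (simp add: abs_le_square_iff)
  have i: "integrable m (\<lambda>x. (f x)\<^sup>2)"
    by (rule Bochner_Integration.integrable_bound[OF L2_integrable_sq[OF assms(1)]])
       (use assms(2) le in auto)
  then show "f \<in> L2 m" using assms by (auto simp: L2_def)
  show "L2_norm m f \<le> L2_norm m g"
    unfolding L2_norm_def
    by (intro real_sqrt_le_mono integral_mono_AE i L2_integrable_sq assms le)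
qed

lemma L2_abs: "f \<in> L2 m \<Longrightarrow> (\<lambda>x. \<bar>f x\<bar>) \<in> L2 m"
  by (rule L2_bound[of f]) (auto simp: L2_def)

lemma L2_cong_AE:
  assumes "f \<in> L2 m" "g \<in> borel_measurable m" "AE x in m. f x = g x"
  shows "g \<in> L2 m"
proof (rule L2_bound(1)[OF assms(1,2)])
  show "AE x in m. \<bar>g x\<bar> \<le> \<bar>f x\<bar>" using assms(3) by eventually_elim simp
qed

lemma L2_norm_cong_AE:
  assumes "f \<in> borel_measurable m" "g \<in> borel_measurable m" "AE x in m. f x = g x"
  shows "L2_norm m f = L2_norm m g"
proof -
  have "AE x in m. (f x)\<^sup>2 = (g x)\<^sup>2" using assms(3) by eventually_elim simp
  then show ?thesis
    unfolding L2_norm_def using assms by (subst integral_cong_AE[where g = "\<lambda>x. (g x)\<^sup>2"]) auto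
qed

text \<open>The quadratic form (s, t) \<mapsto> \<integral>(s f + t g)^2 is nonnegative and is
  evaluated at one pair. The case \<integral>g^2 = 0, in which that pair gives nothing, is treated
  apart.\<close>

lemma L2_Cauchy_Schwarz:
  assumes "f \<in> L2 m" "g \<in> L2 m"
  shows "\<bar>\<integral>x. f x * g x \<partial>m\<bar> \<le> L2_norm m f * L2_norm m g"
proof -
  let ?a = "\<integral>x. (f x)\<^sup>2 \<partial>m" and ?b = "\<integral>x. (g x)\<^sup>2 \<partial>m" and ?c = "\<integral>x. f x * g x \<partial>m"
  have q: "0 \<le> s\<^sup>2 * ?a + t\<^sup>2 * ?b + 2 * s * t * ?c" for s t
  proof -
    have "(\<integral>x. (s * f x + t * g x)\<^sup>2 \<partial>m) = (\<integral>x. s\<^sup>2 * (f x)\<^sup>2 + t\<^sup>2 * (g x)\<^sup>2 + 2 * s * t * (f x * g x) \<partial>m)"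
      by (rule Bochner_Integration.integral_cong) (auto simp: power2_eq_square algebra_simps)
    also have "\<dots> = s\<^sup>2 * ?a + t\<^sup>2 * ?b + 2 * s * t * ?c"
      using assms L2_mult_integrable[OF assms] by (simp add: L2_def)
    finally have eq: "\<dots> = (\<integral>x. (s * f x + t * g x)\<^sup>2 \<partial>m)" by (rule sym)
    show ?thesis unfolding eq by (rule integral_nonneg_AE) simp
  qed
  have "?c\<^sup>2 \<le> ?a * ?b"
  proof (cases "?b = 0")
    case True
    have "0 \<le> 1 * ?a + 2 * t * ?c" for t using q[of 1 t] True by simp
    \<comment> \<open>For c \<noteq> 0 this t turns a + 2 t c into -1.\<close>
    from this[of "- (?a + 1) * ?c / (2 * ?c\<^sup>2)"] have "?c = 0"
      by (cases "?c = 0") (auto simp: field_simps power2_eq_square)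
    then show ?thesis using True by simp
  next
    case False
    have "0 \<le> ?b" by simp
    with False have b: "0 < ?b" by linarith
    \<comment> \<open>The pair (b, -c) consists, up to scale, of the coefficients of f minus its
      projection onto g; the form takes the value b (a b - c^2) there.\<close>
    have "0 \<le> ?b\<^sup>2 * ?a + ?c\<^sup>2 * ?b + 2 * ?b * (- ?c) * ?c" using q[of ?b "- ?c"] by simp
    also have "\<dots> = ?b * (?a * ?b - ?c\<^sup>2)" by (simp add: power2_eq_square algebra_simps)
    finally show ?thesis using b by (simp add: zero_le_mult_iff)
  qed
  then have "sqrt (?c\<^sup>2) \<le> sqrt (?a * ?b)" by (rule real_sqrt_le_mono)
  then show ?thesis by (simp add: L2_norm_def real_sqrt_mult)
qed

lemma L2_norm_add_sq:
  assumes "f \<in> L2 m" "g \<in> L2 m"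
  shows "(L2_norm m (\<lambda>x. f x + t * g x))\<^sup>2 = (L2_norm m f)\<^sup>2 + 2 * t * (\<integral>x. f x * g x \<partial>m) + t\<^sup>2 * (L2_norm m g)\<^sup>2"
proof -
  have "(\<integral>x. (f x + t * g x)\<^sup>2 \<partial>m) = (\<integral>x. (f x)\<^sup>2 + 2 * t * (f x * g x) + t\<^sup>2 * (g x)\<^sup>2 \<partial>m)"
    by (rule Bochner_Integration.integral_cong) (auto simp: power2_eq_square algebra_simps)
  also have "\<dots> = (\<integral>x. (f x)\<^sup>2 \<partial>m) + 2 * t * (\<integral>x. f x * g x \<partial>m) + t\<^sup>2 * (\<integral>x. (g x)\<^sup>2 \<partial>m)"
    using assms L2_mult_integrable[OF assms] by (simp add: L2_def)
  finally show ?thesis by (simp add: L2_norm_sq)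
qed

lemma L2_norm_triangle:
  assumes "f \<in> L2 m" "g \<in> L2 m"
  shows "L2_norm m (\<lambda>x. f x + g x) \<le> L2_norm m f + L2_norm m g"
proof (rule power2_le_imp_le)
  have "(L2_norm m (\<lambda>x. f x + g x))\<^sup>2 \<le> (L2_norm m f)\<^sup>2 + 2 * (L2_norm m f * L2_norm m g) + (L2_norm m g)\<^sup>2"
    using L2_norm_add_sq[OF assms, of 1] L2_Cauchy_Schwarz[OF assms] by simp
  then show "(L2_norm m (\<lambda>x. f x + g x))\<^sup>2 \<le> (L2_norm m f + L2_norm m g)\<^sup>2"
    by (simp add: power2_eq_square algebra_simps)
qed simp

lemma L2_norm_scale: "L2_norm m (\<lambda>x. c * f x) = \<bar>c\<bar> * L2_norm m f"
  by (simp add: L2_norm_def power_mult_distrib real_sqrt_mult)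

lemma L2_norm_minus_commute: "L2_norm m (\<lambda>x. f x - g x) = L2_norm m (\<lambda>x. g x - f x)"
  by (simp add: L2_norm_def power2_commute)

lemma L2_norm_triangle_diff:
  assumes "f \<in> L2 m" "g \<in> L2 m" "k \<in> L2 m"
  shows "L2_norm m (\<lambda>x. f x - k x) \<le> L2_norm m (\<lambda>x. f x - g x) + L2_norm m (\<lambda>x. g x - k x)"
  using L2_norm_triangle[OF L2_diff[OF assms(1,2)] L2_diff[OF assms(2,3)]] by simp

lemma L2_norm_reverse_triangle:
  assumes "f \<in> L2 m" "g \<in> L2 m"
  shows "\<bar>L2_norm m f - L2_norm m g\<bar> \<le> L2_norm m (\<lambda>x. f x - g x)"
  using L2_norm_triangle[OF L2_diff[OF assms] assms(2)]
    L2_norm_triangle[OF L2_diff[OF assms(2,1)] assms(1)] L2_norm_minus_commute[of m f g]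
  by simp

lemma L2_norm_mult_bounded:
  assumes "g \<in> L2 m" "h \<in> borel_measurable m" "AE x in m. \<bar>h x\<bar> \<le> C" "0 \<le> C"
  shows "(\<lambda>x. h x * g x) \<in> L2 m" "L2_norm m (\<lambda>x. h x * g x) \<le> C * L2_norm m g"
proof -
  have le: "AE x in m. \<bar>h x * g x\<bar> \<le> \<bar>C * g x\<bar>"
    using assms(3) by eventually_elim (use assms(4) in \<open>auto simp: abs_mult intro: mult_right_mono\<close>)
  have m: "(\<lambda>x. h x * g x) \<in> borel_measurable m" using assms by (auto simp: L2_def)
  show "(\<lambda>x. h x * g x) \<in> L2 m" by (rule L2_bound(1)[OF L2_scale[OF assms(1)] m le])
  show "L2_norm m (\<lambda>x. h x * g x) \<le> C * L2_norm m g"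
    using L2_bound(2)[OF L2_scale[OF assms(1)] m le] assms(4) by (simp add: L2_norm_scale)
qed

lemma L2_norm_abs: "L2_norm m (\<lambda>x. \<bar>f x\<bar>) = L2_norm m f"
  by (simp add: L2_norm_def)

lemma L2_norm_le_add:
  assumes "p \<in> L2 m" "q \<in> L2 m" "h \<in> borel_measurable m" "AE x in m. \<bar>h x\<bar> \<le> \<bar>p x\<bar> + \<bar>q x\<bar>"
  shows "L2_norm m h \<le> L2_norm m p + L2_norm m q"
proof -
  have "L2_norm m h \<le> L2_norm m (\<lambda>x. \<bar>p x\<bar> + \<bar>q x\<bar>)"
    by (rule L2_bound(2)[OF L2_add[OF L2_abs[OF assms(1)] L2_abs[OF assms(2)]] assms(3)])
       (use assms(4) in simp)
  also have "\<dots> \<le> L2_norm m p + L2_norm m q"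
    using L2_norm_triangle[OF L2_abs[OF assms(1)] L2_abs[OF assms(2)]] by (simp add: L2_norm_abs)
  finally show ?thesis .
qed

lemma L2_norm_zero_AE:
  assumes "f \<in> L2 m" "L2_norm m f = 0"
  shows "AE x in m. f x = 0"
proof -
  have "(\<integral>x. (f x)\<^sup>2 \<partial>m) = 0" using assms by (simp add: L2_norm_def)
  then have "AE x in m. (f x)\<^sup>2 = 0"
    by (subst (asm) integral_nonneg_eq_0_iff_AE) (use assms in \<open>auto simp: L2_def\<close>)
  then show ?thesis by simp
qed

lemma L2_tendsto_iff:
  assumes "\<And>n. fs n \<in> L2 m" "f \<in> L2 m"
  shows "L2_tendsto m fs f \<longleftrightarrow> (\<lambda>n. L2_norm m (\<lambda>x. fs n x - f x)) \<longlonglongrightarrow> 0"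
proof -
  have "(\<integral>\<^sup>+x. ennreal ((fs n x - f x)\<^sup>2) \<partial>m) = ennreal ((L2_norm m (\<lambda>x. fs n x - f x))\<^sup>2)" for n
    unfolding L2_norm_sq
    by (rule nn_integral_eq_integral) (use L2_diff[OF assms(1) assms(2)] in \<open>auto simp: L2_def\<close>)
  then have "L2_tendsto m fs f \<longleftrightarrow> (\<lambda>n. ennreal ((L2_norm m (\<lambda>x. fs n x - f x))\<^sup>2)) \<longlonglongrightarrow> ennreal 0"
    by (simp add: L2_tendsto_def)
  also have "\<dots> \<longleftrightarrow> (\<lambda>n. (L2_norm m (\<lambda>x. fs n x - f x))\<^sup>2) \<longlonglongrightarrow> 0"
    by (subst tendsto_ennreal_iff) auto
  also have "\<dots> \<longleftrightarrow> (\<lambda>n. L2_norm m (\<lambda>x. fs n x - f x)) \<longlonglongrightarrow> 0"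
  proof
    assume "(\<lambda>n. (L2_norm m (\<lambda>x. fs n x - f x))\<^sup>2) \<longlonglongrightarrow> 0"
    then have "(\<lambda>n. sqrt ((L2_norm m (\<lambda>x. fs n x - f x))\<^sup>2)) \<longlonglongrightarrow> sqrt 0"
      by (rule tendsto_real_sqrt)
    then show "(\<lambda>n. L2_norm m (\<lambda>x. fs n x - f x)) \<longlonglongrightarrow> 0" by simp
  next
    assume "(\<lambda>n. L2_norm m (\<lambda>x. fs n x - f x)) \<longlonglongrightarrow> 0"
    from tendsto_power[OF this, of 2] show "(\<lambda>n. (L2_norm m (\<lambda>x. fs n x - f x))\<^sup>2) \<longlonglongrightarrow> 0"
      by simp
  qed
  finally show ?thesis .
qed

lemma L2_norm_tendsto:
  assumes "\<And>n. fs n \<in> L2 m" "f \<in> L2 m" "(\<lambda>n. L2_norm m (\<lambda>x. fs n x - f x)) \<longlonglongrightarrow> 0"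
  shows "(\<lambda>n. L2_norm m (fs n)) \<longlonglongrightarrow> L2_norm m f"
proof -
  have "(\<lambda>n. L2_norm m (fs n) - L2_norm m f) \<longlonglongrightarrow> 0"
    by (rule Lim_null_comparison[OF _ assms(3)]) (simp add: L2_norm_reverse_triangle assms)
  then show ?thesis by (simp add: LIM_zero_iff)
qed

lemma L2_inner_tendsto:
  assumes "\<And>n. fs n \<in> L2 m" "f \<in> L2 m" "g \<in> L2 m" "(\<lambda>n. L2_norm m (\<lambda>x. fs n x - f x)) \<longlonglongrightarrow> 0"
  shows "(\<lambda>n. \<integral>x. fs n x * g x \<partial>m) \<longlonglongrightarrow> (\<integral>x. f x * g x \<partial>m)"
proof -
  have "(\<lambda>n. (\<integral>x. fs n x * g x \<partial>m) - (\<integral>x. f x * g x \<partial>m)) \<longlonglongrightarrow> 0"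
  proof (rule Lim_null_comparison)
    have "(\<integral>x. fs n x * g x \<partial>m) - (\<integral>x. f x * g x \<partial>m) = (\<integral>x. (fs n x - f x) * g x \<partial>m)" for n
      by (subst Bochner_Integration.integral_diff[symmetric])
         (auto simp: left_diff_distrib intro!: L2_mult_integrable assms)
    then show "\<forall>\<^sub>F n in sequentially. norm ((\<integral>x. fs n x * g x \<partial>m) - (\<integral>x. f x * g x \<partial>m))
        \<le> L2_norm m (\<lambda>x. fs n x - f x) * L2_norm m g"
      using L2_Cauchy_Schwarz[OF L2_diff[OF assms(1,2)] assms(3)] by simp
    show "(\<lambda>n. L2_norm m (\<lambda>x. fs n x - f x) * L2_norm m g) \<longlonglongrightarrow> 0"
      using tendsto_mult_right[OF assms(4), of "L2_norm m g"] by simp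
  qed
  then show ?thesis by (simp add: LIM_zero_iff)
qed

text \<open>This is the parallelogram law. The deficit of a quarter of the squared distance is the
  uniform convexity by which minimising sequences become Cauchy.\<close>

lemma L2_mid_sq:
  assumes "f \<in> L2 m" "g \<in> L2 m"
  shows "(L2_norm m (\<lambda>x. (f x + g x) / 2))\<^sup>2
    = (L2_norm m f)\<^sup>2 / 2 + (L2_norm m g)\<^sup>2 / 2 - (L2_norm m (\<lambda>x. f x - g x))\<^sup>2 / 4"
proof -
  have "L2_norm m (\<lambda>x. (f x + g x) / 2) = L2_norm m (\<lambda>x. f x + 1 * g x) / 2"
    using L2_norm_scale[of m "1/2" "\<lambda>x. f x + 1 * g x"] by (simp add: field_simps)
  moreover have "L2_norm m (\<lambda>x. f x - g x) = L2_norm m (\<lambda>x. f x + (-1) * g x)" by simp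
  ultimately have "(L2_norm m (\<lambda>x. (f x + g x) / 2))\<^sup>2 = (L2_norm m (\<lambda>x. f x + 1 * g x))\<^sup>2 / 4"
    "(L2_norm m (\<lambda>x. f x - g x))\<^sup>2 = (L2_norm m (\<lambda>x. f x + (-1) * g x))\<^sup>2"
    by (simp_all only: power_divide) simp
  then show ?thesis
    using L2_norm_add_sq[OF assms, of 1] L2_norm_add_sq[OF assms, of "-1"]
    by (simp add: add_divide_distrib diff_divide_distrib)
qed

section \<open>Completeness and minimisation in L2 of a finite measure\<close>

context finite_measure
begin

lemma L2_bounded:
  assumes "f \<in> borel_measurable M" "AE x in M. \<bar>f x\<bar> \<le> C"
  shows "f \<in> L2 M"
proof -
  have "integrable M (\<lambda>x. (f x)\<^sup>2)"
  proof (rule integrable_const_bound[where B = "C\<^sup>2"])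
    show "AE x in M. norm ((f x)\<^sup>2) \<le> C\<^sup>2"
      using assms(2) by eventually_elim (simp add: abs_le_square_iff[symmetric])
  qed (use assms in auto)
  then show ?thesis using assms by (auto simp: L2_def)
qed

lemma L2_between:
  assumes "f \<in> borel_measurable M" "\<And>x. c \<le> f x" "\<And>x. f x \<le> d"
  shows "f \<in> L2 M"
proof (rule L2_bounded[OF assms(1)], rule AE_I2)
  fix x show "\<bar>f x\<bar> \<le> \<bar>c\<bar> + \<bar>d\<bar>" using assms(2,3)[of x] by linarith
qed

lemma L2_const: "(\<lambda>x. c) \<in> L2 M"
  by (rule L2_bounded[where C = "\<bar>c\<bar>"]) auto

lemma L2_integrable: "f \<in> L2 M \<Longrightarrow> integrable M f"
  using L2_mult_integrable[of f M "\<lambda>x. 1"] L2_const by simp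

text \<open>On a finite measure space the L1 distance is at most the L2 distance times the norm of
  1, so an L2 Cauchy sequence is L1 Cauchy and has an a.e. convergent subsequence. Fatou's lemma
  along that subsequence transfers the Cauchy estimates to the limit.\<close>

lemma L2_complete:
  assumes L: "\<And>n. f n \<in> L2 M"
    and C: "\<And>e. 0 < e \<Longrightarrow> \<exists>n0. \<forall>i\<ge>n0. \<forall>j\<ge>n0. L2_norm M (\<lambda>x. f i x - f j x) < e"
  obtains F where "F \<in> L2 M" "(\<lambda>n. L2_norm M (\<lambda>x. f n x - F x)) \<longlonglongrightarrow> 0"
    "\<exists>r. strict_mono r \<and> (AE x in M. (\<lambda>n. f (r n) x) \<longlonglongrightarrow> F x)"
proof -
  define B where "B = L2_norm M (\<lambda>x. 1)"
  have B0: "0 \<le> B" by (simp add: B_def)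
  have l1: "(\<integral>x. norm (f i x - f j x) \<partial>M) \<le> L2_norm M (\<lambda>x. f i x - f j x) * B" for i j
  proof -
    have "(\<integral>x. norm (f i x - f j x) * 1 \<partial>M) \<le> L2_norm M (\<lambda>x. \<bar>f i x - f j x\<bar>) * B"
      using L2_Cauchy_Schwarz[OF L2_abs[OF L2_diff[OF L L]] L2_const, of i j 1]
      unfolding B_def real_norm_def by (rule order_trans[OF abs_ge_self])
    then show ?thesis by (simp add: L2_norm_def)
  qed
  obtain r where r: "strict_mono r" "AE x in M. Cauchy (\<lambda>i. f (r i) x)"
  proof (rule cauchy_L1_AE_cauchy_subseq[of M f])
    show "integrable M (f n)" for n by (rule L2_integrable[OF L])
    fix e :: real assume e: "0 < e"
    \<comment> \<open>Dividing by B + 1 covers the null measure, for which B = 0.\<close>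
    with B0 have "0 < e / (B + 1)" by simp
    from C[OF this] obtain n0 where n0: "\<forall>i\<ge>n0. \<forall>j\<ge>n0. L2_norm M (\<lambda>x. f i x - f j x) < e / (B + 1)" by blast
    have "(\<integral>x. norm (f i x - f j x) \<partial>M) < e" if "i \<ge> n0" "j \<ge> n0" for i j
    proof -
      have "(\<integral>x. norm (f i x - f j x) \<partial>M) \<le> L2_norm M (\<lambda>x. f i x - f j x) * B" by (rule l1)
      also have "\<dots> \<le> e / (B + 1) * B" using n0 that B0 by (intro mult_right_mono) (auto intro: less_imp_le)
      also have "\<dots> < e" using e B0 by (simp add: field_simps)
      finally show ?thesis .
    qed
    then show "\<exists>N. \<forall>i\<ge>N. \<forall>j\<ge>N. (\<integral>x. norm (f i x - f j x) \<partial>M) < e" by blast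
  qed auto
  define F where "F x = lim (\<lambda>i. f (r i) x)" for x
  have Fm: "F \<in> borel_measurable M"
    unfolding F_def using L by (intro borel_measurable_lim_metric) (auto simp: L2_def)
  have conv: "AE x in M. (\<lambda>i. f (r i) x) \<longlonglongrightarrow> F x"
    using r(2) by eventually_elim (simp add: F_def convergent_LIMSEQ_iff[symmetric] Cauchy_convergent_iff)
  have key: "(\<integral>\<^sup>+x. ennreal ((f n x - F x)\<^sup>2) \<partial>M) \<le> ennreal (e\<^sup>2)"
    if n: "\<forall>j\<ge>n0. L2_norm M (\<lambda>x. f n x - f j x) < e" for n n0 e
  proof -
    have "(\<integral>\<^sup>+x. ennreal ((f n x - F x)\<^sup>2) \<partial>M) = (\<integral>\<^sup>+x. liminf (\<lambda>i. ennreal ((f n x - f (r i) x)\<^sup>2)) \<partial>M)"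
    proof (rule nn_integral_cong_AE)
      show "AE x in M. ennreal ((f n x - F x)\<^sup>2) = liminf (\<lambda>i. ennreal ((f n x - f (r i) x)\<^sup>2))"
        using conv
      proof eventually_elim
        case (elim x)
        then have "(\<lambda>i. ennreal ((f n x - f (r i) x)\<^sup>2)) \<longlonglongrightarrow> ennreal ((f n x - F x)\<^sup>2)"
          by (intro tendsto_intros tendsto_ennrealI)
        then show ?case by (intro lim_imp_Liminf[symmetric]) auto
      qed
    qed
    also have "\<dots> \<le> liminf (\<lambda>i. \<integral>\<^sup>+x. ennreal ((f n x - f (r i) x)\<^sup>2) \<partial>M)"
      using L[THEN L2_measurable] by (intro nn_integral_liminf) measurable
    also have "\<dots> \<le> ennreal (e\<^sup>2)"
    proof (rule order_trans[OF Liminf_le_Limsup Limsup_bounded], simp, rule eventually_sequentiallyI[of n0])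
      fix i assume "n0 \<le> i"
      then have "n0 \<le> r i" using seq_suble[OF r(1), of i] by simp
      then have "L2_norm M (\<lambda>x. f n x - f (r i) x) < e" using n by auto
      moreover have "(\<integral>\<^sup>+x. ennreal ((f n x - f (r i) x)\<^sup>2) \<partial>M) = ennreal ((L2_norm M (\<lambda>x. f n x - f (r i) x))\<^sup>2)"
        unfolding L2_norm_sq
        by (rule nn_integral_eq_integral) (use L2_diff[OF L L, of n "r i"] in \<open>auto simp: L2_def\<close>)
      ultimately show "(\<integral>\<^sup>+x. ennreal ((f n x - f (r i) x)\<^sup>2) \<partial>M) \<le> ennreal (e\<^sup>2)"
        by (simp add: ennreal_leI power_mono)
    qed
    finally show ?thesis .
  qed
  have dL: "(\<lambda>x. f n x - F x) \<in> L2 M" and dn: "L2_norm M (\<lambda>x. f n x - F x) \<le> e"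
    if n: "\<forall>j\<ge>n0. L2_norm M (\<lambda>x. f n x - f j x) < e" for n n0 e
  proof -
    have m: "(\<lambda>x. f n x - F x) \<in> borel_measurable M"
      by (intro borel_measurable_diff L2_measurable[OF L] Fm)
    have "integrable M (\<lambda>x. (f n x - F x)\<^sup>2)"
      by (rule integrableI_bounded) (use m key[OF n] in \<open>auto intro: order_le_less_trans\<close>)
    then show d: "(\<lambda>x. f n x - F x) \<in> L2 M" using m by (simp add: L2_def)
    have "ennreal ((L2_norm M (\<lambda>x. f n x - F x))\<^sup>2) \<le> ennreal (e\<^sup>2)"
      using key[OF n] unfolding L2_norm_sq
      by (subst (asm) nn_integral_eq_integral) (use d in \<open>auto simp: L2_def\<close>)
    moreover have "0 < e" using n L2_norm_nonneg by (meson le_refl order_le_less_trans)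
    ultimately show "L2_norm M (\<lambda>x. f n x - F x) \<le> e"
      by (simp add: ennreal_le_iff abs_le_square_iff[symmetric])
  qed
  have FL: "F \<in> L2 M"
  proof -
    from C[OF zero_less_one] obtain n0 where "\<forall>i\<ge>n0. \<forall>j\<ge>n0. L2_norm M (\<lambda>x. f i x - f j x) < 1" ..
    then have "\<forall>j\<ge>n0. L2_norm M (\<lambda>x. f n0 x - f j x) < 1" by simp
    from L2_diff[OF L dL[OF this], of n0] show ?thesis by simp
  qed
  moreover have "(\<lambda>n. L2_norm M (\<lambda>x. f n x - F x)) \<longlonglongrightarrow> 0"
  proof (rule LIMSEQ_I)
    fix e :: real assume "0 < e"
    then obtain n0 where n0: "\<forall>i\<ge>n0. \<forall>j\<ge>n0. L2_norm M (\<lambda>x. f i x - f j x) < e / 2"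
      using C[of "e / 2"] by auto
    have "L2_norm M (\<lambda>x. f n x - F x) < e" if "n \<ge> n0" for n
    proof -
      from n0 that have "\<forall>j\<ge>n0. L2_norm M (\<lambda>x. f n x - f j x) < e / 2" by blast
      from dn[OF this] \<open>0 < e\<close> show ?thesis by linarith
    qed
    then show "\<exists>n0. \<forall>n\<ge>n0. norm (L2_norm M (\<lambda>x. f n x - F x) - 0) < e" by auto
  qed
  ultimately show thesis using r(1) conv that by blast
qed

text \<open>Controls a product in which G is merely in L2, while h is small in L2 and only bounded
  uniformly. If G is cut at height k, the tail has small norm and is multiplied by at most C, and
  the bounded part contributes at most k times the norm of h.\<close>

lemma L2_absolutely_continuous:
  assumes G: "G \<in> L2 M" and e: "0 < e" and C: "0 \<le> C"
  obtains d where "0 < d"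
    "\<And>h. h \<in> borel_measurable M \<Longrightarrow> (\<And>x. \<bar>h x\<bar> \<le> C) \<Longrightarrow> L2_norm M h < d \<Longrightarrow> L2_norm M (\<lambda>x. h x * G x) < e"
proof -
  let ?T = "\<lambda>k::nat. \<lambda>x. if \<bar>G x\<bar> \<le> real k then 0 else G x"
  have Gm: "G \<in> borel_measurable M" using G by (simp add: L2_def)
  have Tm: "?T k \<in> borel_measurable M" for k using Gm by measurable
  have TL: "?T k \<in> L2 M" for k by (rule L2_bound(1)[OF G Tm]) auto
  have "(\<lambda>k. \<integral>x. (?T k x)\<^sup>2 \<partial>M) \<longlonglongrightarrow> (\<integral>x. 0 \<partial>M)"
  proof (rule integral_dominated_convergence[where w = "\<lambda>x. (G x)\<^sup>2"])
    show "AE x in M. (\<lambda>k. (?T k x)\<^sup>2) \<longlonglongrightarrow> 0"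
    proof (rule AE_I2, rule tendsto_eventually, rule eventually_sequentiallyI)
      fix x k assume "nat \<lceil>\<bar>G x\<bar>\<rceil> \<le> k"
      then show "(?T k x)\<^sup>2 = 0" by (auto simp: nat_le_iff ceiling_le_iff)
    qed
  qed (use G Tm in \<open>auto simp: L2_def\<close>)
  then have "(\<lambda>k. L2_norm M (?T k)) \<longlonglongrightarrow> 0"
    unfolding L2_norm_def by (auto dest: tendsto_real_sqrt)
  then have "(\<lambda>k. C * L2_norm M (?T k)) \<longlonglongrightarrow> 0"
    using tendsto_mult_right_zero by blast
  then obtain k where k: "C * L2_norm M (?T k) < e / 2"
    using order_tendstoD(2)[of _ 0 sequentially "e / 2"] e by (auto simp: eventually_sequentially)
  \<comment> \<open>With k + 1 in the denominator, k d \<le> e / 2 also for k = 0.\<close>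
  define d where "d = e / (2 * (real k + 1))"
  have d: "0 < d" using e by (simp add: d_def)
  moreover have "L2_norm M (\<lambda>x. h x * G x) < e"
    if hm: "h \<in> borel_measurable M" and hC: "\<And>x. \<bar>h x\<bar> \<le> C" and hd: "L2_norm M h < d" for h
  proof -
    have hL: "h \<in> L2 M" using hm hC by (auto intro: L2_bounded)
    let ?S = "\<lambda>x. G x - ?T k x"
    have Sm: "?S \<in> borel_measurable M" using Gm Tm by auto
    have "AE x in M. \<bar>?S x\<bar> \<le> real k" by auto
    from L2_norm_mult_bounded[OF hL Sm this]
    have S: "(\<lambda>x. ?S x * h x) \<in> L2 M" "L2_norm M (\<lambda>x. ?S x * h x) \<le> real k * L2_norm M h"
      by simp_all
    have "AE x in M. \<bar>h x\<bar> \<le> C" using hC by simp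
    from L2_norm_mult_bounded[OF TL hm this C]
    have T: "(\<lambda>x. h x * ?T k x) \<in> L2 M" "L2_norm M (\<lambda>x. h x * ?T k x) \<le> C * L2_norm M (?T k)"
      by simp_all
    have "L2_norm M (\<lambda>x. h x * G x) = L2_norm M (\<lambda>x. ?S x * h x + h x * ?T k x)"
      by (simp add: algebra_simps)
    also have "\<dots> \<le> real k * L2_norm M h + C * L2_norm M (?T k)"
      using L2_norm_triangle[OF S(1) T(1)] S(2) T(2) by linarith
    also have "real k * L2_norm M h \<le> real k * d" using hd by (intro mult_left_mono) auto
    also have "real k * d \<le> e / 2" using e by (simp add: d_def field_simps)
    finally show ?thesis using k by linarith
  qed
  ultimately show thesis using that by blast
qed

text \<open>Minimising sequences for a uniformly convex functional are Cauchy. The pair of maps serves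
  functionals of a function together with its gradient.\<close>

lemma L2_minimising_sequence:
  assumes ne: "I \<noteq> {}"
    and L: "\<And>i. i \<in> I \<Longrightarrow> P i \<in> L2 M" "\<And>i. i \<in> I \<Longrightarrow> Q i \<in> L2 M"
    and mid: "\<And>i j. i \<in> I \<Longrightarrow> j \<in> I \<Longrightarrow> \<exists>k\<in>I. (L2_norm M (P k))\<^sup>2 + (L2_norm M (Q k))\<^sup>2
        \<le> (L2_norm M (\<lambda>x. (P i x + P j x) / 2))\<^sup>2 + (L2_norm M (\<lambda>x. (Q i x + Q j x) / 2))\<^sup>2"
  obtains s p q where "\<And>n::nat. s n \<in> I" "p \<in> L2 M" "q \<in> L2 M"
    "(\<lambda>n. L2_norm M (\<lambda>x. P (s n) x - p x)) \<longlonglongrightarrow> 0" "(\<lambda>n. L2_norm M (\<lambda>x. Q (s n) x - q x)) \<longlonglongrightarrow> 0"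
    "\<And>i. i \<in> I \<Longrightarrow> (L2_norm M p)\<^sup>2 + (L2_norm M q)\<^sup>2 \<le> (L2_norm M (P i))\<^sup>2 + (L2_norm M (Q i))\<^sup>2"
proof -
  define J where "J i = (L2_norm M (P i))\<^sup>2 + (L2_norm M (Q i))\<^sup>2" for i
  define d where "d = Inf (J ` I)"
  have bdd: "bdd_below (J ` I)" by (rule bdd_belowI[of _ 0]) (auto simp: J_def)
  have dle: "d \<le> J i" if "i \<in> I" for i unfolding d_def by (rule cInf_lower[OF _ bdd]) (use that in auto)
  have "\<exists>i\<in>I. J i < d + 1 / real (Suc n)" for n
    using cInf_lessD[of "J ` I" "d + 1 / real (Suc n)"] ne by (auto simp: d_def)
  then obtain s where s: "\<And>n. s n \<in> I" "\<And>n. J (s n) < d + 1 / real (Suc n)" by metis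
  \<comment> \<open>The competitor k for the midpoint has energy at least d, while both ends have
    energy at most d + 1 / (n + 1); the parallelogram law leaves at most 1 / (n + 1) for a quarter
    of the sum of the squared distances.\<close>
  have est: "(L2_norm M (\<lambda>x. P (s i) x - P (s j) x))\<^sup>2 + (L2_norm M (\<lambda>x. Q (s i) x - Q (s j) x))\<^sup>2
      \<le> 4 / real (Suc n)" if ij: "n \<le> i" "n \<le> j" for i j n
  proof -
    from mid[OF s(1)[of i] s(1)[of j]] obtain k where k: "k \<in> I"
      "J k \<le> (L2_norm M (\<lambda>x. (P (s i) x + P (s j) x) / 2))\<^sup>2 + (L2_norm M (\<lambda>x. (Q (s i) x + Q (s j) x) / 2))\<^sup>2"
      by (auto simp: J_def)
    have "1 / real (Suc i) \<le> 1 / real (Suc n)" "1 / real (Suc j) \<le> 1 / real (Suc n)"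
      using ij by (auto simp: frac_le)
    then have "J (s i) \<le> d + 1 / real (Suc n)" "J (s j) \<le> d + 1 / real (Suc n)"
      using s(2)[of i] s(2)[of j] by linarith+
    moreover have "4 / real (Suc n) = 4 * (1 / real (Suc n))" by simp
    ultimately show ?thesis
      using k(2) dle[OF k(1)]
      unfolding L2_mid_sq[OF L(1)[OF s(1)] L(1)[OF s(1)]] L2_mid_sq[OF L(2)[OF s(1)] L(2)[OF s(1)]] J_def
      by linarith
  qed
  have C: "\<exists>n0. \<forall>i\<ge>n0. \<forall>j\<ge>n0. L2_norm M (\<lambda>x. P (s i) x - P (s j) x) < e \<and> L2_norm M (\<lambda>x. Q (s i) x - Q (s j) x) < e"
    if e: "0 < e" for e
  proof -
    obtain n where "4 / e\<^sup>2 < real n" using reals_Archimedean2 by blast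
    then have "4 / e\<^sup>2 < real (Suc n)" by simp
    then have n4: "4 / real (Suc n) < e\<^sup>2" using e by (simp add: field_simps)
    have "L2_norm M (\<lambda>x. P (s i) x - P (s j) x) < e \<and> L2_norm M (\<lambda>x. Q (s i) x - Q (s j) x) < e"
      if "n \<le> i" "n \<le> j" for i j
    proof -
      have "(L2_norm M (\<lambda>x. P (s i) x - P (s j) x))\<^sup>2 < e\<^sup>2" "(L2_norm M (\<lambda>x. Q (s i) x - Q (s j) x))\<^sup>2 < e\<^sup>2"
        using est[OF that] n4 zero_le_power2[of "L2_norm M (\<lambda>x. P (s i) x - P (s j) x)"]
          zero_le_power2[of "L2_norm M (\<lambda>x. Q (s i) x - Q (s j) x)"] by linarith+
      then show ?thesis using e by (auto intro: power2_less_imp_less)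
    qed
    then show ?thesis by blast
  qed
  obtain p where p: "p \<in> L2 M" "(\<lambda>n. L2_norm M (\<lambda>x. P (s n) x - p x)) \<longlonglongrightarrow> 0"
  proof (rule L2_complete[of "\<lambda>n. P (s n)"])
    show "P (s n) \<in> L2 M" for n by (rule L(1)[OF s(1)])
    show "\<exists>n0. \<forall>i\<ge>n0. \<forall>j\<ge>n0. L2_norm M (\<lambda>x. P (s i) x - P (s j) x) < e" if "0 < e" for e
      using C[OF that] by (elim ex_forward) simp
  qed
  obtain q where q: "q \<in> L2 M" "(\<lambda>n. L2_norm M (\<lambda>x. Q (s n) x - q x)) \<longlonglongrightarrow> 0"
  proof (rule L2_complete[of "\<lambda>n. Q (s n)"])
    show "Q (s n) \<in> L2 M" for n by (rule L(2)[OF s(1)])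
    show "\<exists>n0. \<forall>i\<ge>n0. \<forall>j\<ge>n0. L2_norm M (\<lambda>x. Q (s i) x - Q (s j) x) < e" if "0 < e" for e
      using C[OF that] by (elim ex_forward) simp
  qed
  have "(\<lambda>n. J (s n)) \<longlonglongrightarrow> (L2_norm M p)\<^sup>2 + (L2_norm M q)\<^sup>2"
    unfolding J_def using L s(1) p q by (intro tendsto_intros L2_norm_tendsto) auto
  moreover have "(\<lambda>n. d + 1 / real (Suc n)) \<longlonglongrightarrow> d + 0"
    by (intro tendsto_intros inverse_Suc_tendsto)
  ultimately have "(L2_norm M p)\<^sup>2 + (L2_norm M q)\<^sup>2 \<le> d + 0"
    using s(2) by (intro LIMSEQ_le) (auto intro: less_imp_le)
  then have "(L2_norm M p)\<^sup>2 + (L2_norm M q)\<^sup>2 \<le> J i" if "i \<in> I" for i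
    using dle[OF that] by simp
  then show thesis using that[OF s(1) p(1) q(1) p(2) q(2)] by (auto simp: J_def)
qed

text \<open>\<open>p\<close> is the point of the closure of \<open>A\<close> nearest to 0, hence
  only approximated by elements of \<open>A\<close>. The last property is the variational
  inequality: p is compared with p + t (q - p), and t decreases to 0.\<close>

lemma L2_convex_projection:
  assumes ne: "A \<noteq> {}" and L: "A \<subseteq> L2 M"
    and convex: "\<And>a b t. a \<in> A \<Longrightarrow> b \<in> A \<Longrightarrow> 0 \<le> t \<Longrightarrow> t \<le> 1 \<Longrightarrow> (\<lambda>x. (1 - t) * a x + t * b x) \<in> A"
  obtains p where "p \<in> L2 M" "\<forall>e>0. \<exists>a\<in>A. L2_norm M (\<lambda>x. a x - p x) < e"
    "\<forall>q\<in>A. (L2_norm M p)\<^sup>2 \<le> (\<integral>x. p x * q x \<partial>M)"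
proof -
  have z: "(\<lambda>x. 0) \<in> L2 M" by (rule L2_const)
  have hc: "(\<lambda>x. (a x + b x) / 2) \<in> A" if "a \<in> A" "b \<in> A" for a b
    using convex[OF that, of "1/2"] by (simp add: field_simps)
  obtain s p q where s: "\<And>n::nat. s n \<in> A" and p: "p \<in> L2 M"
    "(\<lambda>n. L2_norm M (\<lambda>x. s n x - p x)) \<longlonglongrightarrow> 0"
    and pm: "\<And>i. i \<in> A \<Longrightarrow> (L2_norm M p)\<^sup>2 + (L2_norm M q)\<^sup>2 \<le> (L2_norm M i)\<^sup>2 + (L2_norm M (\<lambda>x. 0))\<^sup>2"
  \<comment> \<open>The second component is the zero function, so only the norm of the elements of
    \<open>A\<close> is minimised.\<close>
  proof (rule L2_minimising_sequence[of A "\<lambda>a. a" "\<lambda>a x. 0"])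
    fix i j assume "i \<in> A" "j \<in> A"
    then show "\<exists>k\<in>A. (L2_norm M k)\<^sup>2 + (L2_norm M (\<lambda>x. 0))\<^sup>2
        \<le> (L2_norm M (\<lambda>x. (i x + j x) / 2))\<^sup>2 + (L2_norm M (\<lambda>x. (0 + 0) / 2))\<^sup>2"
      by (intro bexI[of _ "\<lambda>x. (i x + j x) / 2"] hc) auto
  qed (use ne L z in auto)
  have pm': "(L2_norm M p)\<^sup>2 \<le> (L2_norm M a)\<^sup>2" if "a \<in> A" for a
  proof -
    have "L2_norm M (\<lambda>x. 0) = 0" by (simp add: L2_norm_def)
    then have "(L2_norm M p)\<^sup>2 + (L2_norm M q)\<^sup>2 \<le> (L2_norm M a)\<^sup>2" using pm[OF that] by simp
    then show ?thesis using zero_le_power2[of "L2_norm M q"] by linarith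
  qed
  have "(L2_norm M p)\<^sup>2 \<le> (\<integral>x. p x * q x \<partial>M)" if q: "q \<in> A" for q
  proof -
    have qL: "q \<in> L2 M" using q L by auto
    have dL: "(\<lambda>x. q x - p x) \<in> L2 M" by (rule L2_diff[OF qL p(1)])
    have t: "0 \<le> 2 * (\<integral>x. p x * (q x - p x) \<partial>M) + t * (L2_norm M (\<lambda>x. q x - p x))\<^sup>2"
      if t: "0 < t" "t \<le> 1" for t
    proof -
      \<comment> \<open>The competitor p + t (q - p) need not lie in \<open>A\<close>, but it is the
        limit of (1 - t) s n + t q, which does by convexity.\<close>
      have "(\<lambda>n. L2_norm M (\<lambda>x. ((1 - t) * s n x + t * q x) - (p x + t * (q x - p x)))) \<longlonglongrightarrow> 0"
      proof -
        have "L2_norm M (\<lambda>x. ((1 - t) * s n x + t * q x) - (p x + t * (q x - p x)))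
            = \<bar>1 - t\<bar> * L2_norm M (\<lambda>x. s n x - p x)" for n
          unfolding L2_norm_scale[symmetric] by (simp add: algebra_simps)
        then show ?thesis using tendsto_mult_right_zero[OF p(2)] by simp
      qed
      then have "(\<lambda>n. (L2_norm M (\<lambda>x. (1 - t) * s n x + t * q x))\<^sup>2) \<longlonglongrightarrow> (L2_norm M (\<lambda>x. p x + t * (q x - p x)))\<^sup>2"
        using L s q t by (intro tendsto_power L2_norm_tendsto L2_add L2_scale dL p(1)) (auto intro!: L2_add L2_scale)
      moreover have "(L2_norm M p)\<^sup>2 \<le> (L2_norm M (\<lambda>x. (1 - t) * s n x + t * q x))\<^sup>2" for n
        using convex[OF s q] t by (intro pm') auto
      ultimately have "(L2_norm M p)\<^sup>2 \<le> (L2_norm M (\<lambda>x. p x + t * (q x - p x)))\<^sup>2"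
        by (intro LIMSEQ_le_const) auto
      then have "0 \<le> t * (2 * (\<integral>x. p x * (q x - p x) \<partial>M) + t * (L2_norm M (\<lambda>x. q x - p x))\<^sup>2)"
        unfolding L2_norm_add_sq[OF p(1) dL] by (simp add: algebra_simps power2_eq_square)
      then show ?thesis using t by (simp add: zero_le_mult_iff)
    qed
    have "((\<lambda>t. 2 * (\<integral>x. p x * (q x - p x) \<partial>M) + t * (L2_norm M (\<lambda>x. q x - p x))\<^sup>2)
        \<longlongrightarrow> 2 * (\<integral>x. p x * (q x - p x) \<partial>M) + 0 * (L2_norm M (\<lambda>x. q x - p x))\<^sup>2) (at_right 0)"
      by (intro tendsto_intros)
    then have "0 \<le> 2 * (\<integral>x. p x * (q x - p x) \<partial>M) + 0 * (L2_norm M (\<lambda>x. q x - p x))\<^sup>2"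
      by (rule tendsto_lowerbound)
         (auto simp: eventually_at_right_field intro!: exI[of _ 1] t)
    moreover have "(\<integral>x. p x * (q x - p x) \<partial>M) = (\<integral>x. p x * q x \<partial>M) - (\<integral>x. p x * p x \<partial>M)"
      unfolding right_diff_distrib
      by (rule Bochner_Integration.integral_diff) (intro L2_mult_integrable p(1) qL)+
    moreover have "(L2_norm M p)\<^sup>2 = (\<integral>x. p x * p x \<partial>M)"
      unfolding L2_norm_sq by (simp only: power2_eq_square)
    ultimately show ?thesis by simp
  qed
  moreover have "\<exists>a\<in>A. L2_norm M (\<lambda>x. a x - p x) < e" if "0 < e" for e
    using order_tendstoD(2)[OF p(2) that] s by (auto simp: eventually_sequentially)
  ultimately show thesis using that p(1) by blast
qed

end

section \<open>Lipschitz functions and the local Lipschitz constant\<close>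

text \<open>Serves to replace a constant by a function value: an inequality that holds a.e. for each
  constant holds a.e. for all rational constants at once, and then passes to the limit
  pointwise.\<close>

lemma rational_sequence:
  fixes y :: real
  obtains c where "\<And>n::nat. c n \<in> \<rat>" "c \<longlonglongrightarrow> y"
proof -
  have "\<exists>r. r \<in> \<rat> \<and> y < r \<and> r < y + 1 / real (Suc n)" for n
    using Rats_dense_in_real[of y "y + 1 / real (Suc n)"] by auto
  then have "\<forall>n. \<exists>r. r \<in> \<rat> \<and> y < r \<and> r < y + 1 / real (Suc n)" ..
  then obtain c where c: "\<forall>n. c n \<in> \<rat> \<and> y < c n \<and> c n < y + 1 / real (Suc n)" by (rule choice[THEN exE])
  have "(\<lambda>n. y + 1 / real (Suc n)) \<longlonglongrightarrow> y + 0" by (intro tendsto_intros inverse_Suc_tendsto)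
  then have lim: "(\<lambda>n. y + 1 / real (Suc n)) \<longlonglongrightarrow> y" by simp
  have "c \<longlonglongrightarrow> y"
    by (rule tendsto_sandwich[OF _ _ tendsto_const lim]; rule always_eventually; use c less_imp_le in blast)
  then show thesis using c that by blast
qed

text \<open>The exponential lies above its tangent at s, which bounds exp s - exp t by exp s (s -
  t); exchanging s and t gives the other sign.\<close>

lemma exp_Lipschitz_on_bounded:
  fixes s t :: real
  assumes "\<bar>s\<bar> \<le> A" "\<bar>t\<bar> \<le> A"
  shows "\<bar>exp s - exp t\<bar> \<le> exp A * \<bar>s - t\<bar>"
proof -
  have le: "exp s - exp t \<le> exp A * \<bar>s - t\<bar>" if "\<bar>s\<bar> \<le> A" for s t :: real
  proof -
    have "exp s * (1 + (t - s)) \<le> exp s * exp (t - s)" by (intro mult_left_mono exp_ge_add_one_self) simp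
    also have "\<dots> = exp t" by (simp flip: exp_add)
    finally have "exp s - exp t \<le> exp s * (s - t)" by (simp add: algebra_simps)
    also have "\<dots> \<le> exp s * \<bar>s - t\<bar>" by (intro mult_left_mono) auto
    also have "\<dots> \<le> exp A * \<bar>s - t\<bar>" using that by (intro mult_right_mono) auto
    finally show ?thesis .
  qed
  show ?thesis using le[OF assms(1), of t] le[OF assms(2), of s] by (simp add: abs_le_iff abs_minus_commute)
qed

section \<open>Algebra of Lipschitz functions\<close>

lemma Lip_iff: "f \<in> Lip \<longleftrightarrow> (\<exists>L\<ge>0. \<forall>x y. \<bar>f x - f y\<bar> \<le> L * dist x y)"
  by (auto simp: Lip_def lipschitz_on_def dist_real_def)

lemma LipE:
  assumes "f \<in> Lip"
  obtains L where "0 \<le> L" "\<And>x y. \<bar>f x - f y\<bar> \<le> L * dist x y"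
  using assms by (auto simp: Lip_iff)

lemma Lip_I: "0 \<le> L \<Longrightarrow> (\<And>x y. \<bar>f x - f y\<bar> \<le> L * dist x y) \<Longrightarrow> f \<in> Lip"
  by (auto simp: Lip_iff)

lemma Lip_continuous: "f \<in> Lip \<Longrightarrow> continuous_on UNIV f"
  by (auto simp: Lip_def intro: lipschitz_on_continuous_on)

lemma Lip_const: "(\<lambda>x. c) \<in> Lip"
  by (rule Lip_I[of 0]) auto

lemma Lip_lincomb:
  assumes "f \<in> Lip" "g \<in> Lip"
  shows "(\<lambda>x. a * f x + b * g x) \<in> Lip"
proof -
  obtain K where K: "0 \<le> K" "\<And>x y. \<bar>f x - f y\<bar> \<le> K * dist x y" 
    by (rule LipE[OF assms(1)], rule that)
  obtain L where L: "0 \<le> L" "\<And>x y. \<bar>g x - g y\<bar> \<le> L * dist x y" 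
    by (rule LipE[OF assms(2)], rule that)
  show ?thesis
  proof (rule Lip_I[of "\<bar>a\<bar> * K + \<bar>b\<bar> * L"])
    fix x y
    have "\<bar>(a * f x + b * g x) - (a * f y + b * g y)\<bar> = \<bar>a * (f x - f y) + b * (g x - g y)\<bar>"
      by (simp add: algebra_simps)
    also have "\<dots> \<le> \<bar>a\<bar> * \<bar>f x - f y\<bar> + \<bar>b\<bar> * \<bar>g x - g y\<bar>"
      by (metis abs_mult abs_triangle_ineq)
    also have "\<dots> \<le> \<bar>a\<bar> * (K * dist x y) + \<bar>b\<bar> * (L * dist x y)"
      by (intro add_mono mult_left_mono K L) auto
    finally show "\<bar>(a * f x + b * g x) - (a * f y + b * g y)\<bar> \<le> (\<bar>a\<bar> * K + \<bar>b\<bar> * L) * dist x y"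
      by (simp add: algebra_simps)
  qed (use K L in auto)
qed

lemma Lip_mult:
  assumes "f \<in> Lip" "g \<in> Lip" "\<And>x. \<bar>f x\<bar> \<le> A" "\<And>x. \<bar>g x\<bar> \<le> B"
  shows "(\<lambda>x. f x * g x) \<in> Lip"
proof -
  obtain K where K: "0 \<le> K" "\<And>x y. \<bar>f x - f y\<bar> \<le> K * dist x y" 
    by (rule LipE[OF assms(1)], rule that)
  obtain L where L: "0 \<le> L" "\<And>x y. \<bar>g x - g y\<bar> \<le> L * dist x y" 
    by (rule LipE[OF assms(2)], rule that)
  have A: "0 \<le> A" "0 \<le> B" using order_trans[OF abs_ge_zero assms(3)] order_trans[OF abs_ge_zero assms(4)] by auto
  show ?thesis
  proof (rule Lip_I[of "A * L + B * K"])
    fix x y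
    have "\<bar>f x * g x - f y * g y\<bar> = \<bar>f x * (g x - g y) + g y * (f x - f y)\<bar>"
      by (simp add: algebra_simps)
    also have "\<dots> \<le> \<bar>f x\<bar> * \<bar>g x - g y\<bar> + \<bar>g y\<bar> * \<bar>f x - f y\<bar>"
      by (metis abs_mult abs_triangle_ineq)
    also have "\<dots> \<le> A * (L * dist x y) + B * (K * dist x y)"
      by (intro add_mono mult_mono K L assms) (use A in auto)
    finally show "\<bar>f x * g x - f y * g y\<bar> \<le> (A * L + B * K) * dist x y"
      by (simp add: algebra_simps)
  qed (use A K L in auto)
qed

text \<open>Truncation to the interval from c to d; it is constantly c when d < c. Being
  nonexpansive, it does not increase gradients, and it provides bounds that hold at every point
  rather than almost everywhere.\<close>

definition clip :: "real \<Rightarrow> real \<Rightarrow> real \<Rightarrow> real" where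
  "clip c d t = max c (min d t)"

lemma clip_nonexpansive: "\<bar>clip c d s - clip c d t\<bar> \<le> \<bar>s - t\<bar>"
  unfolding clip_def by linarith

lemma clip_bounds: "c \<le> d \<Longrightarrow> c \<le> clip c d t" "c \<le> d \<Longrightarrow> clip c d t \<le> d"
  by (auto simp: clip_def)

lemma clip_id: "c \<le> t \<Longrightarrow> t \<le> d \<Longrightarrow> clip c d t = t"
  by (auto simp: clip_def)

lemma clip_measurable [measurable]: "clip c d \<in> borel_measurable borel"
  unfolding clip_def by measurable

lemma Lip_clip: "f \<in> Lip \<Longrightarrow> (\<lambda>x. clip c d (f x)) \<in> Lip"
  by (elim LipE, rule Lip_I) (auto intro: order_trans[OF clip_nonexpansive])

text \<open>At an isolated point \<open>at x\<close> is the trivial filter, the upper limit over it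
  is -\<infinity>, and \<open>real_of_ereal\<close> sends this to 0. The case distinction in the
  definition is therefore automatic.\<close>

lemma lip_eq: "lip f x = real_of_ereal (Limsup (at x) (\<lambda>y. ereal (\<bar>f y - f x\<bar> / dist y x)))"
proof (cases "x islimpt UNIV")
  case False
  then have "at x = bot" by (simp add: trivial_limit_within)
  then show ?thesis using False by (simp add: lip_def Limsup_bot bot_ereal_def)
qed (simp add: lip_def)

text \<open>A linear bound near x keeps the upper limit finite, so that \<open>real_of_ereal\<close>
  loses nothing. At an isolated point the value is 0, which is below C because 0 \<le> C.\<close>

lemma
  assumes ev: "\<forall>\<^sub>F y in at x. \<bar>f y - f x\<bar> \<le> C * dist y x" and C: "0 \<le> C"
  shows lip_le: "lip f x \<le> C" and lip_nonneg_aux: "0 \<le> lip f x"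
    and Limsup_lip: "at x \<noteq> bot \<Longrightarrow> Limsup (at x) (\<lambda>y. ereal (\<bar>f y - f x\<bar> / dist y x)) = ereal (lip f x)"
proof -
  let ?L = "Limsup (at x) (\<lambda>y. ereal (\<bar>f y - f x\<bar> / dist y x))"
  have "lip f x \<le> C \<and> 0 \<le> lip f x \<and> (at x \<noteq> bot \<longrightarrow> ?L = ereal (lip f x))"
  proof (cases "at x = bot")
    case True
    then show ?thesis using C by (simp add: lip_eq Limsup_bot bot_ereal_def)
  next
    case False
    have "\<forall>\<^sub>F y in at x. ereal (\<bar>f y - f x\<bar> / dist y x) \<le> ereal C"
      using ev eventually_neq_at_within[of x x UNIV]
      by eventually_elim (simp add: pos_divide_le_eq)
    then have le: "?L \<le> ereal C" by (rule Limsup_bounded)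
    have "0 \<le> Liminf (at x) (\<lambda>y. ereal (\<bar>f y - f x\<bar> / dist y x))"
      by (rule Liminf_bounded) auto
    also have "\<dots> \<le> ?L" by (rule Liminf_le_Limsup[OF False])
    finally have "0 \<le> ?L" .
    with le obtain l where "?L = ereal l" "0 \<le> l" "l \<le> C" by (cases ?L) auto
    then show ?thesis by (simp add: lip_eq)
  qed
  then show "lip f x \<le> C" "0 \<le> lip f x" "at x \<noteq> bot \<Longrightarrow> ?L = ereal (lip f x)" by auto
qed

lemma Lip_eventually:
  assumes "f \<in> Lip"
  obtains L where "0 \<le> L" "\<And>x. \<forall>\<^sub>F y in at x. \<bar>f y - f x\<bar> \<le> L * dist y x"
  by (rule LipE[OF assms]) (simp add: that)

lemma lip_nonneg: "f \<in> Lip \<Longrightarrow> 0 \<le> lip f x"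
  by (rule Lip_eventually, assumption, rule lip_nonneg_aux)

lemma lip_eventually:
  assumes f: "f \<in> Lip" and e: "0 < e"
  shows "\<forall>\<^sub>F y in at x. \<bar>f y - f x\<bar> \<le> (lip f x + e) * dist y x"
proof (cases "at x = bot")
  case False
  obtain L where "0 \<le> L" "\<And>x. \<forall>\<^sub>F y in at x. \<bar>f y - f x\<bar> \<le> L * dist y x"
    by (rule Lip_eventually[OF f], rule that)
  then have "Limsup (at x) (\<lambda>y. ereal (\<bar>f y - f x\<bar> / dist y x)) < ereal (lip f x + e)"
    by (subst Limsup_lip[OF _ _ False]) (use e in auto)
  then have "\<forall>\<^sub>F y in at x. ereal (\<bar>f y - f x\<bar> / dist y x) < ereal (lip f x + e)"
    by (rule Limsup_lessD)
  then show ?thesis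
    using eventually_neq_at_within[of x x UNIV]
    by eventually_elim (simp add: pos_divide_less_eq less_imp_le)
qed simp

text \<open>The calculus rules for \<open>lip\<close> are obtained from difference quotients with
  the slack e of \<open>lip_eventually\<close>; this removes the slack by letting e decrease to
  0.\<close>

lemma lip_leI:
  fixes P :: "real \<Rightarrow> real"
  assumes ev: "\<And>e. 0 < e \<Longrightarrow> \<forall>\<^sub>F y in at x. \<bar>F y - F x\<bar> \<le> P e * dist y x"
    and lim: "(P \<longlongrightarrow> C) (at_right 0)" and C: "0 \<le> C"
  shows "lip F x \<le> C"
proof (rule tendsto_lowerbound)
  \<comment> \<open>\<open>P e\<close> may be negative, but \<open>lip_le\<close> asks for a
    nonnegative constant; the limit is unchanged since 0 \<le> C.\<close>
  show "((\<lambda>e. max 0 (P e)) \<longlongrightarrow> C) (at_right 0)"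
    using tendsto_max[OF tendsto_const lim, of 0] C by simp
  have "lip F x \<le> max 0 (P e)" if "0 < e" for e
  proof (rule lip_le)
    show "\<forall>\<^sub>F y in at x. \<bar>F y - F x\<bar> \<le> max 0 (P e) * dist y x"
      using ev[OF that]
    proof eventually_elim
      case (elim y)
      also have "P e * dist y x \<le> max 0 (P e) * dist y x" by (intro mult_right_mono) auto
      finally show ?case .
    qed
  qed auto
  then show "\<forall>\<^sub>F e in at_right 0. lip F x \<le> max 0 (P e)"
    by (simp add: eventually_at_right_less eventually_at_filter)
qed simp

lemma lip_le_Lipschitz: "0 \<le> L \<Longrightarrow> (\<And>x y. \<bar>f x - f y\<bar> \<le> L * dist x y) \<Longrightarrow> lip f x \<le> L"
  by (rule lip_le) auto

lemma Lip_tendsto: "f \<in> Lip \<Longrightarrow> (f \<longlongrightarrow> f x) (at x)"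
  using Lip_continuous by (auto simp: continuous_on_def)

text \<open>The increment is \<eta> y (f y - f x) + (1 - \<eta> y) (g y - g x) + (\<eta> y - \<eta>
  x) (f x - g x). The last term is the price L |f - g| of gluing, harmless when f and g approximate
  the same function.\<close>

lemma lip_convex_comb:
  assumes "\<eta> \<in> Lip" "f \<in> Lip" "g \<in> Lip" and \<eta>: "\<And>x. 0 \<le> \<eta> x" "\<And>x. \<eta> x \<le> 1"
    and L: "0 \<le> L" "\<And>x y. \<bar>\<eta> x - \<eta> y\<bar> \<le> L * dist x y"
  shows "lip (\<lambda>x. \<eta> x * f x + (1 - \<eta> x) * g x) x \<le> \<eta> x * lip f x + (1 - \<eta> x) * lip g x + L * \<bar>f x - g x\<bar>"
proof (rule lip_leI)
  let ?P = "\<lambda>e. (\<eta> x + e) * (lip f x + e) + (1 - \<eta> x + e) * (lip g x + e) + L * \<bar>f x - g x\<bar>"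
  have "(?P \<longlongrightarrow> (\<eta> x + 0) * (lip f x + 0) + (1 - \<eta> x + 0) * (lip g x + 0) + L * \<bar>f x - g x\<bar>) (at_right 0)"
    by (intro tendsto_intros)
  then show "(?P \<longlongrightarrow> \<eta> x * lip f x + (1 - \<eta> x) * lip g x + L * \<bar>f x - g x\<bar>) (at_right 0)" by simp
  show "0 \<le> \<eta> x * lip f x + (1 - \<eta> x) * lip g x + L * \<bar>f x - g x\<bar>"
    using \<eta>[of x] L(1) lip_nonneg[OF assms(2)] lip_nonneg[OF assms(3)] by simp
  fix e :: real assume e: "0 < e"
  have "\<forall>\<^sub>F y in at x. \<bar>\<eta> y - \<eta> x\<bar> < e"
    using tendstoD[OF Lip_tendsto[OF assms(1)] e, of x] by (simp add: dist_real_def)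
  then show "\<forall>\<^sub>F y in at x. \<bar>(\<eta> y * f y + (1 - \<eta> y) * g y) - (\<eta> x * f x + (1 - \<eta> x) * g x)\<bar> \<le> ?P e * dist y x"
    using lip_eventually[OF assms(2) e] lip_eventually[OF assms(3) e]
  proof eventually_elim
    case (elim y)
    have "\<bar>(\<eta> y * f y + (1 - \<eta> y) * g y) - (\<eta> x * f x + (1 - \<eta> x) * g x)\<bar>
        = \<bar>\<eta> y * (f y - f x) + (1 - \<eta> y) * (g y - g x) + (\<eta> y - \<eta> x) * (f x - g x)\<bar>"
      by (simp add: algebra_simps)
    also have "\<dots> \<le> \<eta> y * \<bar>f y - f x\<bar> + (1 - \<eta> y) * \<bar>g y - g x\<bar> + \<bar>\<eta> y - \<eta> x\<bar> * \<bar>f x - g x\<bar>"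
      using \<eta>[of y] by (intro order_trans[OF abs_triangle_ineq] add_mono) (auto simp: abs_mult intro: order_trans[OF abs_triangle_ineq])
    also have "\<dots> \<le> (\<eta> x + e) * ((lip f x + e) * dist y x) + (1 - \<eta> x + e) * ((lip g x + e) * dist y x)
        + (L * dist y x) * \<bar>f x - g x\<bar>"
      using elim \<eta>[of y] \<eta>[of x] L(2)[of y x] e
      by (intro add_mono mult_mono) auto
    finally show ?case by (simp add: algebra_simps)
  qed
qed

lemma lip_lincomb:
  assumes "f \<in> Lip" "g \<in> Lip"
  shows "lip (\<lambda>x. a * f x + b * g x) x \<le> \<bar>a\<bar> * lip f x + \<bar>b\<bar> * lip g x"
proof (rule lip_leI)
  let ?P = "\<lambda>e. \<bar>a\<bar> * (lip f x + e) + \<bar>b\<bar> * (lip g x + e)"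
  have "(?P \<longlongrightarrow> \<bar>a\<bar> * (lip f x + 0) + \<bar>b\<bar> * (lip g x + 0)) (at_right 0)"
    by (intro tendsto_intros)
  then show "(?P \<longlongrightarrow> \<bar>a\<bar> * lip f x + \<bar>b\<bar> * lip g x) (at_right 0)" by simp
  fix e :: real assume e: "0 < e"
  show "\<forall>\<^sub>F y in at x. \<bar>(a * f y + b * g y) - (a * f x + b * g x)\<bar> \<le> ?P e * dist y x"
    using lip_eventually[OF assms(1) e] lip_eventually[OF assms(2) e]
  proof eventually_elim
    case (elim y)
    have "\<bar>(a * f y + b * g y) - (a * f x + b * g x)\<bar> = \<bar>a * (f y - f x) + b * (g y - g x)\<bar>"
      by (simp add: algebra_simps)
    also have "\<dots> \<le> \<bar>a\<bar> * \<bar>f y - f x\<bar> + \<bar>b\<bar> * \<bar>g y - g x\<bar>"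
      by (metis abs_mult abs_triangle_ineq)
    also have "\<dots> \<le> \<bar>a\<bar> * ((lip f x + e) * dist y x) + \<bar>b\<bar> * ((lip g x + e) * dist y x)"
      using elim by (intro add_mono mult_left_mono) auto
    finally show ?case by (simp add: algebra_simps)
  qed
qed (simp add: lip_nonneg assms)

lemma lip_mult:
  assumes "f \<in> Lip" "g \<in> Lip"
  shows "lip (\<lambda>x. f x * g x) x \<le> \<bar>f x\<bar> * lip g x + \<bar>g x\<bar> * lip f x"
proof (rule lip_leI)
  let ?P = "\<lambda>e. (\<bar>f x\<bar> + e) * (lip g x + e) + \<bar>g x\<bar> * (lip f x + e)"
  have "(?P \<longlongrightarrow> (\<bar>f x\<bar> + 0) * (lip g x + 0) + \<bar>g x\<bar> * (lip f x + 0)) (at_right 0)"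
    by (intro tendsto_intros)
  then show "(?P \<longlongrightarrow> \<bar>f x\<bar> * lip g x + \<bar>g x\<bar> * lip f x) (at_right 0)" by simp
  fix e :: real assume e: "0 < e"
  have "\<forall>\<^sub>F y in at x. \<bar>f y - f x\<bar> < e"
    using tendstoD[OF Lip_tendsto[OF assms(1)] e, of x] by (simp add: dist_real_def)
  then show "\<forall>\<^sub>F y in at x. \<bar>f y * g y - f x * g x\<bar> \<le> ?P e * dist y x"
    using lip_eventually[OF assms(1) e] lip_eventually[OF assms(2) e]
  proof eventually_elim
    case (elim y)
    have "\<bar>f y * g y - f x * g x\<bar> = \<bar>f y * (g y - g x) + g x * (f y - f x)\<bar>"
      by (simp add: algebra_simps)
    also have "\<dots> \<le> \<bar>f y\<bar> * \<bar>g y - g x\<bar> + \<bar>g x\<bar> * \<bar>f y - f x\<bar>"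
      by (metis abs_mult abs_triangle_ineq)
    also have "\<dots> \<le> (\<bar>f x\<bar> + e) * ((lip g x + e) * dist y x) + \<bar>g x\<bar> * ((lip f x + e) * dist y x)"
      using elim e by (intro add_mono mult_mono) auto
    finally show ?case by (simp add: algebra_simps)
  qed
qed (simp add: lip_nonneg assms)

lemma lip_clip:
  assumes "f \<in> Lip"
  shows "lip (\<lambda>x. clip c d (f x)) x \<le> lip f x"
proof (rule lip_leI)
  have "((\<lambda>e. lip f x + e) \<longlongrightarrow> lip f x + 0) (at_right 0)"
    by (intro tendsto_intros)
  then show "((\<lambda>e. lip f x + e) \<longlongrightarrow> lip f x) (at_right 0)" by simp
  show "\<forall>\<^sub>F y in at x. \<bar>clip c d (f y) - clip c d (f x)\<bar> \<le> (lip f x + e) * dist y x" if "0 < e" for e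
    using lip_eventually[OF assms that] by eventually_elim (rule order_trans[OF clip_nonexpansive])
qed (use lip_nonneg assms in auto)

text \<open>The difference quotient of \<open>F\<close> controls the increment only at points with v
  y \<noteq> v x; where v y = v x the increment of the composition vanishes.\<close>

lemma lip_compose:
  assumes v: "v \<in> Lip" and D: "(F has_real_derivative D) (at (v x))"
  shows "lip (\<lambda>x. F (v x)) x \<le> \<bar>D\<bar> * lip v x"
proof (rule lip_leI)
  have "((\<lambda>e. (\<bar>D\<bar> + e) * (lip v x + e)) \<longlongrightarrow> (\<bar>D\<bar> + 0) * (lip v x + 0)) (at_right 0)"
    by (intro tendsto_intros)
  then show "((\<lambda>e. (\<bar>D\<bar> + e) * (lip v x + e)) \<longlongrightarrow> \<bar>D\<bar> * lip v x) (at_right 0)" by simp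
  show "0 \<le> \<bar>D\<bar> * lip v x" using lip_nonneg[OF v, of x] by simp
  fix e :: real assume e: "0 < e"
  have "((\<lambda>t. (F t - F (v x)) / (t - v x)) \<longlongrightarrow> D) (at (v x))"
    using D by (simp add: has_field_derivative_iff)
  then have "((\<lambda>t. \<bar>(F t - F (v x)) / (t - v x)\<bar>) \<longlongrightarrow> \<bar>D\<bar>) (at (v x))" by (rule tendsto_rabs)
  then have "\<forall>\<^sub>F t in at (v x). \<bar>(F t - F (v x)) / (t - v x)\<bar> < \<bar>D\<bar> + e"
    by (rule order_tendstoD(2)) (use e in simp)
  then have "\<forall>\<^sub>F t in nhds (v x). t \<noteq> v x \<longrightarrow> \<bar>(F t - F (v x)) / (t - v x)\<bar> < \<bar>D\<bar> + e"
    by (simp add: eventually_at_filter)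
  then have "\<forall>\<^sub>F y in at x. v y \<noteq> v x \<longrightarrow> \<bar>(F (v y) - F (v x)) / (v y - v x)\<bar> < \<bar>D\<bar> + e"
    using Lip_tendsto[OF v] by (rule eventually_compose_filterlim)
  then show "\<forall>\<^sub>F y in at x. \<bar>F (v y) - F (v x)\<bar> \<le> (\<bar>D\<bar> + e) * (lip v x + e) * dist y x"
    using lip_eventually[OF v e]
  proof eventually_elim
    case (elim y)
    show ?case
    proof (cases "v y = v x")
      case True
      then show ?thesis using e lip_nonneg[OF v, of x] by simp
    next
      case False
      then have "\<bar>F (v y) - F (v x)\<bar> \<le> (\<bar>D\<bar> + e) * \<bar>v y - v x\<bar>"
        using elim(1) by (simp add: abs_divide pos_divide_less_eq)
      also have "\<dots> \<le> (\<bar>D\<bar> + e) * ((lip v x + e) * dist y x)"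
        using elim(2) e by (intro mult_left_mono) auto
      finally show ?thesis by (simp add: mult.assoc)
    qed
  qed
qed

text \<open>The supremum \<open>s e\<close> of the quotients over a punctured ball is lower
  semicontinuous, because a point y that witnesses \<open>a < s e x\<close> remains a witness for
  all nearby x. The upper limit is an infimum of countably many such functions.\<close>

lemma lip_measurable:
  assumes f: "f \<in> Lip"
  shows "lip f \<in> borel_measurable borel"
proof -
  define s where "s e x = (SUP y\<in>ball x e - {x}. ereal (\<bar>f y - f x\<bar> / dist y x))" for e x
  have cont: "isCont f x" for x using Lip_continuous[OF f] by (simp add: continuous_on_eq_continuous_at)
  have sm: "s e \<in> borel_measurable borel" for e
  proof (rule borel_measurableI_greater)
    fix a
    have "open {x. a < s e x}"
      unfolding open_dist mem_Collect_eq
    proof (intro ballI, simp only: mem_Collect_eq)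
      fix x assume "a < s e x"
      then obtain y where "y \<in> ball x e - {x}" "a < ereal (\<bar>f y - f x\<bar> / dist y x)"
        unfolding s_def less_SUP_iff by blast
      then have y: "dist x y < e" "y \<noteq> x" "a < ereal (\<bar>f y - f x\<bar> / dist y x)" by auto
      have "((\<lambda>x'. ereal (\<bar>f y - f x'\<bar> / dist y x')) \<longlongrightarrow> ereal (\<bar>f y - f x\<bar> / dist y x)) (nhds x)"
        using y(2) cont by (intro tendsto_intros) (auto simp: isCont_def tendsto_at_iff_tendsto_nhds filterlim_ident)
      then have "\<forall>\<^sub>F x' in nhds x. a < ereal (\<bar>f y - f x'\<bar> / dist y x')"
        using y(3) by (rule order_tendstoD)
      moreover have "\<forall>\<^sub>F x' in nhds x. dist x' y < e"
        using y(1) by (intro order_tendstoD(2)[of _ "dist x y"] tendsto_intros) (auto simp: filterlim_ident)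
      moreover have "\<forall>\<^sub>F x' in nhds x. x' \<noteq> y"
        using y(2) by (intro t1_space_nhds) auto
      ultimately have "\<forall>\<^sub>F x' in nhds x. a < s e x'"
      proof eventually_elim
        case (elim x')
        then show ?case unfolding s_def less_SUP_iff by (intro bexI[of _ y]) auto
      qed
      then show "\<exists>e'>0. \<forall>y. dist y x < e' \<longrightarrow> a < s e y"
        by (simp add: eventually_nhds_metric)
    qed
    then show "{x \<in> space borel. a < s e x} \<in> sets borel" by simp
  qed
  have "Limsup (at x) (\<lambda>y. ereal (\<bar>f y - f x\<bar> / dist y x)) = (INF n. s (1 / real (Suc n)) x)" for x
    unfolding Limsup_at s_def[symmetric]
  proof (rule antisym)
    show "(INF e\<in>{0<..}. s e x) \<le> (INF n. s (1 / real (Suc n)) x)"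
      by (rule INF_mono) (auto intro!: bexI[of _ "1 / real (Suc _)"])
    show "(INF n. s (1 / real (Suc n)) x) \<le> (INF e\<in>{0<..}. s e x)"
    proof (rule INF_mono)
      fix e :: real assume "e \<in> {0<..}"
      then obtain n where n: "1 / real (Suc n) < e" using nat_approx_posE[of e] by auto
      then have "s (1 / real (Suc n)) x \<le> s e x"
        unfolding s_def by (intro SUP_subset_mono) auto
      then show "\<exists>n\<in>UNIV. s (1 / real (Suc n)) x \<le> s e x" by blast
    qed
  qed
  then have "lip f = (\<lambda>x. real_of_ereal (INF n. s (1 / real (Suc n)) x))"
    by (simp add: lip_eq fun_eq_iff)
  then show ?thesis using sm by simp
qed

section \<open>Upper gradients\<close>

lemma mult_abs_mono: "\<bar>a\<bar> \<le> b \<Longrightarrow> a * (x::real) \<le> b * \<bar>x\<bar>"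
  using abs_ge_self[of "a * x"] mult_right_mono[of "\<bar>a\<bar>" b "\<bar>x\<bar>"] by (simp add: abs_mult)

text \<open>Relaxed gradients with strong approximation and an explicit L2 error \<open>r\<close>.
  In this form the calculus rules reduce to pointwise estimates of \<open>lip\<close>, and
  \<open>relaxed_gradient_upper_grad\<close> shows that relaxed gradients, although defined by weak
  limits, have this form.\<close>

definition upper_grad :: "'a::metric_space measure \<Rightarrow> ('a \<Rightarrow> real) \<Rightarrow> ('a \<Rightarrow> real) \<Rightarrow> bool" where
  "upper_grad m f G \<longleftrightarrow> f \<in> L2 m \<and> G \<in> L2 m \<and>
     (\<forall>e>0. \<exists>F\<in>Lip. \<exists>r\<in>L2 m. L2_norm m (\<lambda>x. F x - f x) \<le> e \<and> L2_norm m r \<le> e \<and>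
        (AE x in m. lip F x \<le> G x + r x))"

lemma upper_gradD: "upper_grad m f G \<Longrightarrow> f \<in> L2 m" "upper_grad m f G \<Longrightarrow> G \<in> L2 m"
  by (simp_all add: upper_grad_def)

lemma upper_gradE:
  assumes "upper_grad m f G" "0 < e"
  obtains F r where "F \<in> Lip" "r \<in> L2 m" "L2_norm m (\<lambda>x. F x - f x) \<le> e" "L2_norm m r \<le> e"
    "AE x in m. lip F x \<le> G x + r x"
  using assms unfolding upper_grad_def by blast

lemma upper_gradI:
  assumes "f \<in> L2 m" "G \<in> L2 m" and C: "0 \<le> C"
    and app: "\<And>e. 0 < e \<Longrightarrow> \<exists>F r. F \<in> Lip \<and> r \<in> L2 m \<and> L2_norm m (\<lambda>x. F x - f x) \<le> C * e \<and>
      L2_norm m r \<le> C * e \<and> (AE x in m. lip F x \<le> G x + r x)"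
  shows "upper_grad m f G"
  unfolding upper_grad_def
proof (intro conjI allI impI assms(1,2))
  fix e :: real assume e: "0 < e"
  \<comment> \<open>C + 1 keeps the quotient meaningful for C = 0.\<close>
  then have e': "0 < e / (C + 1)" "C * (e / (C + 1)) \<le> e" using C by (auto simp: field_simps)
  show "\<exists>F\<in>Lip. \<exists>r\<in>L2 m. L2_norm m (\<lambda>x. F x - f x) \<le> e \<and> L2_norm m r \<le> e \<and>
        (AE x in m. lip F x \<le> G x + r x)"
    using app[OF e'(1)] e'(2) by (meson order_trans)
qed

text \<open>Compactness makes Lipschitz functions bounded, hence members of L2 for a probability
  measure. Inner regularity lets Lipschitz functions detect null sets.\<close>

locale compact_mms = prob_space M for M :: "'a::metric_space measure" +
  assumes compact_space: "compact (UNIV :: 'a set)"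
    and sets_M: "sets M = sets borel"
    and inner_regular: "\<And>A. A \<in> sets M \<Longrightarrow> emeasure M A = (SUP C\<in>{C. compact C \<and> C \<subseteq> A}. emeasure M C)"
begin

lemma measurable_M: "f \<in> borel_measurable borel \<Longrightarrow> f \<in> borel_measurable M"
  using measurable_cong_sets[OF sets_M refl] by blast

lemma Lip_bounded:
  fixes f :: "'a \<Rightarrow> real"
  assumes "f \<in> Lip"
  obtains B where "0 \<le> B" "\<And>x. \<bar>f x\<bar> \<le> B"
proof -
  have "compact (range f)"
    using Lip_continuous[OF assms] compact_space by (rule compact_continuous_image)
  then obtain B where "\<forall>y\<in>range f. norm y \<le> B"
    using compact_imp_bounded bounded_iff by blast
  then have "\<And>x. \<bar>f x\<bar> \<le> max 0 B" by (auto simp: le_max_iff_disj)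
  then show thesis by (rule that[rotated]) simp
qed

lemma Lip_measurable: "f \<in> Lip \<Longrightarrow> f \<in> borel_measurable M"
  by (intro measurable_M borel_measurable_continuous_onI Lip_continuous)

lemma lip_measurable_M: "f \<in> Lip \<Longrightarrow> lip f \<in> borel_measurable M"
  by (intro measurable_M lip_measurable)

lemma Lip_L2: assumes "f \<in> Lip" shows "f \<in> L2 M"
proof -
  obtain B where "\<And>x. \<bar>f x\<bar> \<le> B" by (rule Lip_bounded[OF assms], rule that)
  then show ?thesis by (intro L2_bounded[where C = B] Lip_measurable assms) simp
qed

lemma lip_bounded:
  assumes "f \<in> Lip"
  obtains B where "0 \<le> B" "\<And>x. \<bar>lip f x\<bar> \<le> B"
proof -
  obtain L where "0 \<le> L" "\<And>x y. \<bar>f x - f y\<bar> \<le> L * dist x y" by (rule LipE[OF assms], rule that)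
  then have "\<bar>lip f x\<bar> \<le> L" for x using lip_le_Lipschitz[of L f x] lip_nonneg[OF assms, of x] by simp
  then show thesis using that[of L] \<open>0 \<le> L\<close> by blast
qed

lemma lip_L2: assumes "f \<in> Lip" shows "lip f \<in> L2 M"
proof -
  obtain B where "\<And>x. \<bar>lip f x\<bar> \<le> B" by (rule lip_bounded[OF assms], rule that)
  then show ?thesis by (intro L2_bounded[where C = B] lip_measurable_M assms) simp
qed

text \<open>For a compact C inside {h < 0}, the Lipschitz functions max 0 (1 - n dist(x, C))
  decrease to the indicator of C, so the integral of h over C is nonnegative and C is null. Inner
  regularity extends this to all of {h < 0}.\<close>

lemma Lip_test_nonneg:
  assumes h: "integrable M h"
    and test: "\<And>\<eta>. \<eta> \<in> Lip \<Longrightarrow> (\<And>x. 0 \<le> \<eta> x) \<Longrightarrow> (\<And>x. \<eta> x \<le> 1) \<Longrightarrow> 0 \<le> (\<integral>x. \<eta> x * h x \<partial>M)"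
  shows "AE x in M. 0 \<le> h x"
proof -
  have hm: "h \<in> borel_measurable M" using h by simp
  define A where "A = {x \<in> space M. h x < 0}"
  have A: "A \<in> sets M" unfolding A_def using hm by measurable
  have null: "emeasure M C = 0" if C: "compact C" "C \<subseteq> A" for C
  proof (cases "C = {}")
    case False
    have Cc: "closed C" using C(1) by (rule compact_imp_closed)
    have Cs: "C \<in> sets M" using Cc sets_M by auto
    define \<eta> where "\<eta> n x = max 0 (1 - real n * infdist x C)" for n x
    have \<eta>L: "\<eta> n \<in> Lip" for n
    proof (rule Lip_I[of "real n"])
      fix x y
      have "\<bar>infdist x C - infdist y C\<bar> \<le> dist x y"
        using infdist_triangle[of x C y] infdist_triangle[of y C x] by (simp add: dist_commute abs_le_iff)
      then have "real n * \<bar>infdist x C - infdist y C\<bar> \<le> real n * dist x y" by (rule mult_left_mono) simp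
      moreover have "\<bar>\<eta> n x - \<eta> n y\<bar> \<le> \<bar>real n * infdist x C - real n * infdist y C\<bar>"
        unfolding \<eta>_def by linarith
      moreover have "\<bar>real n * infdist x C - real n * infdist y C\<bar> = real n * \<bar>infdist x C - infdist y C\<bar>"
        by (simp add: abs_mult flip: right_diff_distrib)
      ultimately show "\<bar>\<eta> n x - \<eta> n y\<bar> \<le> real n * dist x y" by linarith
    qed simp
    have \<eta>01: "0 \<le> \<eta> n x" "\<eta> n x \<le> 1" for n x by (auto simp: \<eta>_def infdist_nonneg)
    have lim: "(\<lambda>n. \<eta> n x * h x) \<longlonglongrightarrow> indicator C x * h x" for x
    proof (cases "x \<in> C")
      case True
      then show ?thesis by (simp add: \<eta>_def)
    next
      case False
      then have d: "0 < infdist x C"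
        using in_closed_iff_infdist_zero[OF Cc \<open>C \<noteq> {}\<close>, of x] infdist_nonneg[of x C] by linarith
      have "\<eta> n x * h x = indicator C x * h x" if "nat \<lceil>1 / infdist x C\<rceil> \<le> n" for n
      proof -
        have "1 / infdist x C \<le> real n" using that by (simp add: nat_le_iff ceiling_le_iff)
        then show ?thesis using d False by (simp add: \<eta>_def field_simps)
      qed
      then have "\<forall>\<^sub>F n in sequentially. \<eta> n x * h x = indicator C x * h x"
        by (rule eventually_sequentiallyI)
      then show ?thesis by (rule tendsto_eventually)
    qed
    have "(\<lambda>n. \<integral>x. \<eta> n x * h x \<partial>M) \<longlonglongrightarrow> (\<integral>x. indicator C x * h x \<partial>M)"
    proof (rule integral_dominated_convergence[where w = "\<lambda>x. \<bar>h x\<bar>"])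
      show "AE x in M. norm (\<eta> n x * h x) \<le> \<bar>h x\<bar>" for n
        using \<eta>01 by (auto simp: abs_mult intro!: mult_left_le_one_le)
      show "(\<lambda>x. \<eta> n x * h x) \<in> borel_measurable M" for n
        using Lip_measurable[OF \<eta>L] hm by (rule borel_measurable_times)
      show "(\<lambda>x. indicator C x * h x) \<in> borel_measurable M"
        using Cs hm by measurable
    qed (use h lim in auto)
    moreover have "0 \<le> (\<integral>x. \<eta> n x * h x \<partial>M)" for n by (rule test[OF \<eta>L \<eta>01])
    ultimately have ge: "0 \<le> (\<integral>x. indicator C x * h x \<partial>M)" by (intro LIMSEQ_le_const) auto
    have int: "integrable M (\<lambda>x. - (indicator C x * h x))"
      using integrable_real_mult_indicator[OF Cs h] by (simp add: mult.commute)
    have nn: "AE x in M. 0 \<le> - (indicator C x * h x)"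
      using C(2) by (auto simp: A_def indicator_def intro!: AE_I2)
    have "0 \<le> (\<integral>x. - (indicator C x * h x) \<partial>M)" by (rule integral_nonneg_AE[OF nn])
    with ge have "(\<integral>x. - (indicator C x * h x) \<partial>M) = 0" by simp
    then have "AE x in M. - (indicator C x * h x) = 0"
      using integral_nonneg_eq_0_iff_AE[OF int nn] by simp
    then have "AE x in M. x \<notin> C"
      by eventually_elim (use C(2) in \<open>auto simp: A_def indicator_def\<close>)
    then show ?thesis using AE_iff_null_sets[OF Cs] by (simp add: null_sets_def)
  qed simp
  have "emeasure M A = 0"
    unfolding inner_regular[OF A] using null by (auto simp: SUP_eq_iff bot_ennreal intro!: antisym SUP_least)
  then have "AE x in M. x \<notin> A" using A by (intro AE_not_in) (simp add: null_sets_def)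
  then show ?thesis by (rule AE_mp) (auto simp: A_def intro!: AE_I2)
qed

lemma Lip_test_eq_0:
  assumes h: "integrable M h"
    and test: "\<And>\<eta>. \<eta> \<in> Lip \<Longrightarrow> (\<And>x. 0 \<le> \<eta> x) \<Longrightarrow> (\<And>x. \<eta> x \<le> 1) \<Longrightarrow> (\<integral>x. \<eta> x * h x \<partial>M) = 0"
  shows "AE x in M. h x = 0"
proof -
  have "AE x in M. 0 \<le> h x" by (rule Lip_test_nonneg[OF h]) (simp add: test)
  moreover have "AE x in M. 0 \<le> - h x"
    by (rule Lip_test_nonneg) (use h test in auto)
  ultimately show ?thesis by eventually_elim simp
qed

text \<open>The element p of least norm in the closure of the affine space of all \<eta> - h is
  orthogonal to every Lipschitz function, hence 0 by \<open>Lip_test_eq_0\<close>.\<close>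

lemma Lip_dense:
  assumes h: "h \<in> L2 M" and e: "0 < e"
  obtains \<eta> where "\<eta> \<in> Lip" "L2_norm M (\<lambda>x. \<eta> x - h x) < e"
proof -
  let ?A = "{\<lambda>x. \<eta> x - h x | \<eta>. \<eta> \<in> Lip}"
  obtain p where p: "p \<in> L2 M" "\<forall>e>0. \<exists>a\<in>?A. L2_norm M (\<lambda>x. a x - p x) < e"
    and ge: "\<forall>q\<in>?A. (L2_norm M p)\<^sup>2 \<le> (\<integral>x. p x * q x \<partial>M)"
  proof (rule L2_convex_projection[of ?A])
    show "?A \<noteq> {}" using Lip_const by blast
    show "?A \<subseteq> L2 M" using h by (auto intro: L2_diff Lip_L2)
    fix a b and t :: real assume "a \<in> ?A" "b \<in> ?A" "0 \<le> t" "t \<le> 1"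
    then obtain \<eta> \<zeta> where "\<eta> \<in> Lip" "\<zeta> \<in> Lip" "a = (\<lambda>x. \<eta> x - h x)" "b = (\<lambda>x. \<zeta> x - h x)" by blast
    moreover from this have "(\<lambda>x. (1 - t) * \<eta> x + t * \<zeta> x) \<in> Lip" by (intro Lip_lincomb)
    moreover have "(1 - t) * (\<eta> x - h x) + t * (\<zeta> x - h x) = ((1 - t) * \<eta> x + t * \<zeta> x) - h x" for x
      by (simp add: algebra_simps)
    ultimately show "(\<lambda>x. (1 - t) * a x + t * b x) \<in> ?A" by auto
  qed (rule that)
  have "(\<integral>x. \<eta> x * p x \<partial>M) = 0" if \<eta>: "\<eta> \<in> Lip" for \<eta>
  proof (rule ccontr)
    let ?c = "\<integral>x. \<eta> x * p x \<partial>M" and ?d = "\<integral>x. p x * h x \<partial>M"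
    assume c: "?c \<noteq> 0"
    have "(L2_norm M p)\<^sup>2 \<le> s * ?c - ?d" for s
    proof -
      have "(\<lambda>x. s * \<eta> x - h x) \<in> ?A" using Lip_lincomb[OF \<eta> \<eta>, of s 0] by auto
      from bspec[OF ge this] have "(L2_norm M p)\<^sup>2 \<le> (\<integral>x. s * (\<eta> x * p x) - p x * h x \<partial>M)"
        by (simp add: algebra_simps)
      also have "\<dots> = s * ?c - ?d"
        using L2_mult_integrable[OF Lip_L2[OF \<eta>] p(1)] L2_mult_integrable[OF p(1) h] by simp
      finally show ?thesis .
    qed
    \<comment> \<open>For this s the right-hand side s c - d equals -1.\<close>
    from this[of "(?d - 1) / ?c"] c have "(L2_norm M p)\<^sup>2 \<le> - 1" by simp
    then show False using zero_le_power2[of "L2_norm M p"] by linarith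
  qed
  then have "AE x in M. p x = 0" by (rule Lip_test_eq_0[OF L2_integrable[OF p(1)]])
  then have p0: "L2_norm M p = 0"
    using L2_norm_cong_AE[of p M "\<lambda>x. 0"] p(1) by (simp add: L2_def L2_norm_def)
  from p(2)[rule_format, OF e] obtain \<eta> where \<eta>: "\<eta> \<in> Lip" "L2_norm M (\<lambda>x. (\<eta> x - h x) - p x) < e" by blast
  have "L2_norm M (\<lambda>x. \<eta> x - h x) \<le> L2_norm M (\<lambda>x. (\<eta> x - h x) - p x) + L2_norm M p"
    using L2_norm_triangle[OF L2_diff[OF L2_diff[OF Lip_L2[OF \<eta>(1)] h] p(1)] p(1)] by simp
  then show thesis using \<eta> p0 that by simp
qed

section \<open>Closure properties of upper gradients\<close>

lemma upper_grad_closed: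
  assumes "f \<in> L2 M" "G \<in> L2 M"
    and app: "\<And>e. 0 < e \<Longrightarrow> \<exists>f' G'. upper_grad M f' G' \<and> L2_norm M (\<lambda>x. f' x - f x) \<le> e \<and> L2_norm M (\<lambda>x. G' x - G x) \<le> e"
  shows "upper_grad M f G"
proof (rule upper_gradI[where C = 2])
  fix e :: real assume e: "0 < e"
  from app[OF e] obtain f' G' where f': "upper_grad M f' G'" "L2_norm M (\<lambda>x. f' x - f x) \<le> e"
    "L2_norm M (\<lambda>x. G' x - G x) \<le> e" by blast
  from upper_gradE[OF f'(1) e] obtain F r where F: "F \<in> Lip" "r \<in> L2 M"
    "L2_norm M (\<lambda>x. F x - f' x) \<le> e" "L2_norm M r \<le> e" "AE x in M. lip F x \<le> G' x + r x" .
  note L = upper_gradD[OF f'(1)]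
  let ?r = "\<lambda>x. r x + (G' x - G x)"
  have r: "?r \<in> L2 M" by (intro L2_add L2_diff F L assms)
  have "L2_norm M ?r \<le> 2 * e"
    using L2_norm_triangle[OF F(2) L2_diff[OF L(2) assms(2)]] F(4) f'(3) by linarith
  moreover have "L2_norm M (\<lambda>x. F x - f x) \<le> 2 * e"
    using L2_norm_triangle_diff[OF Lip_L2[OF F(1)] L(1) assms(1)] F(3) f'(2) by linarith
  moreover have "AE x in M. lip F x \<le> G x + ?r x" using F(5) by eventually_elim simp
  ultimately show "\<exists>F r. F \<in> Lip \<and> r \<in> L2 M \<and> L2_norm M (\<lambda>x. F x - f x) \<le> 2 * e \<and>
      L2_norm M r \<le> 2 * e \<and> (AE x in M. lip F x \<le> G x + r x)"
    using F(1) r by blast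
qed (use assms in auto)

lemma upper_grad_Lip:
  assumes "f \<in> Lip" shows "upper_grad M f (lip f)"
proof (rule upper_gradI[where C = 0])
  show "\<exists>F r. F \<in> Lip \<and> r \<in> L2 M \<and> L2_norm M (\<lambda>x. F x - f x) \<le> 0 * e \<and>
      L2_norm M r \<le> 0 * e \<and> (AE x in M. lip F x \<le> lip f x + r x)" for e
    by (intro exI[of _ f] exI[of _ "\<lambda>x. 0"]) (simp add: assms L2_const L2_norm_def)
qed (use assms Lip_L2 lip_L2 in auto)

text \<open>From 0 \<le> lip F \<le> G + r the negative part of G is at most |r|, and the norm of r
  can be made arbitrarily small.\<close>

lemma upper_grad_nonneg:
  assumes "upper_grad M f G" shows "AE x in M. 0 \<le> G x"
proof -
  let ?n = "\<lambda>x. max 0 (- G x)"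
  have G: "G \<in> L2 M" using upper_gradD(2)[OF assms] .
  have nm: "?n \<in> borel_measurable M" using L2_measurable[OF G] by measurable
  have nL: "?n \<in> L2 M" by (rule L2_bound(1)[OF G nm]) auto
  have "L2_norm M ?n \<le> e" if e: "0 < e" for e
  proof -
    from upper_gradE[OF assms e] obtain F r where F: "F \<in> Lip" "r \<in> L2 M" "L2_norm M r \<le> e"
      "AE x in M. lip F x \<le> G x + r x" .
    have "AE x in M. \<bar>?n x\<bar> \<le> \<bar>r x\<bar>"
      using F(4) 
    proof eventually_elim
      case (elim x)
      then show ?case using lip_nonneg[OF F(1), of x] by linarith
    qed
    from L2_bound(2)[OF F(2) nm this] F(3) show ?thesis by linarith
  qed
  then have "L2_norm M ?n \<le> 0" by (rule field_le_epsilon) simp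
  then have "L2_norm M ?n = 0" using L2_norm_nonneg[of M ?n] by linarith
  then have "AE x in M. ?n x = 0" by (rule L2_norm_zero_AE[OF nL])
  then show ?thesis by eventually_elim (simp add: max_def split: if_splits)
qed

lemma upper_grad_lincomb:
  assumes f: "upper_grad M f F" and g: "upper_grad M g G"
  shows "upper_grad M (\<lambda>x. a * f x + b * g x) (\<lambda>x. \<bar>a\<bar> * F x + \<bar>b\<bar> * G x)"
proof (rule upper_gradI[where C = "\<bar>a\<bar> + \<bar>b\<bar>"])
  fix e :: real assume e: "0 < e"
  from upper_gradE[OF f e] obtain \<phi> r where \<phi>: "\<phi> \<in> Lip" "r \<in> L2 M" "L2_norm M (\<lambda>x. \<phi> x - f x) \<le> e"
    "L2_norm M r \<le> e" "AE x in M. lip \<phi> x \<le> F x + r x" .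
  from upper_gradE[OF g e] obtain \<psi> s where \<psi>: "\<psi> \<in> Lip" "s \<in> L2 M" "L2_norm M (\<lambda>x. \<psi> x - g x) \<le> e"
    "L2_norm M s \<le> e" "AE x in M. lip \<psi> x \<le> G x + s x" .
  note fL = upper_gradD[OF f] and gL = upper_gradD[OF g]
  have sc: "L2_norm M (\<lambda>x. a * h x + b * k x) \<le> (\<bar>a\<bar> + \<bar>b\<bar>) * e"
    if "h \<in> L2 M" "k \<in> L2 M" "L2_norm M h \<le> e" "L2_norm M k \<le> e" for h k and a b :: real
  proof -
    have "L2_norm M (\<lambda>x. a * h x + b * k x) \<le> \<bar>a\<bar> * L2_norm M h + \<bar>b\<bar> * L2_norm M k"
      using L2_norm_triangle[OF L2_scale[OF that(1)] L2_scale[OF that(2)], of a b] by (simp add: L2_norm_scale)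
    also have "\<dots> \<le> \<bar>a\<bar> * e + \<bar>b\<bar> * e" using that by (intro add_mono mult_left_mono) auto
    finally show ?thesis by (simp add: algebra_simps)
  qed
  have "L2_norm M (\<lambda>x. (a * \<phi> x + b * \<psi> x) - (a * f x + b * g x)) \<le> (\<bar>a\<bar> + \<bar>b\<bar>) * e"
    using sc[OF L2_diff[OF Lip_L2[OF \<phi>(1)] fL(1)] L2_diff[OF Lip_L2[OF \<psi>(1)] gL(1)] \<phi>(3) \<psi>(3), of a b]
    by (simp add: algebra_simps)
  moreover have "L2_norm M (\<lambda>x. \<bar>a\<bar> * r x + \<bar>b\<bar> * s x) \<le> (\<bar>a\<bar> + \<bar>b\<bar>) * e"
    using sc[OF \<phi>(2) \<psi>(2) \<phi>(4) \<psi>(4), of "\<bar>a\<bar>" "\<bar>b\<bar>"] by simp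
  moreover have "AE x in M. lip (\<lambda>x. a * \<phi> x + b * \<psi> x) x \<le> (\<bar>a\<bar> * F x + \<bar>b\<bar> * G x) + (\<bar>a\<bar> * r x + \<bar>b\<bar> * s x)"
    using \<phi>(5) \<psi>(5)
  proof eventually_elim
    case (elim x)
    have "\<bar>a\<bar> * lip \<phi> x + \<bar>b\<bar> * lip \<psi> x \<le> \<bar>a\<bar> * (F x + r x) + \<bar>b\<bar> * (G x + s x)"
      using elim by (intro add_mono mult_left_mono) auto
    then show ?case using lip_lincomb[OF \<phi>(1) \<psi>(1), of a b x] by (simp add: algebra_simps)
  qed
  ultimately show "\<exists>\<Phi> \<rho>. \<Phi> \<in> Lip \<and> \<rho> \<in> L2 M \<and> L2_norm M (\<lambda>x. \<Phi> x - (a * f x + b * g x)) \<le> (\<bar>a\<bar> + \<bar>b\<bar>) * e \<and>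
      L2_norm M \<rho> \<le> (\<bar>a\<bar> + \<bar>b\<bar>) * e \<and> (AE x in M. lip \<Phi> x \<le> \<bar>a\<bar> * F x + \<bar>b\<bar> * G x + \<rho> x)"
    using Lip_lincomb[OF \<phi>(1) \<psi>(1), of a b] L2_lincomb[OF \<phi>(2) \<psi>(2), of "\<bar>a\<bar>" "\<bar>b\<bar>"] by blast
qed (use L2_lincomb upper_gradD[OF f] upper_gradD[OF g] in auto)

lemma L2_norm_clip_diff:
  assumes "f \<in> L2 M" "g \<in> L2 M"
  shows "L2_norm M (\<lambda>x. clip c d (f x) - clip c d (g x)) \<le> L2_norm M (\<lambda>x. f x - g x)"
proof (rule L2_bound(2)[OF L2_diff[OF assms]])
  show "(\<lambda>x. clip c d (f x) - clip c d (g x)) \<in> borel_measurable M"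
    using assms[THEN L2_measurable] by measurable
qed (simp add: clip_nonexpansive)

lemma clip_L2:
  assumes "f \<in> L2 M" shows "(\<lambda>x. clip c d (f x)) \<in> L2 M"
proof (rule L2_bounded[where C = "\<bar>c\<bar> + \<bar>d\<bar>"])
  show "(\<lambda>x. clip c d (f x)) \<in> borel_measurable M" using L2_measurable[OF assms] by measurable
  show "AE x in M. \<bar>clip c d (f x)\<bar> \<le> \<bar>c\<bar> + \<bar>d\<bar>" unfolding clip_def by (rule AE_I2) linarith
qed

lemma upper_grad_clip:
  assumes f: "upper_grad M f G"
  shows "upper_grad M (\<lambda>x. clip c d (f x)) G"
proof (rule upper_gradI[where C = 1])
  fix e :: real assume e: "0 < e"
  from upper_gradE[OF f e] obtain F r where F: "F \<in> Lip" "r \<in> L2 M" "L2_norm M (\<lambda>x. F x - f x) \<le> e"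
    "L2_norm M r \<le> e" "AE x in M. lip F x \<le> G x + r x" .
  have "AE x in M. lip (\<lambda>x. clip c d (F x)) x \<le> G x + r x"
    using F(5) by eventually_elim (rule order_trans[OF lip_clip[OF F(1)]])
  then show "\<exists>F r. F \<in> Lip \<and> r \<in> L2 M \<and> L2_norm M (\<lambda>x. F x - clip c d (f x)) \<le> 1 * e \<and>
      L2_norm M r \<le> 1 * e \<and> (AE x in M. lip F x \<le> G x + r x)"
    using Lip_clip[OF F(1), of c d] F L2_norm_clip_diff[OF Lip_L2[OF F(1)] upper_gradD(1)[OF f], of c d]
    by (intro exI[of _ "\<lambda>x. clip c d (F x)"] exI[of _ r]) auto
qed (use upper_gradD[OF f] clip_L2 in auto)

text \<open>The approximation \<phi> of f converges only in L2, and G lies only in L2, so a term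
  such as (\<phi> - f) G need not be small by itself. Truncating the approximations to the common
  bound B of f and g makes \<open>L2_absolutely_continuous\<close> applicable.\<close>

lemma upper_grad_mult:
  assumes f: "upper_grad M f F" and g: "upper_grad M g G"
    and bd: "\<And>x. \<bar>f x\<bar> \<le> B" "\<And>x. \<bar>g x\<bar> \<le> B"
  shows "upper_grad M (\<lambda>x. f x * g x) (\<lambda>x. \<bar>f x\<bar> * G x + \<bar>g x\<bar> * F x)"
proof (rule upper_gradI[where C = "2 * B + 2"])
  note fL = upper_gradD[OF f] and gL = upper_gradD[OF g]
  note fm = L2_measurable[OF fL(1)] and gm = L2_measurable[OF gL(1)]
  have B: "0 \<le> B" using order_trans[OF abs_ge_zero bd(1)] .
  then show "0 \<le> 2 * B + 2" by simp
  have fa: "AE x in M. \<bar>f x\<bar> \<le> B" "AE x in M. \<bar>g x\<bar> \<le> B" using bd by auto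
  show "(\<lambda>x. f x * g x) \<in> L2 M"
    by (rule L2_norm_mult_bounded(1)[OF gL(1) fm fa(1) B])
  have "(\<lambda>x. \<bar>f x\<bar> * G x) \<in> L2 M" "(\<lambda>x. \<bar>g x\<bar> * F x) \<in> L2 M"
    using fa fm gm by (auto intro!: L2_norm_mult_bounded(1)[OF gL(2) _ _ B] L2_norm_mult_bounded(1)[OF fL(2) _ _ B])
  then show GL: "(\<lambda>x. \<bar>f x\<bar> * G x + \<bar>g x\<bar> * F x) \<in> L2 M" by (rule L2_add)
  fix e :: real assume e: "0 < e"
  obtain d1 where d1: "0 < d1" "\<And>h. h \<in> borel_measurable M \<Longrightarrow> (\<And>x. \<bar>h x\<bar> \<le> 2 * B) \<Longrightarrow> L2_norm M h < d1 \<Longrightarrow> L2_norm M (\<lambda>x. h x * G x) < e"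
    by (rule L2_absolutely_continuous[OF gL(2) e, of "2 * B"]) (use B in auto)
  obtain d2 where d2: "0 < d2" "\<And>h. h \<in> borel_measurable M \<Longrightarrow> (\<And>x. \<bar>h x\<bar> \<le> 2 * B) \<Longrightarrow> L2_norm M h < d2 \<Longrightarrow> L2_norm M (\<lambda>x. h x * F x) < e"
    by (rule L2_absolutely_continuous[OF fL(2) e, of "2 * B"]) (use B in auto)
  \<comment> \<open>The halves make d strictly smaller than both thresholds d1 and d2.\<close>
  define d where "d = min e (min (d1 / 2) (d2 / 2))"
  have d: "0 < d" "d \<le> e" "d < d1" "d < d2" using e d1(1) d2(1) by (auto simp: d_def)
  from upper_gradE[OF upper_grad_clip[OF f, of "-B" B] d(1)] obtain \<phi>0 r where \<phi>0: "\<phi>0 \<in> Lip" "r \<in> L2 M"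
    "L2_norm M (\<lambda>x. \<phi>0 x - clip (-B) B (f x)) \<le> d" "L2_norm M r \<le> d" "AE x in M. lip \<phi>0 x \<le> F x + r x" .
  from upper_gradE[OF upper_grad_clip[OF g, of "-B" B] d(1)] obtain \<psi>0 s where \<psi>0: "\<psi>0 \<in> Lip" "s \<in> L2 M"
    "L2_norm M (\<lambda>x. \<psi>0 x - clip (-B) B (g x)) \<le> d" "L2_norm M s \<le> d" "AE x in M. lip \<psi>0 x \<le> G x + s x" .
  define \<phi> where "\<phi> x = clip (-B) B (\<phi>0 x)" for x
  define \<psi> where "\<psi> x = clip (-B) B (\<psi>0 x)" for x
  have cf: "clip (-B) B (f x) = f x" "clip (-B) B (g x) = g x" for x
    using bd[of x] by (auto simp: clip_id abs_le_iff)
  have \<phi>L: "\<phi> \<in> Lip" "\<psi> \<in> Lip" unfolding \<phi>_def \<psi>_def using \<phi>0(1) \<psi>0(1) by (auto intro: Lip_clip)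
  have \<phi>B: "\<bar>\<phi> x\<bar> \<le> B" "\<bar>\<psi> x\<bar> \<le> B" for x
    unfolding \<phi>_def \<psi>_def clip_def using B by linarith+
  have \<phi>d: "L2_norm M (\<lambda>x. \<phi> x - f x) \<le> d" "L2_norm M (\<lambda>x. \<psi> x - g x) \<le> d"
    using L2_norm_clip_diff[OF Lip_L2[OF \<phi>0(1)] fL(1), of "-B" B] L2_norm_clip_diff[OF Lip_L2[OF \<psi>0(1)] gL(1), of "-B" B]
      \<phi>0(3) \<psi>0(3) by (simp_all add: cf \<phi>_def \<psi>_def)
  have \<phi>l: "AE x in M. lip \<phi> x \<le> F x + r x" "AE x in M. lip \<psi> x \<le> G x + s x"
    using \<phi>0(5) \<psi>0(5) unfolding \<phi>_def[abs_def] \<psi>_def[abs_def]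
    by (eventually_elim, blast intro: order_trans[OF lip_clip] \<phi>0(1) \<psi>0(1))+
  have \<phi>m: "\<phi> \<in> borel_measurable M" "\<psi> \<in> borel_measurable M" using \<phi>L by (auto intro: Lip_measurable)
  have dm: "(\<lambda>x. \<phi> x - f x) \<in> borel_measurable M" "(\<lambda>x. \<psi> x - g x) \<in> borel_measurable M"
    using \<phi>m fm gm by auto
  have dL: "(\<lambda>x. \<phi> x - f x) \<in> L2 M" "(\<lambda>x. \<psi> x - g x) \<in> L2 M"
    using \<phi>L fL gL by (auto intro: L2_diff Lip_L2)
  have db: "\<bar>\<phi> x - f x\<bar> \<le> 2 * B" "\<bar>\<psi> x - g x\<bar> \<le> 2 * B" for x
    using \<phi>B[of x] bd[of x] by linarith+
  have e1: "L2_norm M (\<lambda>x. (\<phi> x - f x) * G x) < e" using d1(2)[OF dm(1) db(1)] \<phi>d(1) d(3) by simp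
  have e2: "L2_norm M (\<lambda>x. (\<psi> x - g x) * F x) < e" using d2(2)[OF dm(2) db(2)] \<phi>d(2) d(4) by simp
  have l1: "(\<lambda>x. (\<phi> x - f x) * G x) \<in> L2 M"
    by (rule L2_norm_mult_bounded(1)[OF gL(2) dm(1), of "2 * B"]) (use db B in auto)
  have l2: "(\<lambda>x. (\<psi> x - g x) * F x) \<in> L2 M"
    by (rule L2_norm_mult_bounded(1)[OF fL(2) dm(2), of "2 * B"]) (use db B in auto)
  \<comment> \<open>p collects the error of replacing \<phi>, \<psi> by f, g in front of the
    gradients, q the contribution of the remainders r, s.\<close>
  define p where "p x = \<bar>(\<phi> x - f x) * G x\<bar> + \<bar>(\<psi> x - g x) * F x\<bar>" for x
  define q where "q x = B * \<bar>r x\<bar> + B * \<bar>s x\<bar>" for x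
  have pL: "p \<in> L2 M" unfolding p_def by (intro L2_add L2_abs l1 l2)
  have qL: "q \<in> L2 M" unfolding q_def by (intro L2_add L2_scale L2_abs \<phi>0 \<psi>0)
  have pn: "L2_norm M p \<le> 2 * e"
    using L2_norm_le_add[OF l1 l2 L2_measurable[OF pL]] e1 e2 by (simp add: p_def)
  have qn: "L2_norm M q \<le> 2 * B * e"
  proof -
    have "L2_norm M q \<le> B * L2_norm M r + B * L2_norm M s"
      using L2_norm_triangle[OF L2_scale[OF L2_abs[OF \<phi>0(2)]] L2_scale[OF L2_abs[OF \<psi>0(2)]], of B B] B
      by (simp add: q_def[abs_def] L2_norm_scale L2_norm_abs)
    also have "\<dots> \<le> B * e + B * e"
      using \<phi>0(4) \<psi>0(4) d(2) B by (intro add_mono mult_left_mono) auto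
    finally show ?thesis by simp
  qed
  have "L2_norm M (\<lambda>x. p x + q x) \<le> (2 * B + 2) * e"
    using L2_norm_triangle[OF pL qL] pn qn by (simp add: algebra_simps)
  moreover have "L2_norm M (\<lambda>x. \<phi> x * \<psi> x - f x * g x) \<le> (2 * B + 2) * e"
  proof -
    have n1: "(\<lambda>x. \<phi> x * (\<psi> x - g x)) \<in> L2 M" "L2_norm M (\<lambda>x. \<phi> x * (\<psi> x - g x)) \<le> B * L2_norm M (\<lambda>x. \<psi> x - g x)"
      using \<phi>B B by (auto intro!: L2_norm_mult_bounded[OF dL(2) \<phi>m(1)])
    have n2: "(\<lambda>x. g x * (\<phi> x - f x)) \<in> L2 M" "L2_norm M (\<lambda>x. g x * (\<phi> x - f x)) \<le> B * L2_norm M (\<lambda>x. \<phi> x - f x)"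
      using fa B by (auto intro!: L2_norm_mult_bounded[OF dL(1) gm])
    have "L2_norm M (\<lambda>x. \<phi> x * \<psi> x - f x * g x) \<le> B * L2_norm M (\<lambda>x. \<psi> x - g x) + B * L2_norm M (\<lambda>x. \<phi> x - f x)"
      using L2_norm_triangle[OF n1(1) n2(1)] n1(2) n2(2) by (simp add: algebra_simps)
    also have "\<dots> \<le> B * e + B * e" using \<phi>d d(2) B by (intro add_mono mult_left_mono) auto
    also have "\<dots> \<le> (2 * B + 2) * e" using e by (simp add: algebra_simps)
    finally show ?thesis .
  qed
  moreover have "AE x in M. lip (\<lambda>x. \<phi> x * \<psi> x) x \<le> (\<bar>f x\<bar> * G x + \<bar>g x\<bar> * F x) + (p x + q x)"
    using \<phi>l upper_grad_nonneg[OF f] upper_grad_nonneg[OF g]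
  proof eventually_elim
    case (elim x)
    have "lip (\<lambda>x. \<phi> x * \<psi> x) x \<le> \<bar>\<phi> x\<bar> * lip \<psi> x + \<bar>\<psi> x\<bar> * lip \<phi> x" by (rule lip_mult[OF \<phi>L])
    also have "\<dots> \<le> \<bar>\<phi> x\<bar> * (G x + s x) + \<bar>\<psi> x\<bar> * (F x + r x)"
      using elim by (intro add_mono mult_left_mono) auto
    also have "\<dots> = (\<bar>\<phi> x\<bar> * G x + \<bar>\<psi> x\<bar> * F x) + (\<bar>\<phi> x\<bar> * s x + \<bar>\<psi> x\<bar> * r x)" by (simp add: algebra_simps)
    also have "\<dots> \<le> ((\<bar>f x\<bar> + \<bar>\<phi> x - f x\<bar>) * G x + (\<bar>g x\<bar> + \<bar>\<psi> x - g x\<bar>) * F x) + (B * \<bar>s x\<bar> + B * \<bar>r x\<bar>)"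
      using elim \<phi>B[of x] by (intro add_mono mult_right_mono mult_abs_mono) auto
    also have "\<dots> = (\<bar>f x\<bar> * G x + \<bar>g x\<bar> * F x) + (p x + q x)"
      using elim by (simp add: p_def q_def abs_mult distrib_right)
    finally show ?case .
  qed
  ultimately show "\<exists>\<Phi> \<rho>. \<Phi> \<in> Lip \<and> \<rho> \<in> L2 M \<and> L2_norm M (\<lambda>x. \<Phi> x - f x * g x) \<le> (2 * B + 2) * e \<and>
      L2_norm M \<rho> \<le> (2 * B + 2) * e \<and> (AE x in M. lip \<Phi> x \<le> (\<bar>f x\<bar> * G x + \<bar>g x\<bar> * F x) + \<rho> x)"
    using Lip_mult[OF \<phi>L \<phi>B] L2_add[OF pL qL] by blast
qed

text \<open>A weak form of locality. Lipschitz approximations belonging to the two gradients are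
  glued along \<eta>; since both approximate the same f, the gluing error L |\<phi> - \<psi>| is
  small in L2.\<close>

lemma upper_grad_cutoff:
  assumes F: "upper_grad M f F" and G: "upper_grad M f G"
    and \<eta>: "\<eta> \<in> Lip" "\<And>x. 0 \<le> \<eta> x" "\<And>x. \<eta> x \<le> 1"
  shows "upper_grad M f (\<lambda>x. \<eta> x * F x + (1 - \<eta> x) * G x)"
proof -
  obtain L where L: "0 \<le> L" "\<And>x y. \<bar>\<eta> x - \<eta> y\<bar> \<le> L * dist x y" by (rule LipE[OF \<eta>(1)], rule that)
  note FL = upper_gradD[OF F] and GL = upper_gradD[OF G]
  have \<eta>m: "\<eta> \<in> borel_measurable M" "(\<lambda>x. 1 - \<eta> x) \<in> borel_measurable M"
    using Lip_measurable[OF \<eta>(1)] by auto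
  have \<eta>1: "AE x in M. \<bar>\<eta> x\<bar> \<le> 1" "AE x in M. \<bar>1 - \<eta> x\<bar> \<le> 1" using \<eta>(2,3) by auto
  show ?thesis
  proof (rule upper_gradI[where C = "2 + 2 * L"])
    show "(\<lambda>x. \<eta> x * F x + (1 - \<eta> x) * G x) \<in> L2 M"
      by (intro L2_add L2_norm_mult_bounded(1)[OF FL(2) \<eta>m(1) \<eta>1(1)] L2_norm_mult_bounded(1)[OF GL(2) \<eta>m(2) \<eta>1(2)]) auto
    fix e :: real assume e: "0 < e"
    from upper_gradE[OF F e] obtain \<phi> r where \<phi>: "\<phi> \<in> Lip" "r \<in> L2 M" "L2_norm M (\<lambda>x. \<phi> x - f x) \<le> e"
      "L2_norm M r \<le> e" "AE x in M. lip \<phi> x \<le> F x + r x" .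
    from upper_gradE[OF G e] obtain \<psi> s where \<psi>: "\<psi> \<in> Lip" "s \<in> L2 M" "L2_norm M (\<lambda>x. \<psi> x - f x) \<le> e"
      "L2_norm M s \<le> e" "AE x in M. lip \<psi> x \<le> G x + s x" .
    define \<Phi> where "\<Phi> x = \<eta> x * \<phi> x + (1 - \<eta> x) * \<psi> x" for x
    define \<rho> where "\<rho> x = (\<bar>r x\<bar> + \<bar>s x\<bar>) + L * \<bar>\<phi> x - \<psi> x\<bar>" for x
    have dL: "(\<lambda>x. \<phi> x - f x) \<in> L2 M" "(\<lambda>x. \<psi> x - f x) \<in> L2 M" "(\<lambda>x. \<phi> x - \<psi> x) \<in> L2 M"
      using \<phi> \<psi> FL by (auto intro: L2_diff Lip_L2)
    have dn: "L2_norm M (\<lambda>x. \<phi> x - \<psi> x) \<le> 2 * e"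
      using L2_norm_triangle_diff[OF Lip_L2[OF \<phi>(1)] FL(1) Lip_L2[OF \<psi>(1)]] \<phi>(3) \<psi>(3)
        L2_norm_minus_commute[of M f \<psi>] by linarith
    have \<rho>L: "\<rho> \<in> L2 M" unfolding \<rho>_def by (intro L2_add L2_abs L2_scale \<phi> \<psi> dL)
    have "L2_norm M (\<lambda>x. \<bar>r x\<bar> + \<bar>s x\<bar>) \<le> 2 * e"
      using L2_norm_triangle[OF L2_abs[OF \<phi>(2)] L2_abs[OF \<psi>(2)]] \<phi>(4) \<psi>(4) by (simp add: L2_norm_abs)
    moreover have "L2_norm M (\<lambda>x. L * \<bar>\<phi> x - \<psi> x\<bar>) \<le> L * (2 * e)"
      using L(1) dn by (simp add: L2_norm_scale L2_norm_abs mult_left_mono)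
    ultimately have "L2_norm M \<rho> \<le> (2 + 2 * L) * e"
      using L2_norm_triangle[OF L2_add[OF L2_abs[OF \<phi>(2)] L2_abs[OF \<psi>(2)]] L2_scale[OF L2_abs[OF dL(3)], of L]]
      by (simp add: \<rho>_def[abs_def] algebra_simps)
    moreover have "L2_norm M (\<lambda>x. \<Phi> x - f x) \<le> (2 + 2 * L) * e"
    proof -
      have "\<bar>\<Phi> x - f x\<bar> \<le> \<bar>\<phi> x - f x\<bar> + \<bar>\<psi> x - f x\<bar>" for x
      proof -
        have "\<Phi> x - f x = \<eta> x * (\<phi> x - f x) + (1 - \<eta> x) * (\<psi> x - f x)" by (simp add: \<Phi>_def algebra_simps)
        also have "\<bar>\<dots>\<bar> \<le> \<eta> x * \<bar>\<phi> x - f x\<bar> + (1 - \<eta> x) * \<bar>\<psi> x - f x\<bar>"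
          using \<eta>(2,3)[of x] by (intro order_trans[OF abs_triangle_ineq]) (simp add: abs_mult)
        also have "\<dots> \<le> 1 * \<bar>\<phi> x - f x\<bar> + 1 * \<bar>\<psi> x - f x\<bar>"
          using \<eta>(2,3)[of x] by (intro add_mono mult_right_mono) auto
        finally show ?thesis by simp
      qed
      then have "L2_norm M (\<lambda>x. \<Phi> x - f x) \<le> L2_norm M (\<lambda>x. \<phi> x - f x) + L2_norm M (\<lambda>x. \<psi> x - f x)"
        using Lip_measurable[OF \<phi>(1)] Lip_measurable[OF \<psi>(1)] \<eta>m L2_measurable[OF FL(1)]
        by (intro L2_norm_le_add dL) (auto simp: \<Phi>_def[abs_def])
      also have "\<dots> \<le> 2 * e" using \<phi>(3) \<psi>(3) by simp
      also have "\<dots> \<le> (2 + 2 * L) * e" using L(1) e by (simp add: algebra_simps)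
      finally show ?thesis .
    qed
    moreover have "\<Phi> \<in> Lip"
    proof -
      obtain A where A: "\<And>x. \<bar>\<phi> x\<bar> \<le> A" by (rule Lip_bounded[OF \<phi>(1)], rule that)
      obtain B where B: "\<And>x. \<bar>\<psi> x\<bar> \<le> B" by (rule Lip_bounded[OF \<psi>(1)], rule that)
      have e1: "\<bar>\<eta> x\<bar> \<le> 1" "\<bar>1 - \<eta> x\<bar> \<le> 1" for x using \<eta>(2,3)[of x] by auto
      have "(\<lambda>x. 1 - \<eta> x) \<in> Lip" using Lip_lincomb[OF Lip_const \<eta>(1), of 1 1 "-1"] by simp
      from Lip_lincomb[OF Lip_mult[OF \<eta>(1) \<phi>(1) e1(1) A] Lip_mult[OF this \<psi>(1) e1(2) B], of 1 1]
      show ?thesis by (simp add: \<Phi>_def[abs_def])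
    qed
    moreover have "AE x in M. lip \<Phi> x \<le> (\<eta> x * F x + (1 - \<eta> x) * G x) + \<rho> x"
      using \<phi>(5) \<psi>(5)
    proof eventually_elim
      case (elim x)
      have "lip \<Phi> x \<le> \<eta> x * lip \<phi> x + (1 - \<eta> x) * lip \<psi> x + L * \<bar>\<phi> x - \<psi> x\<bar>"
        unfolding \<Phi>_def[abs_def] by (rule lip_convex_comb[OF \<eta>(1) \<phi>(1) \<psi>(1) \<eta>(2,3) L])
      also have "\<dots> \<le> \<eta> x * (F x + r x) + (1 - \<eta> x) * (G x + s x) + L * \<bar>\<phi> x - \<psi> x\<bar>"
        using elim \<eta>(2,3)[of x] by (intro add_mono mult_left_mono order_refl) auto
      also have "\<dots> = (\<eta> x * F x + (1 - \<eta> x) * G x) + (\<eta> x * r x + (1 - \<eta> x) * s x) + L * \<bar>\<phi> x - \<psi> x\<bar>"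
        by (simp add: algebra_simps)
      also have "\<dots> \<le> (\<eta> x * F x + (1 - \<eta> x) * G x) + (1 * \<bar>r x\<bar> + 1 * \<bar>s x\<bar>) + L * \<bar>\<phi> x - \<psi> x\<bar>"
        using \<eta>(2,3)[of x] by (intro add_mono mult_abs_mono order_refl) auto
      finally show ?case by (simp add: \<rho>_def)
    qed
    ultimately show "\<exists>\<Phi> \<rho>. \<Phi> \<in> Lip \<and> \<rho> \<in> L2 M \<and> L2_norm M (\<lambda>x. \<Phi> x - f x) \<le> (2 + 2 * L) * e \<and>
      L2_norm M \<rho> \<le> (2 + 2 * L) * e \<and> (AE x in M. lip \<Phi> x \<le> (\<eta> x * F x + (1 - \<eta> x) * G x) + \<rho> x)"
      using \<rho>L by blast
  qed (use FL L in auto)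
qed

section \<open>The Cheeger energy and the minimal relaxed gradient\<close>

lemma nn_integral_lip:
  assumes "F \<in> Lip"
  shows "(\<integral>\<^sup>+x. ennreal ((lip F x)\<^sup>2) \<partial>M) / 2 = ennreal ((L2_norm M (lip F))\<^sup>2 / 2)"
proof -
  have "(\<integral>\<^sup>+x. ennreal ((lip F x)\<^sup>2) \<partial>M) = ennreal ((L2_norm M (lip F))\<^sup>2)"
    unfolding L2_norm_sq
    by (rule nn_integral_eq_integral[OF L2_integrable_sq[OF lip_L2[OF assms]]]) simp
  then show ?thesis by (simp add: ennreal_divide_numeral)
qed

lemma Cheeger_le:
  assumes F: "\<And>n. F n \<in> Lip" and f: "f \<in> L2 M"
    and lim: "(\<lambda>n. L2_norm M (\<lambda>x. F n x - f x)) \<longlonglongrightarrow> 0"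
    and k: "\<And>n. (L2_norm M (lip (F n)))\<^sup>2 \<le> k n" "k \<longlonglongrightarrow> \<kappa>"
  shows "Cheeger M f \<le> ennreal (\<kappa> / 2)"
proof -
  have "L2_tendsto M F f" using L2_tendsto_iff[of F M f] Lip_L2[OF F] f lim by simp
  then have "Cheeger M f \<le> liminf (\<lambda>n. (\<integral>\<^sup>+x. ennreal ((lip (F n) x)\<^sup>2) \<partial>M) / 2)"
    unfolding Cheeger_def using F Lip_L2 by (intro INF_lower) auto
  also have "\<dots> \<le> liminf (\<lambda>n. ennreal (k n / 2))"
    unfolding nn_integral_lip[OF F] using k(1) by (intro Liminf_mono always_eventually allI ennreal_leI) simp
  also have "\<dots> = ennreal (\<kappa> / 2)"
    using k(2) by (intro lim_imp_Liminf tendsto_ennrealI tendsto_intros) auto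
  finally show ?thesis .
qed

lemma Cheeger_le_upper_grad:
  assumes "upper_grad M f H"
  shows "Cheeger M f \<le> ennreal ((L2_norm M H)\<^sup>2 / 2)"
proof -
  note fL = upper_gradD[OF assms]
  let ?P = "\<lambda>n F r. F \<in> Lip \<and> r \<in> L2 M \<and> L2_norm M (\<lambda>x. F x - f x) \<le> 1 / real (Suc n) \<and>
     L2_norm M r \<le> 1 / real (Suc n) \<and> (AE x in M. lip F x \<le> H x + r x)"
  have "\<exists>F r. ?P n F r" for n
    by (rule upper_gradE[OF assms, of "1 / real (Suc n)"]) (simp, blast)
  then have "\<forall>n. \<exists>F r. ?P n F r" by blast
  from choice[OF this] obtain F where "\<forall>n. \<exists>r. ?P n (F n) r" ..
  from choice[OF this] obtain r where "\<forall>n. ?P n (F n) (r n)" ..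
  then have F: "\<And>n. F n \<in> Lip" "\<And>n. r n \<in> L2 M" "\<And>n. L2_norm M (\<lambda>x. F n x - f x) \<le> 1 / real (Suc n)"
     "\<And>n. L2_norm M (r n) \<le> 1 / real (Suc n)" "\<And>n. AE x in M. lip (F n) x \<le> H x + r n x"
    by blast+
  show ?thesis
  proof (rule Cheeger_le[OF F(1) fL(1)])
    show "(\<lambda>n. L2_norm M (\<lambda>x. F n x - f x)) \<longlonglongrightarrow> 0"
      by (rule Lim_null_comparison[OF _ inverse_Suc_tendsto]) (simp only: real_norm_def abs_of_nonneg L2_norm_nonneg F(3) eventually_True)
    have "L2_norm M (lip (F n)) \<le> L2_norm M H + 1 / real (Suc n)" for n
    proof -
      have "AE x in M. \<bar>lip (F n) x\<bar> \<le> \<bar>H x + r n x\<bar>"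
        using F(5)[of n] by eventually_elim (use lip_nonneg[OF F(1)] in \<open>auto intro: order_trans\<close>)
      from L2_bound(2)[OF L2_add[OF fL(2) F(2)] lip_measurable_M[OF F(1)] this]
      show ?thesis using L2_norm_triangle[OF fL(2) F(2)[of n]] F(4)[of n] by linarith
    qed
    then show "(L2_norm M (lip (F n)))\<^sup>2 \<le> (L2_norm M H + 1 / real (Suc n))\<^sup>2" for n
      by (intro power_mono) auto
    have "(\<lambda>n. (L2_norm M H + 1 / real (Suc n))\<^sup>2) \<longlonglongrightarrow> (L2_norm M H + 0)\<^sup>2"
      by (intro tendsto_intros inverse_Suc_tendsto)
    then show "(\<lambda>n. (L2_norm M H + 1 / real (Suc n))\<^sup>2) \<longlonglongrightarrow> (L2_norm M H)\<^sup>2" by simp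
  qed
qed

text \<open>\<open>K e\<close> is the infimum of the squared norm of lip F over Lipschitz F within e
  of f; it increases to twice the Cheeger energy as e decreases to 0. Balls around f are convex, so
  midpoints of near-minimisers compete as well, and the parallelogram law makes the local Lipschitz
  constants converge strongly.\<close>

lemma W12_minimising_sequence:
  assumes f: "f \<in> W12 M"
  obtains F G where "\<And>n::nat. F n \<in> Lip" "(\<lambda>n. L2_norm M (\<lambda>x. F n x - f x)) \<longlonglongrightarrow> 0" "G \<in> L2 M"
    "(\<lambda>n. L2_norm M (\<lambda>x. lip (F n) x - G x)) \<longlonglongrightarrow> 0" "Cheeger M f = ennreal ((L2_norm M G)\<^sup>2 / 2)"
proof -
  have fL: "f \<in> L2 M" and fC: "Cheeger M f < \<infinity>" using f by (auto simp: W12_def)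
  define S where "S e = {(L2_norm M (lip F))\<^sup>2 | F. F \<in> Lip \<and> L2_norm M (\<lambda>x. F x - f x) < e}" for e
  define K where "K e = Inf (S e)" for e
  have bdd: "bdd_below (S e)" for e by (rule bdd_belowI[of _ 0]) (auto simp: S_def)
  have Kle: "K e \<le> (L2_norm M (lip F))\<^sup>2" if "F \<in> Lip" "L2_norm M (\<lambda>x. F x - f x) < e" for F e
    unfolding K_def by (rule cInf_lower[OF _ bdd]) (use that in \<open>auto simp: S_def\<close>)
  have competitor: "\<forall>\<^sub>F n in sequentially. K e \<le> (L2_norm M (lip (fs n)))\<^sup>2"
    if "\<forall>n. fs n \<in> Lip \<inter> L2 M" "L2_tendsto M fs f" "0 < e" for fs e
  proof -
    have "(\<lambda>n. L2_norm M (\<lambda>x. fs n x - f x)) \<longlonglongrightarrow> 0"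
      using L2_tendsto_iff[of fs M f] that fL by auto
    then have "\<forall>\<^sub>F n in sequentially. L2_norm M (\<lambda>x. fs n x - f x) < e"
      using that(3) by (rule order_tendstoD)
    then show ?thesis by eventually_elim (use that(1) Kle in blast)
  qed
  obtain fs where fs: "\<forall>n. fs n \<in> Lip \<inter> L2 M" "L2_tendsto M fs f"
    "liminf (\<lambda>n. (\<integral>\<^sup>+x. ennreal ((lip (fs n) x)\<^sup>2) \<partial>M) / 2) < \<infinity>"
    using fC unfolding Cheeger_def INF_less_iff by blast
  then have "liminf (\<lambda>n. ennreal ((L2_norm M (lip (fs n)))\<^sup>2 / 2)) < \<infinity>"
    using nn_integral_lip by simp
  then obtain c where c: "0 \<le> c" "liminf (\<lambda>n. ennreal ((L2_norm M (lip (fs n)))\<^sup>2 / 2)) = ennreal c"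
    by (cases "liminf (\<lambda>n. ennreal ((L2_norm M (lip (fs n)))\<^sup>2 / 2))" rule: ennreal_cases) auto
  \<comment> \<open>Otherwise the energies would be at least c + 1 from some index on, against their
    lower limit c.\<close>
  have "\<exists>n. L2_norm M (\<lambda>x. fs n x - f x) < e \<and> (L2_norm M (lip (fs n)))\<^sup>2 < 2 * (c + 1)" if e: "0 < e" for e
  proof (rule ccontr)
    assume neg: "\<not> ?thesis"
    have "(\<lambda>n. L2_norm M (\<lambda>x. fs n x - f x)) \<longlonglongrightarrow> 0"
      using L2_tendsto_iff[of fs M f] fs fL by auto
    then have "\<forall>\<^sub>F n in sequentially. L2_norm M (\<lambda>x. fs n x - f x) < e"
      using e by (rule order_tendstoD)
    then have "\<forall>\<^sub>F n in sequentially. ennreal (c + 1) \<le> ennreal ((L2_norm M (lip (fs n)))\<^sup>2 / 2)"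
    proof eventually_elim
      case (elim n)
      then have "\<not> (L2_norm M (lip (fs n)))\<^sup>2 < 2 * (c + 1)" using neg by blast
      then show ?case by (intro ennreal_leI) simp
    qed
    then have "ennreal (c + 1) \<le> ennreal c" unfolding c(2)[symmetric] by (rule Liminf_bounded)
    then show False using c(1) by simp
  qed
  then have ne: "\<exists>F. F \<in> Lip \<and> L2_norm M (\<lambda>x. F x - f x) < e \<and> (L2_norm M (lip F))\<^sup>2 < 2 * (c + 1)" if "0 < e" for e
    using fs(1) that by blast
  have Kc: "K e \<le> 2 * (c + 1)" if e: "0 < e" for e
  proof -
    from ne[OF e] obtain F where "F \<in> Lip" "L2_norm M (\<lambda>x. F x - f x) < e" "(L2_norm M (lip F))\<^sup>2 < 2 * (c + 1)" by blast
    with Kle[of F e] show ?thesis by linarith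
  qed
  have S_ne: "S e \<noteq> {}" if "0 < e" for e using ne[OF that] by (auto simp: S_def)
  have Kmono: "K e \<le> K d" if "0 < d" "d \<le> e" for d e
    unfolding K_def by (rule cInf_superset_mono[OF S_ne[OF that(1)] bdd]) (use that in \<open>force simp: S_def\<close>)
  define k where "k n = K (1 / real (Suc n))" for n
  have "incseq k" unfolding k_def by (rule incseq_SucI, rule Kmono) (auto simp: field_simps)
  moreover have "k n \<le> 2 * (c + 1)" for n unfolding k_def by (rule Kc) simp
  ultimately obtain \<kappa> where \<kappa>: "k \<longlonglongrightarrow> \<kappa>" "\<forall>n. k n \<le> \<kappa>" using incseq_convergent by blast
  have "\<exists>F. F \<in> Lip \<and> L2_norm M (\<lambda>x. F x - f x) < 1 / real (Suc n) \<and> (L2_norm M (lip F))\<^sup>2 < k n + 1 / real (Suc n)" for n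
  proof -
    obtain y where "y \<in> S (1 / real (Suc n))" "y < k n + 1 / real (Suc n)"
      using cInf_lessD[OF S_ne, of "1 / real (Suc n)" "k n + 1 / real (Suc n)"] by (auto simp: k_def K_def)
    then show ?thesis by (auto simp: S_def)
  qed
  then obtain F where F: "\<And>n. F n \<in> Lip" "\<And>n. L2_norm M (\<lambda>x. F n x - f x) < 1 / real (Suc n)"
    "\<And>n. (L2_norm M (lip (F n)))\<^sup>2 < k n + 1 / real (Suc n)" by metis
  have Flim: "(\<lambda>n. L2_norm M (\<lambda>x. F n x - f x)) \<longlonglongrightarrow> 0"
    by (rule Lim_null_comparison[OF _ inverse_Suc_tendsto]) (simp only: real_norm_def abs_of_nonneg L2_norm_nonneg less_imp_le[OF F(2)] eventually_True)
  \<comment> \<open>The midpoint of F i and F j is again within 1 / (n + 1) of f, so the squared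
    norm of its \<open>lip\<close> is at least \<open>k n\<close>, while at both ends it is at most
    \<kappa> + 1 / (n + 1).\<close>
  have est: "(L2_norm M (\<lambda>x. lip (F i) x - lip (F j) x))\<^sup>2 \<le> 4 * (\<kappa> - k n) + 4 * (1 / real (Suc n))"
    if ij: "n \<le> i" "n \<le> j" for i j n
  proof -
    have fr: "1 / real (Suc i) \<le> 1 / real (Suc n)" "1 / real (Suc j) \<le> 1 / real (Suc n)"
      using ij by (auto simp: frac_le)
    define m where "m = (\<lambda>x. 1/2 * F i x + 1/2 * F j x)"
    have mL: "m \<in> Lip" unfolding m_def by (rule Lip_lincomb[OF F(1) F(1)])
    have "(\<lambda>x. m x - f x) = (\<lambda>x. 1/2 * (F i x - f x) + 1/2 * (F j x - f x))"
      by (rule ext) (simp add: m_def field_simps)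
    then have "L2_norm M (\<lambda>x. m x - f x) = L2_norm M (\<lambda>x. 1/2 * (F i x - f x) + 1/2 * (F j x - f x))"
      by simp
    also have "\<dots> \<le> 1/2 * L2_norm M (\<lambda>x. F i x - f x) + 1/2 * L2_norm M (\<lambda>x. F j x - f x)"
      using L2_norm_triangle[OF L2_scale[OF L2_diff[OF Lip_L2[OF F(1)] fL]] L2_scale[OF L2_diff[OF Lip_L2[OF F(1)] fL]], of "1/2" i "1/2" j]
      by (simp only: L2_norm_scale)
    also have "\<dots> < 1 / real (Suc n)" using F(2)[of i] F(2)[of j] fr by linarith
    finally have "k n \<le> (L2_norm M (lip m))\<^sup>2" unfolding k_def by (rule Kle[OF mL])
    also have "\<dots> \<le> (L2_norm M (\<lambda>x. (lip (F i) x + lip (F j) x) / 2))\<^sup>2"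
    proof (intro power_mono L2_bound(2) AE_I2)
      show "(\<lambda>x. (lip (F i) x + lip (F j) x) / 2) \<in> L2 M"
        using L2_scale[OF L2_add[OF lip_L2[OF F(1)[of i]] lip_L2[OF F(1)[of j]]], of "1/2"] by simp
      show "\<bar>lip m x\<bar> \<le> \<bar>(lip (F i) x + lip (F j) x) / 2\<bar>" for x
        using lip_lincomb[OF F(1)[of i] F(1)[of j], of "1/2" "1/2" x] lip_nonneg[OF mL, of x]
        by (simp add: m_def)
    qed (use mL lip_measurable_M in auto)
    also have "\<dots> = (L2_norm M (lip (F i)))\<^sup>2 / 2 + (L2_norm M (lip (F j)))\<^sup>2 / 2
        - (L2_norm M (\<lambda>x. lip (F i) x - lip (F j) x))\<^sup>2 / 4"
      by (rule L2_mid_sq[OF lip_L2[OF F(1)] lip_L2[OF F(1)]])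
    finally have "k n \<le> (L2_norm M (lip (F i)))\<^sup>2 / 2 + (L2_norm M (lip (F j)))\<^sup>2 / 2
        - (L2_norm M (\<lambda>x. lip (F i) x - lip (F j) x))\<^sup>2 / 4" .
    moreover have "(L2_norm M (lip (F i)))\<^sup>2 \<le> \<kappa> + 1 / real (Suc n)"
      using less_imp_le[OF F(3)[of i]] add_mono[OF \<kappa>(2)[rule_format, of i] fr(1)] by (rule order_trans)
    moreover have "(L2_norm M (lip (F j)))\<^sup>2 \<le> \<kappa> + 1 / real (Suc n)"
      using less_imp_le[OF F(3)[of j]] add_mono[OF \<kappa>(2)[rule_format, of j] fr(2)] by (rule order_trans)
    ultimately show ?thesis by argo
  qed
  have "\<exists>n0. \<forall>i\<ge>n0. \<forall>j\<ge>n0. L2_norm M (\<lambda>x. lip (F i) x - lip (F j) x) < e" if e: "0 < e" for e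
  proof -
    have "(\<lambda>n. 4 * (\<kappa> - k n) + 4 * (1 / real (Suc n))) \<longlonglongrightarrow> 4 * (\<kappa> - \<kappa>) + 4 * 0"
      by (intro tendsto_intros inverse_Suc_tendsto \<kappa>(1))
    then have "\<forall>\<^sub>F n in sequentially. 4 * (\<kappa> - k n) + 4 * (1 / real (Suc n)) < e\<^sup>2"
      using e by (intro order_tendstoD(2)) auto
    then obtain n where "4 * (\<kappa> - k n) + 4 * (1 / real (Suc n)) < e\<^sup>2" by (auto simp: eventually_sequentially)
    then have "(L2_norm M (\<lambda>x. lip (F i) x - lip (F j) x))\<^sup>2 < e\<^sup>2" if "n \<le> i" "n \<le> j" for i j
      by (rule order_le_less_trans[OF est[OF that]])
    then show ?thesis using e by (intro exI[of _ n] allI impI) (rule power2_less_imp_less[OF _ less_imp_le])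
  qed
  with lip_L2[OF F(1)] obtain G where G: "G \<in> L2 M" "(\<lambda>n. L2_norm M (\<lambda>x. lip (F n) x - G x)) \<longlonglongrightarrow> 0"
    by (rule L2_complete)
  have a: "(\<lambda>n. (L2_norm M (lip (F n)))\<^sup>2) \<longlonglongrightarrow> (L2_norm M G)\<^sup>2"
    by (intro tendsto_power L2_norm_tendsto lip_L2 F G)
  moreover have "(\<lambda>n. (L2_norm M (lip (F n)))\<^sup>2) \<longlonglongrightarrow> \<kappa>"
  proof (rule tendsto_sandwich[OF _ _ \<kappa>(1)])
    show "(\<lambda>n. k n + 1 / real (Suc n)) \<longlonglongrightarrow> \<kappa>" using tendsto_add[OF \<kappa>(1) inverse_Suc_tendsto] by simp
    show "\<forall>\<^sub>F n in sequentially. k n \<le> (L2_norm M (lip (F n)))\<^sup>2"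
      unfolding k_def by (intro always_eventually allI Kle F)
    show "\<forall>\<^sub>F n in sequentially. (L2_norm M (lip (F n)))\<^sup>2 \<le> k n + 1 / real (Suc n)"
      by (intro always_eventually allI less_imp_le F)
  qed
  ultimately have \<kappa>G: "\<kappa> = (L2_norm M G)\<^sup>2" using LIMSEQ_unique by blast
  have "Cheeger M f = ennreal (\<kappa> / 2)"
  proof (rule antisym)
    show "Cheeger M f \<le> ennreal (\<kappa> / 2)"
      by (rule Cheeger_le[OF F(1) fL Flim order_refl]) (use a \<kappa>G in simp)
    have "ennreal (k n / 2) \<le> Cheeger M f" for n
      unfolding Cheeger_def
    proof (rule INF_greatest)
      fix fs assume fs: "fs \<in> {fs. (\<forall>n. fs n \<in> Lip \<inter> L2 M) \<and> L2_tendsto M fs f}"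
      have "\<forall>\<^sub>F j in sequentially. k n \<le> (L2_norm M (lip (fs j)))\<^sup>2"
        unfolding k_def by (rule competitor) (use fs in auto)
      then have "\<forall>\<^sub>F j in sequentially. ennreal (k n / 2) \<le> (\<integral>\<^sup>+x. ennreal ((lip (fs j) x)\<^sup>2) \<partial>M) / 2"
      proof eventually_elim
        case (elim j)
        have "fs j \<in> Lip" using fs by auto
        then show ?case unfolding nn_integral_lip[OF \<open>fs j \<in> Lip\<close>] using elim by (intro ennreal_leI) simp
      qed
      then show "ennreal (k n / 2) \<le> liminf (\<lambda>n. (\<integral>\<^sup>+x. ennreal ((lip (fs n) x)\<^sup>2) \<partial>M) / 2)"
        by (rule Liminf_bounded)
    qed
    moreover have "(\<lambda>n. ennreal (k n / 2)) \<longlonglongrightarrow> ennreal (\<kappa> / 2)"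
      by (intro tendsto_ennrealI tendsto_intros \<kappa>(1)) auto
    ultimately show "ennreal (\<kappa> / 2) \<le> Cheeger M f" by (intro LIMSEQ_le_const2) auto
  qed
  then show thesis using that[OF F(1) Flim G] \<kappa>G by simp
qed

text \<open>Mazur's lemma: convex combinations of the approximating functions turn weak into strong convergence.\<close>

lemma relaxed_gradient_upper_grad:
  assumes rg: "relaxed_gradient M f G" and f: "f \<in> L2 M"
  shows "upper_grad M f G"
proof (rule upper_gradI[where C = 1])
  show GL: "G \<in> L2 M" using rg by (simp add: relaxed_gradient_def)
  fix e :: real assume e: "0 < e"
  from rg obtain fs H where fs: "\<And>n. fs n \<in> Lip" "L2_tendsto M fs f" "L2_weak_tendsto M (\<lambda>n. lip (fs n)) H"
    "AE x in M. H x \<le> G x" by (auto simp: relaxed_gradient_def)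
  have HL: "H \<in> L2 M" using fs(3) by (simp add: L2_weak_tendsto_def)
  have fl: "(\<lambda>n. L2_norm M (\<lambda>x. fs n x - f x)) \<longlonglongrightarrow> 0"
    using L2_tendsto_iff[of fs M f] Lip_L2[OF fs(1)] f fs(2) by simp
  \<comment> \<open>The set is built from L2 majorants of lip F rather than from lip F itself: the
    local Lipschitz constant of a convex combination is only bounded by the combination, and
    admitting majorants makes the set convex.\<close>
  let ?A = "{\<lambda>x. g x - H x | g. g \<in> L2 M \<and> (\<exists>F\<in>Lip. L2_norm M (\<lambda>x. F x - f x) < e \<and> (AE x in M. lip F x \<le> g x))}"
  have inA: "(\<lambda>x. lip (fs n) x - H x) \<in> ?A" if "L2_norm M (\<lambda>x. fs n x - f x) < e" for n
    using that fs(1) lip_L2 by blast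
  have evA: "\<forall>\<^sub>F n in sequentially. (\<lambda>x. lip (fs n) x - H x) \<in> ?A"
    using order_tendstoD(2)[OF fl e] by eventually_elim (rule inA)
  obtain p where p: "p \<in> L2 M" "\<forall>e>0. \<exists>a\<in>?A. L2_norm M (\<lambda>x. a x - p x) < e"
    and ge: "\<forall>q\<in>?A. (L2_norm M p)\<^sup>2 \<le> (\<integral>x. p x * q x \<partial>M)"
  proof (rule L2_convex_projection[of ?A])
    obtain n where "(\<lambda>x. lip (fs n) x - H x) \<in> ?A" using eventually_happens'[OF _ evA] by auto
    then show "?A \<noteq> {}" by blast
    show "?A \<subseteq> L2 M" using HL by (auto intro: L2_diff)
    fix a b and t :: real assume ab: "a \<in> ?A" "b \<in> ?A" and t: "0 \<le> t" "t \<le> 1"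
    from ab(1) obtain g F where g: "a = (\<lambda>x. g x - H x)" "g \<in> L2 M" "F \<in> Lip" "L2_norm M (\<lambda>x. F x - f x) < e"
      "AE x in M. lip F x \<le> g x" by blast
    from ab(2) obtain g' F' where g': "b = (\<lambda>x. g' x - H x)" "g' \<in> L2 M" "F' \<in> Lip" "L2_norm M (\<lambda>x. F' x - f x) < e"
      "AE x in M. lip F' x \<le> g' x" by blast
    let ?F = "\<lambda>x. (1 - t) * F x + t * F' x"
    have "L2_norm M (\<lambda>x. ?F x - f x) = L2_norm M (\<lambda>x. (1 - t) * (F x - f x) + t * (F' x - f x))"
      by (simp add: algebra_simps)
    also have "\<dots> \<le> (1 - t) * L2_norm M (\<lambda>x. F x - f x) + t * L2_norm M (\<lambda>x. F' x - f x)"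
      using L2_norm_triangle[OF L2_scale[OF L2_diff[OF Lip_L2[OF g(3)] f], of "1 - t"] L2_scale[OF L2_diff[OF Lip_L2[OF g'(3)] f], of t]] t
      by (simp add: L2_norm_scale)
    also have "\<dots> < e" using g(4) g'(4) t by (intro convex_bound_lt) auto
    finally have n: "L2_norm M (\<lambda>x. ?F x - f x) < e" .
    have l: "AE x in M. lip ?F x \<le> (1 - t) * g x + t * g' x"
      using g(5) g'(5)
    proof eventually_elim
      case (elim x)
      have "lip ?F x \<le> \<bar>1 - t\<bar> * lip F x + \<bar>t\<bar> * lip F' x" by (rule lip_lincomb[OF g(3) g'(3)])
      also have "\<dots> \<le> (1 - t) * g x + t * g' x"
        using elim t by (intro add_mono mult_mono) (auto intro: lip_nonneg g g')
      finally show ?case .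
    qed
    have "(\<lambda>x. (1 - t) * a x + t * b x) = (\<lambda>x. ((1 - t) * g x + t * g' x) - H x)"
      by (simp add: g(1) g'(1) algebra_simps)
    then show "(\<lambda>x. (1 - t) * a x + t * b x) \<in> ?A"
      using n l Lip_lincomb[OF g(3) g'(3), of "1 - t" t] L2_lincomb[OF g(2) g'(2), of "1 - t" t]
      by (intro CollectI exI[of _ "\<lambda>x. (1 - t) * g x + t * g' x"] conjI bexI[of _ ?F]) simp_all
  qed (rule that)
  \<comment> \<open>For large n the functions lip (fs n) - H belong to \<open>?A\<close>, and they
    converge weakly to 0, so the variational inequality forces p = 0.\<close>
  have "(\<lambda>n. \<integral>x. p x * (lip (fs n) x - H x) \<partial>M) \<longlonglongrightarrow> 0"
  proof -
    have "(\<lambda>n. (\<integral>x. lip (fs n) x * p x \<partial>M) - (\<integral>x. H x * p x \<partial>M)) \<longlonglongrightarrow> (\<integral>x. H x * p x \<partial>M) - (\<integral>x. H x * p x \<partial>M)"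
      using fs(3) p(1) by (intro tendsto_intros) (simp add: L2_weak_tendsto_def)
    moreover have "(\<integral>x. p x * (lip (fs n) x - H x) \<partial>M) = (\<integral>x. lip (fs n) x * p x \<partial>M) - (\<integral>x. H x * p x \<partial>M)" for n
      using L2_mult_integrable[OF lip_L2[OF fs(1)] p(1)] L2_mult_integrable[OF HL p(1)]
      by (simp add: algebra_simps)
    ultimately show ?thesis by simp
  qed
  moreover have "\<forall>\<^sub>F n in sequentially. (L2_norm M p)\<^sup>2 \<le> (\<integral>x. p x * (lip (fs n) x - H x) \<partial>M)"
    using evA by eventually_elim (rule bspec[OF ge])
  ultimately have "(L2_norm M p)\<^sup>2 \<le> 0" by (intro tendsto_lowerbound[of _ _ sequentially]) auto
  then have p0: "L2_norm M p = 0" by simp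
  from p(2)[rule_format, OF e] obtain g F where g: "L2_norm M (\<lambda>x. (g x - H x) - p x) < e" "g \<in> L2 M" "F \<in> Lip"
    "L2_norm M (\<lambda>x. F x - f x) < e" "AE x in M. lip F x \<le> g x" by blast
  have "L2_norm M (\<lambda>x. g x - H x) \<le> e"
    using L2_norm_triangle[OF L2_diff[OF L2_diff[OF g(2) HL] p(1)] p(1)] g(1) p0 by simp
  moreover have "AE x in M. lip F x \<le> G x + (g x - H x)"
    using g(5) fs(4) by eventually_elim linarith
  ultimately show "\<exists>F r. F \<in> Lip \<and> r \<in> L2 M \<and> L2_norm M (\<lambda>x. F x - f x) \<le> 1 * e \<and>
      L2_norm M r \<le> 1 * e \<and> (AE x in M. lip F x \<le> G x + r x)"
    using g(3,4) L2_diff[OF g(2) HL] by (intro exI[of _ F] exI[of _ "\<lambda>x. g x - H x"]) auto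
qed (use f in auto)

lemma W12_I: "upper_grad M f G \<Longrightarrow> f \<in> W12 M"
  using Cheeger_le_upper_grad[of f G] upper_gradD(1)[of M f G]
  by (auto simp: W12_def intro: order_le_less_trans)

text \<open>The strong limit of lip (F n) along a minimising sequence is a relaxed gradient that
  attains the Cheeger energy, and no relaxed gradient has less. Hence the \<open>SOME\<close> in
  \<open>grad_norm\<close> selects a genuine minimiser, with the same norm as that limit.\<close>

lemma
  assumes f: "f \<in> W12 M"
  shows grad_norm_upper_grad: "upper_grad M f (grad_norm M f)"
    and Cheeger_eq: "Cheeger M f = ennreal ((L2_norm M (grad_norm M f))\<^sup>2 / 2)"
proof -
  have fL: "f \<in> L2 M" using f by (simp add: W12_def)
  obtain F G where F: "\<And>n::nat. F n \<in> Lip" "(\<lambda>n. L2_norm M (\<lambda>x. F n x - f x)) \<longlonglongrightarrow> 0" and G: "G \<in> L2 M"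
    "(\<lambda>n. L2_norm M (\<lambda>x. lip (F n) x - G x)) \<longlonglongrightarrow> 0" "Cheeger M f = ennreal ((L2_norm M G)\<^sup>2 / 2)"
    by (rule W12_minimising_sequence[OF f], rule that)
  have "L2_tendsto M F f" using L2_tendsto_iff[of F M f] Lip_L2[OF F(1)] fL F(2) by simp
  moreover have "L2_weak_tendsto M (\<lambda>n. lip (F n)) G"
    unfolding L2_weak_tendsto_def using L2_inner_tendsto[OF lip_L2[OF F(1)] G(1) _ G(2)] lip_L2[OF F(1)] G(1) by blast
  ultimately have rG: "relaxed_gradient M f G"
    unfolding relaxed_gradient_def using F(1) Lip_L2[OF F(1)] G(1) by (intro conjI exI[of _ F] exI[of _ G]) auto
  have min: "(L2_norm M G)\<^sup>2 \<le> (L2_norm M H)\<^sup>2" if "relaxed_gradient M f H" for H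
  proof -
    have "ennreal ((L2_norm M G)\<^sup>2 / 2) \<le> ennreal ((L2_norm M H)\<^sup>2 / 2)"
      unfolding G(3)[symmetric] by (rule Cheeger_le_upper_grad[OF relaxed_gradient_upper_grad[OF that fL]])
    then show ?thesis by simp
  qed
  have "minimal_relaxed_gradient M f G"
    unfolding minimal_relaxed_gradient_def using rG min by (simp add: L2_norm_sq)
  then have m: "minimal_relaxed_gradient M f (grad_norm M f)"
    unfolding grad_norm_def by (rule someI[of "minimal_relaxed_gradient M f"])
  then have r: "relaxed_gradient M f (grad_norm M f)" by (simp add: minimal_relaxed_gradient_def)
  show u: "upper_grad M f (grad_norm M f)"
    by (rule relaxed_gradient_upper_grad[OF r fL])
  have "(L2_norm M (grad_norm M f))\<^sup>2 = (L2_norm M G)\<^sup>2"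
    using min[OF r] m rG by (intro antisym) (simp_all add: minimal_relaxed_gradient_def L2_norm_sq)
  then show "Cheeger M f = ennreal ((L2_norm M (grad_norm M f))\<^sup>2 / 2)" using G(3) by simp
qed

lemma W12_L2: "f \<in> W12 M \<Longrightarrow> f \<in> L2 M"
  by (simp add: W12_def)

lemma grad_norm_L2: "f \<in> W12 M \<Longrightarrow> grad_norm M f \<in> L2 M"
  by (rule upper_gradD(2)[OF grad_norm_upper_grad])

lemma grad_norm_nonneg: "f \<in> W12 M \<Longrightarrow> AE x in M. 0 \<le> grad_norm M f x"
  by (rule upper_grad_nonneg[OF grad_norm_upper_grad])

text \<open>Since \<open>N + t\<eta>(H - N)\<close> is an upper gradient for every cutoff \<open>\<eta>\<close>, minimality of the \<open>L\<^sup>2\<close> norm of \<open>N\<close>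
  gives \<open>N(H - N) \<ge> 0\<close> almost everywhere.\<close>

lemma grad_norm_le:
  assumes H: "upper_grad M f H"
  shows "AE x in M. grad_norm M f x \<le> H x"
proof -
  have f: "f \<in> W12 M" by (rule W12_I[OF H])
  define N where "N = grad_norm M f"
  have N: "upper_grad M f N" unfolding N_def by (rule grad_norm_upper_grad[OF f])
  note NL = upper_gradD(2)[OF N] and HL = upper_gradD(2)[OF H]
  have min: "(L2_norm M N)\<^sup>2 \<le> (L2_norm M K)\<^sup>2" if "upper_grad M f K" for K
    using Cheeger_le_upper_grad[OF that] unfolding Cheeger_eq[OF f] N_def by simp
  have "AE x in M. 0 \<le> N x * (H x - N x)"
  proof (rule Lip_test_nonneg)
    show "integrable M (\<lambda>x. N x * (H x - N x))" by (rule L2_mult_integrable[OF NL L2_diff[OF HL NL]])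
    fix \<eta> :: "'a \<Rightarrow> real" assume \<eta>: "\<eta> \<in> Lip" "\<And>x. 0 \<le> \<eta> x" "\<And>x. \<eta> x \<le> 1"
    have D: "(\<lambda>x. \<eta> x * (H x - N x)) \<in> L2 M"
      by (rule L2_norm_mult_bounded(1)[OF L2_diff[OF HL NL] Lip_measurable[OF \<eta>(1)], of 1]) (use \<eta> in auto)
    let ?D = "\<lambda>x. \<eta> x * (H x - N x)"
    have t: "0 \<le> 2 * (\<integral>x. N x * ?D x \<partial>M) + t * (L2_norm M ?D)\<^sup>2" if t: "0 < t" "t \<le> 1" for t
    proof -
      have "upper_grad M f (\<lambda>x. (t * \<eta> x) * H x + (1 - t * \<eta> x) * N x)"
        using \<eta>(2,3) t Lip_lincomb[OF \<eta>(1) \<eta>(1), of t 0]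
        by (intro upper_grad_cutoff[OF H N]) (auto intro: mult_le_one)
      then have "upper_grad M f (\<lambda>x. N x + t * ?D x)" by (simp add: algebra_simps)
      from min[OF this] have "0 \<le> t * (2 * (\<integral>x. N x * ?D x \<partial>M) + t * (L2_norm M ?D)\<^sup>2)"
        unfolding L2_norm_add_sq[OF NL D] by (simp add: power2_eq_square algebra_simps)
      then show ?thesis using t by (simp add: zero_le_mult_iff)
    qed
    have "((\<lambda>t. 2 * (\<integral>x. N x * ?D x \<partial>M) + t * (L2_norm M ?D)\<^sup>2) \<longlongrightarrow> 2 * (\<integral>x. N x * ?D x \<partial>M) + 0 * (L2_norm M ?D)\<^sup>2) (at_right 0)"
      by (intro tendsto_intros)
    then have "0 \<le> 2 * (\<integral>x. N x * ?D x \<partial>M) + 0 * (L2_norm M ?D)\<^sup>2"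
      by (rule tendsto_lowerbound) (auto simp: eventually_at_right_field intro!: exI[of _ 1] t)
    then show "0 \<le> (\<integral>x. \<eta> x * (N x * (H x - N x)) \<partial>M)" by (simp add: mult.left_commute)
  qed
  \<comment> \<open>Where N > 0 the product inequality gives N \<le> H; where N = 0 the sign of H
    does.\<close>
  then show ?thesis
    using upper_grad_nonneg[OF N] upper_grad_nonneg[OF H] unfolding N_def
    by eventually_elim (auto simp: zero_le_mult_iff)
qed

section \<open>The gradient inner product\<close>

lemma W12_lincomb:
  assumes "f \<in> W12 M" "g \<in> W12 M"
  shows "(\<lambda>x. a * f x + b * g x) \<in> W12 M"
    and "AE x in M. grad_norm M (\<lambda>x. a * f x + b * g x) x \<le> \<bar>a\<bar> * grad_norm M f x + \<bar>b\<bar> * grad_norm M g x"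
  using upper_grad_lincomb[OF grad_norm_upper_grad[OF assms(1)] grad_norm_upper_grad[OF assms(2)], of a b]
  by (auto intro: W12_I grad_norm_le)

lemma W12_add: "f \<in> W12 M \<Longrightarrow> g \<in> W12 M \<Longrightarrow> (\<lambda>x. f x + g x) \<in> W12 M"
  using W12_lincomb(1)[of f g 1 1] by simp

lemma W12_scale: "f \<in> W12 M \<Longrightarrow> (\<lambda>x. a * f x) \<in> W12 M"
  using W12_lincomb(1)[of f f a 0] by simp

lemma W12_minus: "f \<in> W12 M \<Longrightarrow> (\<lambda>x. - f x) \<in> W12 M"
  using W12_scale[of f "-1"] by simp

lemma W12_add_scale: "f \<in> W12 M \<Longrightarrow> g \<in> W12 M \<Longrightarrow> (\<lambda>x. f x + s * g x) \<in> W12 M"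
  using W12_lincomb(1)[of f g 1 s] by simp

lemma Lip_W12: "f \<in> Lip \<Longrightarrow> f \<in> W12 M"
  by (rule W12_I[OF upper_grad_Lip])

lemma grad_norm_Lip: "f \<in> Lip \<Longrightarrow> AE x in M. grad_norm M f x \<le> lip f x"
  by (rule grad_norm_le[OF upper_grad_Lip])

lemma W12_const: "(\<lambda>x. c) \<in> W12 M"
  by (rule Lip_W12[OF Lip_const])

lemma grad_norm_const: "AE x in M. grad_norm M (\<lambda>x. c) x = 0"
proof -
  have l: "lip (\<lambda>x. c) y \<le> 0" for y :: 'a by (rule lip_le) auto
  show ?thesis
    using grad_norm_Lip[OF Lip_const[of c]] grad_norm_nonneg[OF W12_const[of c]]
  proof eventually_elim
    case (elim x)
    then show ?case using l[of x] by linarith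
  qed
qed

text \<open>The upper bound is applied to the factor a and to its inverse.\<close>

lemma grad_norm_scale:
  assumes f: "f \<in> W12 M"
  shows "AE x in M. grad_norm M (\<lambda>x. a * f x) x = \<bar>a\<bar> * grad_norm M f x"
proof (cases "a = 0")
  case True
  then show ?thesis using grad_norm_const[of 0] by simp
next
  case False
  have le: "AE x in M. grad_norm M (\<lambda>x. c * g x) x \<le> \<bar>c\<bar> * grad_norm M g x" if "g \<in> W12 M" for c g
    using W12_lincomb(2)[OF that that, of c 0] by simp
  show ?thesis
    using le[OF f, of a] le[OF W12_scale[OF f, of a], of "1 / a"]
  proof eventually_elim
    case (elim x)
    then have "grad_norm M f x \<le> \<bar>1 / a\<bar> * grad_norm M (\<lambda>x. a * f x) x" using False by simp
    then have "\<bar>a\<bar> * grad_norm M f x \<le> \<bar>a\<bar> * (\<bar>1 / a\<bar> * grad_norm M (\<lambda>x. a * f x) x)"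
      by (rule mult_left_mono) simp
    also have "\<dots> = grad_norm M (\<lambda>x. a * f x) x" using False by (simp flip: mult.assoc abs_mult)
    finally show ?case using elim(1) by simp
  qed
qed

lemma grad_norm_add_const:
  assumes f: "f \<in> W12 M"
  shows "AE x in M. grad_norm M (\<lambda>x. f x - c) x \<le> grad_norm M f x"
  using W12_lincomb(2)[OF f W12_const[of c], of 1 "-1"] grad_norm_const[of c]
  by eventually_elim simp

lemma W12_clip:
  assumes f: "f \<in> W12 M"
  shows "(\<lambda>x. clip c d (f x)) \<in> W12 M" "AE x in M. grad_norm M (\<lambda>x. clip c d (f x)) x \<le> grad_norm M f x"
  using upper_grad_clip[OF grad_norm_upper_grad[OF f], of c d] by (auto intro: W12_I grad_norm_le)

text \<open>The predicate under \<open>SOME\<close> depends on f only through L2 convergence, so it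
  is literally the same for f and g, and the selected functions agree at every point.\<close>

lemma grad_norm_cong:
  assumes f: "f \<in> borel_measurable M" "g \<in> borel_measurable M" "AE x in M. f x = g x"
  shows "grad_norm M f = grad_norm M g"
proof -
  have t: "L2_tendsto M fs f \<longleftrightarrow> L2_tendsto M fs g" for fs
  proof -
    have "(\<integral>\<^sup>+x. ennreal ((fs n x - f x)\<^sup>2) \<partial>M) = (\<integral>\<^sup>+x. ennreal ((fs n x - g x)\<^sup>2) \<partial>M)" for n
      by (rule nn_integral_cong_AE) (use f(3) in \<open>eventually_elim, simp\<close>)
    then show ?thesis by (simp add: L2_tendsto_def)
  qed
  show ?thesis
    unfolding grad_norm_def minimal_relaxed_gradient_def relaxed_gradient_def t ..
qed

lemma W12_cong:
  assumes "f \<in> W12 M" "g \<in> borel_measurable M" "AE x in M. f x = g x"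
  shows "g \<in> W12 M"
proof -
  have "L2_norm M (\<lambda>x. h x - g x) = L2_norm M (\<lambda>x. h x - f x)" if "h \<in> borel_measurable M" for h
  proof (rule L2_norm_cong_AE)
    show "AE x in M. h x - g x = h x - f x" using assms(3) by eventually_elim simp
  qed (intro borel_measurable_diff that assms(2) L2_measurable[OF W12_L2[OF assms(1)]])+
  then have "L2_norm M (\<lambda>x. F x - g x) = L2_norm M (\<lambda>x. F x - f x)" if "F \<in> Lip" for F
    using Lip_measurable[OF that] .
  then have "upper_grad M g (grad_norm M f)"
    using grad_norm_upper_grad[OF assms(1)] L2_cong_AE[OF W12_L2[OF assms(1)] assms(2,3)]
    unfolding upper_grad_def by auto
  then show ?thesis by (rule W12_I)
qed

text \<open>The bound is required at every point, so that products can be estimated without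
  exceptional sets. These functions form the algebra on which the Leibniz rule is proved.\<close>

definition W12b :: "('a \<Rightarrow> real) set" where
  "W12b = {f \<in> W12 M. \<exists>B. \<forall>x. \<bar>f x\<bar> \<le> B}"

lemma W12b_W12: "f \<in> W12b \<Longrightarrow> f \<in> W12 M"
  by (simp add: W12b_def)

lemma W12bE:
  assumes "f \<in> W12b" obtains B where "0 \<le> B" "\<And>x. \<bar>f x\<bar> \<le> B"
proof -
  obtain B where "\<forall>x. \<bar>f x\<bar> \<le> B" using assms by (auto simp: W12b_def)
  then show thesis using that[of B] order_trans[OF abs_ge_zero] by blast
qed

lemma W12bI: "f \<in> W12 M \<Longrightarrow> (\<And>x. \<bar>f x\<bar> \<le> B) \<Longrightarrow> f \<in> W12b"
  by (auto simp: W12b_def)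

lemma Lip_W12b:
  assumes "f \<in> Lip" shows "f \<in> W12b"
  by (rule Lip_bounded[OF assms], rule W12bI[OF Lip_W12[OF assms]])

lemma W12b_const: "(\<lambda>x. c) \<in> W12b"
  by (rule Lip_W12b[OF Lip_const])

lemma W12b_lincomb:
  assumes "f \<in> W12b" "g \<in> W12b" shows "(\<lambda>x. a * f x + b * g x) \<in> W12b"
proof -
  obtain A where A: "0 \<le> A" "\<And>x. \<bar>f x\<bar> \<le> A" by (rule W12bE[OF assms(1)], rule that)
  obtain B where B: "0 \<le> B" "\<And>x. \<bar>g x\<bar> \<le> B" by (rule W12bE[OF assms(2)], rule that)
  show ?thesis
  proof (rule W12bI[OF W12_lincomb(1)])
    fix x
    have "\<bar>a * f x + b * g x\<bar> \<le> \<bar>a\<bar> * \<bar>f x\<bar> + \<bar>b\<bar> * \<bar>g x\<bar>"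
      using abs_triangle_ineq[of "a * f x" "b * g x"] by (simp add: abs_mult)
    also have "\<dots> \<le> \<bar>a\<bar> * A + \<bar>b\<bar> * B" using A B by (intro add_mono mult_left_mono) auto
    finally show "\<bar>a * f x + b * g x\<bar> \<le> \<bar>a\<bar> * A + \<bar>b\<bar> * B" .
  qed (use assms W12b_W12 in auto)
qed

lemma W12b_add_scale: "f \<in> W12b \<Longrightarrow> g \<in> W12b \<Longrightarrow> (\<lambda>x. f x + s * g x) \<in> W12b"
  using W12b_lincomb[of f g 1 s] by simp

lemma W12b_diff: "f \<in> W12b \<Longrightarrow> g \<in> W12b \<Longrightarrow> (\<lambda>x. f x - g x) \<in> W12b"
  using W12b_lincomb[of f g 1 "-1"] by simp

lemma
  assumes f: "f \<in> W12b" and g: "g \<in> W12b"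
  shows W12b_mult: "(\<lambda>x. f x * g x) \<in> W12b"
    and grad_norm_mult: "AE x in M. grad_norm M (\<lambda>x. f x * g x) x \<le> \<bar>f x\<bar> * grad_norm M g x + \<bar>g x\<bar> * grad_norm M f x"
proof -
  obtain A where A: "0 \<le> A" "\<And>x. \<bar>f x\<bar> \<le> A" by (rule W12bE[OF f], rule that)
  obtain B where B: "0 \<le> B" "\<And>x. \<bar>g x\<bar> \<le> B" by (rule W12bE[OF g], rule that)
  have u: "upper_grad M (\<lambda>x. f x * g x) (\<lambda>x. \<bar>f x\<bar> * grad_norm M g x + \<bar>g x\<bar> * grad_norm M f x)"
    by (rule upper_grad_mult[OF grad_norm_upper_grad[OF W12b_W12[OF f]] grad_norm_upper_grad[OF W12b_W12[OF g]], of "max A B"])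
       (use A(2) B(2) in \<open>auto simp: le_max_iff_disj\<close>)
  show "(\<lambda>x. f x * g x) \<in> W12b"
  proof (rule W12bI[OF W12_I[OF u]])
    show "\<bar>f x * g x\<bar> \<le> A * B" for x unfolding abs_mult using A B by (intro mult_mono) auto
  qed
  show "AE x in M. grad_norm M (\<lambda>x. f x * g x) x \<le> \<bar>f x\<bar> * grad_norm M g x + \<bar>g x\<bar> * grad_norm M f x"
    by (rule grad_norm_le[OF u])
qed

lemma W12b_measurable: "f \<in> W12b \<Longrightarrow> f \<in> borel_measurable M"
  using L2_measurable[OF W12_L2[OF W12b_W12]] .

lemma W12b_mult_integrable:
  assumes f: "f \<in> W12b" and g: "integrable M g"
  shows "integrable M (\<lambda>x. f x * g x)"
proof -
  obtain A where A: "0 \<le> A" "\<And>x. \<bar>f x\<bar> \<le> A" by (rule W12bE[OF f], rule that)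
  show ?thesis
  proof (rule Bochner_Integration.integrable_bound)
    show "integrable M (\<lambda>x. A * g x)" using g by simp
    show "(\<lambda>x. f x * g x) \<in> borel_measurable M" using W12b_measurable[OF f] g by auto
    have "norm (f x * g x) \<le> norm (A * g x)" for x
      using A by (simp add: abs_mult mult_right_mono)
    then show "AE x in M. norm (f x * g x) \<le> norm (A * g x)" by simp
  qed
qed

text \<open>The positive part of d lies below every r n, so its integral is 0. This turns
  convergence of errors in mean into an a.e. inequality without passing to a subsequence.\<close>

lemma AE_le_0_of_integral_tendsto_0:
  fixes d :: "'a \<Rightarrow> real"
  assumes d: "d \<in> borel_measurable M" and r: "\<And>n::nat. integrable M (r n)"
    and le: "\<And>n. AE x in M. 0 \<le> r n x \<and> d x \<le> r n x" and lim: "(\<lambda>n. \<integral>x. r n x \<partial>M) \<longlonglongrightarrow> 0"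
  shows "AE x in M. d x \<le> 0"
proof -
  have i: "integrable M (\<lambda>x. max 0 (d x))"
    by (rule Bochner_Integration.integrable_bound[OF r[of 0]]) (use d le[of 0] in \<open>auto elim: eventually_mono\<close>)
  have "(\<integral>x. max 0 (d x) \<partial>M) \<le> (\<integral>x. r n x \<partial>M)" for n
    by (rule integral_mono_AE[OF i r]) (use le[of n] in \<open>eventually_elim, simp\<close>)
  then have "(\<integral>x. max 0 (d x) \<partial>M) \<le> 0" using lim by (intro LIMSEQ_le_const) auto
  moreover have "0 \<le> (\<integral>x. max 0 (d x) \<partial>M)" by (rule integral_nonneg_AE) simp
  ultimately have "(\<integral>x. max 0 (d x) \<partial>M) = 0" by simp
  then have "AE x in M. max 0 (d x) = 0" using integral_nonneg_eq_0_iff_AE[OF i] by simp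
  then show ?thesis by eventually_elim simp
qed

section \<open>Convexity of the squared gradient and its difference quotients\<close>

lemma grad_sq_convex:
  assumes f: "f \<in> W12 M" and g: "g \<in> W12 M" and t: "0 \<le> t" "t \<le> 1"
  shows "AE x in M. (grad_norm M (\<lambda>x. (1 - t) * f x + t * g x) x)\<^sup>2
    \<le> (1 - t) * (grad_norm M f x)\<^sup>2 + t * (grad_norm M g x)\<^sup>2"
  using W12_lincomb(2)[OF f g, of "1 - t" t] grad_norm_nonneg[OF W12_lincomb(1)[OF f g, of "1 - t" t]]
proof eventually_elim
  case (elim x)
  let ?a = "grad_norm M f x" and ?b = "grad_norm M g x"
  have "(grad_norm M (\<lambda>x. (1 - t) * f x + t * g x) x)\<^sup>2 \<le> ((1 - t) * ?a + t * ?b)\<^sup>2"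
    using elim t by (intro power_mono) auto
  \<comment> \<open>The square of a convex combination falls short of the combination of the squares
    by t (1 - t) (a - b)^2.\<close>
  also have "\<dots> = (1 - t) * ?a\<^sup>2 + t * ?b\<^sup>2 - t * (1 - t) * (?a - ?b)\<^sup>2"
    by (simp add: power2_eq_square algebra_simps)
  also have "\<dots> \<le> (1 - t) * ?a\<^sup>2 + t * ?b\<^sup>2" using t by simp
  finally show ?case .
qed

text \<open>The quotient occurring in \<open>is_grad_inner\<close>. It is the slope of the chord
  from 0 to s of the convex function s \<mapsto> |\<nabla>(f + s g)|^2 / 2, whence its monotonicity
  in s.\<close>

definition grad_diff :: "('a \<Rightarrow> real) \<Rightarrow> ('a \<Rightarrow> real) \<Rightarrow> real \<Rightarrow> 'a \<Rightarrow> real" where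
  "grad_diff f g s x = ((grad_norm M (\<lambda>y. f y + s * g y) x)\<^sup>2 - (grad_norm M f x)\<^sup>2) / (2 * s)"

lemma grad_diff_integrable:
  assumes "f \<in> W12 M" "g \<in> W12 M"
  shows "integrable M (grad_diff f g s)"
  unfolding grad_diff_def
  by (intro Bochner_Integration.integrable_diff integrable_divide_zero impI L2_integrable_sq grad_norm_L2 W12_add_scale assms)

text \<open>f + s g is the convex combination of f and f + t g in which f + t g has weight s /
  t.\<close>

lemma grad_diff_mono:
  assumes f: "f \<in> W12 M" and g: "g \<in> W12 M" and s: "0 < s" "s \<le> t"
  shows "AE x in M. grad_diff f g s x \<le> grad_diff f g t x"
proof -
  have st: "0 \<le> s / t" "s / t \<le> 1" using s by auto
  have "(1 - s / t) * f x + s / t * (f x + t * g x) = f x + s * g x" for x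
    using s by (simp add: field_simps)
  with grad_sq_convex[OF f W12_add_scale[OF f g, of t] st]
  have "AE x in M. (grad_norm M (\<lambda>x. f x + s * g x) x)\<^sup>2
    \<le> (1 - s / t) * (grad_norm M f x)\<^sup>2 + s / t * (grad_norm M (\<lambda>x. f x + t * g x) x)\<^sup>2" by simp
  then show ?thesis
  proof eventually_elim
    case (elim x)
    let ?A = "(grad_norm M (\<lambda>x. f x + s * g x) x)\<^sup>2" and ?B = "(grad_norm M (\<lambda>x. f x + t * g x) x)\<^sup>2"
      and ?C = "(grad_norm M f x)\<^sup>2"
    from elim have "?A - ?C \<le> s / t * (?B - ?C)" by (simp add: algebra_simps)
    then have "(?A - ?C) / (2 * s) \<le> (s / t * (?B - ?C)) / (2 * s)" using s by (intro divide_right_mono) auto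
    then show ?case using s by (simp add: grad_diff_def)
  qed
qed

lemma grad_diff_minus: "grad_diff f g (- s) x = - grad_diff f (\<lambda>x. - g x) s x"
  by (simp add: grad_diff_def)

text \<open>f is the midpoint of f + s g and f - s g.\<close>

lemma grad_diff_neg_le_pos:
  assumes f: "f \<in> W12 M" and g: "g \<in> W12 M" and s: "0 < s"
  shows "AE x in M. grad_diff f g (- s) x \<le> grad_diff f g s x"
proof -
  have "(1 - 1/2) * (f x + s * g x) + 1/2 * (f x + (-s) * g x) = f x" for x by (simp add: field_simps)
  with grad_sq_convex[OF W12_add_scale[OF f g, of s] W12_add_scale[OF f g, of "- s"], of "1/2"]
  have "AE x in M. (grad_norm M f x)\<^sup>2
    \<le> (1 - 1/2) * (grad_norm M (\<lambda>x. f x + s * g x) x)\<^sup>2 + 1/2 * (grad_norm M (\<lambda>x. f x + (-s) * g x) x)\<^sup>2" by simp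
  then show ?thesis
  proof eventually_elim
    case (elim x)
    let ?A = "(grad_norm M (\<lambda>x. f x + s * g x) x)\<^sup>2" and ?B = "(grad_norm M (\<lambda>x. f x + - s * g x) x)\<^sup>2"
      and ?C = "(grad_norm M f x)\<^sup>2"
    have "c - b \<le> a - c" if "c \<le> (1 - 1/2) * a + 1/2 * b" for a b c :: real using that by argo
    from this[OF elim] have "?C - ?B \<le> ?A - ?C" .
    then have "(?C - ?B) / (2 * s) \<le> (?A - ?C) / (2 * s)" using s by (intro divide_right_mono) auto
    then show ?case by (simp add: grad_diff_def minus_divide_left)
  qed
qed

lemma grad_diff_bounds:
  assumes f: "f \<in> W12 M" and g: "g \<in> W12 M" and s: "s \<noteq> 0" "\<bar>s\<bar> \<le> t"
  shows "AE x in M. grad_diff f g (- t) x \<le> grad_diff f g s x \<and> grad_diff f g s x \<le> grad_diff f g t x"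
proof -
  let ?s = "\<bar>s\<bar>"
  have s0: "0 < ?s" using s by simp
  have "AE x in M. grad_diff f g (- t) x \<le> grad_diff f g (- ?s) x"
    using grad_diff_mono[OF f W12_minus[OF g] s0 s(2)] unfolding grad_diff_minus by eventually_elim simp
  then show ?thesis
    using grad_diff_neg_le_pos[OF f g s0] grad_diff_mono[OF f g s0 s(2)]
    by eventually_elim (use s(1) in \<open>cases "s > 0", auto simp: abs_if\<close>)
qed

end

section \<open>The energy form and the existence of gradient inner products\<close>

locale hilbert_mms = compact_mms +
  assumes Hilbertian: "infinitesimally_Hilbertian M"
begin

definition is_energy_form :: "(('a \<Rightarrow> real) \<Rightarrow> ('a \<Rightarrow> real) \<Rightarrow> real) \<Rightarrow> bool" where
  "is_energy_form B \<longleftrightarrow> (\<forall>f\<in>W12 M. \<forall>g\<in>W12 M. B f g = B g f) \<and>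
        (\<forall>f\<in>W12 M. \<forall>g\<in>W12 M. \<forall>h\<in>W12 M. \<forall>a b. B (\<lambda>x. a * f x + b * g x) h = a * B f h + b * B g h) \<and>
        (\<forall>f\<in>W12 M. B f f \<ge> 0 \<and> Cheeger M f = ennreal (B f f))"

text \<open>The factor 2 undoes the factor 1/2 in the Cheeger energy, so that
  \<open>energy f f\<close> is the integral of |\<nabla>f|^2. By polarisation, any two admissible
  choices of the form agree on \<open>W12 M\<close>.\<close>

definition energy :: "('a \<Rightarrow> real) \<Rightarrow> ('a \<Rightarrow> real) \<Rightarrow> real" where
  "energy f g = 2 * (SOME B. is_energy_form B) f g"

lemma
  shows energy_sym: "f \<in> W12 M \<Longrightarrow> g \<in> W12 M \<Longrightarrow> energy f g = energy g f"
    and energy_lincomb: "f \<in> W12 M \<Longrightarrow> g \<in> W12 M \<Longrightarrow> h \<in> W12 M \<Longrightarrow>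
      energy (\<lambda>x. a * f x + b * g x) h = a * energy f h + b * energy g h"
    and energy_self: "f \<in> W12 M \<Longrightarrow> energy f f = (\<integral>x. (grad_norm M f x)\<^sup>2 \<partial>M)"
proof -
  have "\<exists>B. is_energy_form B"
    using Hilbertian unfolding infinitesimally_Hilbertian_def quadratic_form_on_def is_energy_form_def .
  then have "is_energy_form (SOME B. is_energy_form B)" by (rule someI_ex)
  then obtain B where B: "is_energy_form B" and e: "\<And>f g. energy f g = 2 * B f g"
    by (simp add: energy_def)
  show "f \<in> W12 M \<Longrightarrow> g \<in> W12 M \<Longrightarrow> energy f g = energy g f"
    using B by (simp add: e is_energy_form_def)
  show "f \<in> W12 M \<Longrightarrow> g \<in> W12 M \<Longrightarrow> h \<in> W12 M \<Longrightarrow>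
      energy (\<lambda>x. a * f x + b * g x) h = a * energy f h + b * energy g h"
    using B by (simp add: e is_energy_form_def distrib_left)
  assume f: "f \<in> W12 M"
  then have "0 \<le> B f f" "ennreal (B f f) = ennreal ((L2_norm M (grad_norm M f))\<^sup>2 / 2)"
    using B Cheeger_eq[OF f] by (auto simp: is_energy_form_def)
  then show "energy f f = (\<integral>x. (grad_norm M f x)\<^sup>2 \<partial>M)"
    unfolding e by (simp add: L2_norm_sq)
qed

lemma energy_lincomb_right: "f \<in> W12 M \<Longrightarrow> g \<in> W12 M \<Longrightarrow> h \<in> W12 M \<Longrightarrow>
      energy h (\<lambda>x. a * f x + b * g x) = a * energy h f + b * energy h g"
  using energy_lincomb[of f g h a b] energy_sym[of h] W12_lincomb(1)[of f g a b] by simp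

lemma energy_nonneg: "f \<in> W12 M \<Longrightarrow> 0 \<le> energy f f"
  by (simp add: energy_self)

lemma energy_add_scale:
  assumes "f \<in> W12 M" "g \<in> W12 M"
  shows "energy (\<lambda>x. f x + s * g x) (\<lambda>x. f x + s * g x) = energy f f + 2 * s * energy f g + s\<^sup>2 * energy g g"
proof -
  have h: "(\<lambda>x. f x + s * g x) \<in> W12 M" by (rule W12_add_scale[OF assms])
  have "energy (\<lambda>x. f x + s * g x) h = energy f h + s * energy g h" if "h \<in> W12 M" for h
    using energy_lincomb[OF assms that, of 1 s] by simp
  moreover have "energy k (\<lambda>x. f x + s * g x) = energy k f + s * energy k g" if "k \<in> W12 M" for k
    using energy_lincomb_right[OF assms that, of 1 s] by simp
  ultimately show ?thesis
    using h assms energy_sym[OF assms] by (simp add: power2_eq_square algebra_simps)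
qed

lemma integral_grad_diff:
  assumes f: "f \<in> W12 M" and g: "g \<in> W12 M" and s: "s \<noteq> 0"
  shows "(\<integral>x. grad_diff f g s x \<partial>M) = energy f g + s / 2 * energy g g"
proof -
  have "(\<integral>x. grad_diff f g s x \<partial>M) = (energy (\<lambda>x. f x + s * g x) (\<lambda>x. f x + s * g x) - energy f f) / (2 * s)"
    unfolding grad_diff_def energy_self[OF f] energy_self[OF W12_add_scale[OF f g]]
    using L2_integrable_sq[OF grad_norm_L2] f W12_add_scale[OF f g] by simp
  also have "\<dots> = energy f g + s / 2 * energy g g"
    unfolding energy_add_scale[OF f g] using s by (simp add: field_simps power2_eq_square)
  finally show ?thesis .
qed

text \<open>The left and right difference quotients enclose the derivative, and because the energy
  is quadratic their mean gap vanishes linearly in t. Existence and uniqueness of the gradient inner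
  product both rest on this.\<close>

lemma grad_diff_gap:
  assumes f: "f \<in> W12 M" and g: "g \<in> W12 M" and t: "0 < t"
  shows "(\<integral>x. grad_diff f g t x - grad_diff f g (- t) x \<partial>M) = t * energy g g"
  using integral_grad_diff[OF f g, of t] integral_grad_diff[OF f g, of "- t"] t
    grad_diff_integrable[OF f g] by simp

lemma tendsto_inverse_Suc: "(\<lambda>n. 1 / real (Suc n) * c) \<longlonglongrightarrow> 0"
  using tendsto_mult_left_zero[OF inverse_Suc_tendsto] .

text \<open>Differentiability of the energy forces the monotone difference quotients from both sides to
  have the same limit.\<close>

lemma grad_inner_exists:
  assumes f: "f \<in> W12 M" and g: "g \<in> W12 M"
  obtains u where "is_grad_inner M f g u"
    "\<And>t. 0 < t \<Longrightarrow> AE x in M. grad_diff f g (- t) x \<le> u x \<and> u x \<le> grad_diff f g t x"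
proof -
  \<comment> \<open>The quotients along s = 1 / (n + 1) decrease and are bounded below by the left
    quotients, so they converge a.e.; u is their limit.\<close>
  define q where "q n = grad_diff f g (1 / real (Suc n))" for n
  have q_int: "integrable M (q n)" for n unfolding q_def by (rule grad_diff_integrable[OF f g])
  define u where "u x = lim (\<lambda>n. q n x)" for x
  have um: "u \<in> borel_measurable M"
    unfolding u_def by (rule borel_measurable_lim_metric) (use q_int in auto)
  have b: "AE x in M. \<forall>n. grad_diff f g (- (1 / real (Suc k))) x \<le> q (k + n) x" for k
    unfolding AE_all_countable q_def
  proof
    fix n
    show "AE x in M. grad_diff f g (- (1 / real (Suc k))) x \<le> grad_diff f g (1 / real (Suc (k + n))) x"
      using grad_diff_bounds[OF f g, of "1 / real (Suc (k + n))" "1 / real (Suc k)"] by (auto simp: frac_le elim: eventually_mono)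
  qed
  then have b': "AE x in M. \<forall>k n. grad_diff f g (- (1 / real (Suc k))) x \<le> q (k + n) x"
    by (simp add: AE_all_countable)
  have "AE x in M. \<forall>n. q (Suc n) x \<le> q n x"
    unfolding AE_all_countable q_def by (intro allI grad_diff_mono[OF f g]) (auto simp: frac_le)
  then have ub: "AE x in M. \<forall>k. grad_diff f g (- (1 / real (Suc k))) x \<le> u x \<and> u x \<le> q k x"
    using b'
  proof eventually_elim
    case (elim x)
    have dec: "decseq (\<lambda>n. q n x)" by (rule decseq_SucI) (use elim(1) in blast)
    have "grad_diff f g (- (1 / real (Suc 0))) x \<le> q n x" for n
      using elim(2)[rule_format, of 0 n] by simp
    then obtain L where L: "(\<lambda>n. q n x) \<longlonglongrightarrow> L" "\<forall>n. L \<le> q n x" using decseq_convergent[OF dec] by blast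
    have "grad_diff f g (- (1 / real (Suc k))) x \<le> L" for k
    proof (rule LIMSEQ_le_const[OF L(1)], intro exI[of _ k] allI impI)
      fix n assume "k \<le> n"
      then show "grad_diff f g (- (1 / real (Suc k))) x \<le> q n x"
        using elim(2)[rule_format, of k "n - k"] by simp
    qed
    then show ?case using L limI[OF L(1)] by (simp add: u_def)
  qed
  have bnd: "AE x in M. grad_diff f g (- t) x \<le> u x \<and> u x \<le> grad_diff f g t x" if t: "0 < t" for t
  proof -
    obtain n where n: "1 / real (Suc n) < t" using nat_approx_posE[OF t] by auto
    have "AE x in M. grad_diff f g (- t) x \<le> grad_diff f g (- (1 / real (Suc n))) x"
      using grad_diff_bounds[OF f g, of "- (1 / real (Suc n))" t] n by (auto elim: eventually_mono)
    moreover have "AE x in M. q n x \<le> grad_diff f g t x"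
      unfolding q_def using grad_diff_bounds[OF f g, of "1 / real (Suc n)" t] n by (auto elim: eventually_mono)
    ultimately show ?thesis using ub
    proof eventually_elim
      case (elim x)
      from elim(3)[rule_format, of n] elim(1,2) show ?case by linarith
    qed
  qed
  have ui: "integrable M u"
  proof (rule Bochner_Integration.integrable_bound)
    show "integrable M (\<lambda>x. \<bar>grad_diff f g 1 x\<bar> + \<bar>grad_diff f g (-1) x\<bar>)"
      by (intro Bochner_Integration.integrable_add integrable_abs grad_diff_integrable[OF f g])
    show "AE x in M. norm (u x) \<le> norm (\<bar>grad_diff f g 1 x\<bar> + \<bar>grad_diff f g (-1) x\<bar>)"
      using bnd[OF zero_less_one] by eventually_elim auto
  qed (rule um)
  \<comment> \<open>Both the quotient at s and u lie between the left and right quotients at |s|, so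
    \<open>grad_diff_gap\<close> bounds their L1 distance.\<close>
  have est: "(\<integral>x. \<bar>grad_diff f g s x - u x\<bar> \<partial>M) \<le> \<bar>s\<bar> * energy g g" if s: "s \<noteq> 0" for s
  proof -
    have "(\<integral>x. \<bar>grad_diff f g s x - u x\<bar> \<partial>M) \<le> (\<integral>x. grad_diff f g \<bar>s\<bar> x - grad_diff f g (- \<bar>s\<bar>) x \<partial>M)"
    proof (rule integral_mono_AE)
      have "AE x in M. grad_diff f g (- \<bar>s\<bar>) x \<le> u x \<and> u x \<le> grad_diff f g \<bar>s\<bar> x"
        using s by (intro bnd) simp
      moreover have "AE x in M. grad_diff f g (- \<bar>s\<bar>) x \<le> grad_diff f g s x \<and> grad_diff f g s x \<le> grad_diff f g \<bar>s\<bar> x"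
        by (rule grad_diff_bounds[OF f g s]) simp
      ultimately show "AE x in M. \<bar>grad_diff f g s x - u x\<bar> \<le> grad_diff f g \<bar>s\<bar> x - grad_diff f g (- \<bar>s\<bar>) x"
        by eventually_elim linarith
    qed (intro integrable_abs Bochner_Integration.integrable_diff grad_diff_integrable[OF f g] ui)+
    then show ?thesis using grad_diff_gap[OF f g, of "\<bar>s\<bar>"] s by simp
  qed
  have "((\<lambda>s. \<integral>x. \<bar>grad_diff f g s x - u x\<bar> \<partial>M) \<longlongrightarrow> 0) (at 0)"
  proof (rule Lim_null_comparison)
    show "\<forall>\<^sub>F s in at 0. norm (\<integral>x. \<bar>grad_diff f g s x - u x\<bar> \<partial>M) \<le> \<bar>s\<bar> * energy g g"
      using eventually_neq_at_within[of "0::real" 0 UNIV] by eventually_elim (use est in simp)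
    have "((\<lambda>s. \<bar>s\<bar> * energy g g) \<longlongrightarrow> \<bar>0\<bar> * energy g g) (at 0)" by (intro tendsto_intros)
    then show "((\<lambda>s. \<bar>s\<bar> * energy g g) \<longlongrightarrow> 0) (at 0)" by simp
  qed
  then have "is_grad_inner M f g u" using ui by (simp add: is_grad_inner_def grad_diff_def)
  then show thesis using bnd that by blast
qed

text \<open>The function selected by \<open>SOME\<close> is known only as an L1 limit. It agrees
  a.e. with the monotone limit \<open>u\<close> of \<open>grad_inner_exists\<close> and so inherits
  the pointwise bounds of u.\<close>

lemma
  assumes f: "f \<in> W12 M" and g: "g \<in> W12 M"
  shows grad_inner_integrable: "integrable M (grad_inner M f g)"
    and grad_inner_bounds: "0 < t \<Longrightarrow> AE x in M. grad_diff f g (- t) x \<le> grad_inner M f g x \<and> grad_inner M f g x \<le> grad_diff f g t x"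
proof -
  let ?w = "grad_inner M f g"
  obtain u where u: "is_grad_inner M f g u"
    "\<And>t. 0 < t \<Longrightarrow> AE x in M. grad_diff f g (- t) x \<le> u x \<and> u x \<le> grad_diff f g t x"
    by (rule grad_inner_exists[OF f g], rule that)
  have w: "is_grad_inner M f g ?w" unfolding grad_inner_def by (rule someI[of "is_grad_inner M f g", OF u(1)])
  then show wi: "integrable M ?w" by (simp add: is_grad_inner_def)
  have ui: "integrable M u" using u(1) by (simp add: is_grad_inner_def)
  have "((\<lambda>s. (\<integral>x. \<bar>grad_diff f g s x - ?w x\<bar> \<partial>M) + (\<integral>x. \<bar>grad_diff f g s x - u x\<bar> \<partial>M)) \<longlongrightarrow> 0 + 0) (at 0)"
    using w u(1) by (intro tendsto_add) (simp_all add: is_grad_inner_def grad_diff_def)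
  moreover have "(\<integral>x. \<bar>?w x - u x\<bar> \<partial>M) \<le> (\<integral>x. \<bar>grad_diff f g s x - ?w x\<bar> \<partial>M) + (\<integral>x. \<bar>grad_diff f g s x - u x\<bar> \<partial>M)" for s
  proof -
    have "(\<integral>x. \<bar>?w x - u x\<bar> \<partial>M) \<le> (\<integral>x. \<bar>grad_diff f g s x - ?w x\<bar> + \<bar>grad_diff f g s x - u x\<bar> \<partial>M)"
      using wi ui grad_diff_integrable[OF f g] by (intro integral_mono_AE) auto
    then show ?thesis using wi ui grad_diff_integrable[OF f g] by simp
  qed
  ultimately have "(\<integral>x. \<bar>?w x - u x\<bar> \<partial>M) \<le> 0 + 0"
    by (intro tendsto_lowerbound) auto
  moreover have "0 \<le> (\<integral>x. \<bar>?w x - u x\<bar> \<partial>M)" by (rule integral_nonneg_AE) simp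
  ultimately have "(\<integral>x. \<bar>?w x - u x\<bar> \<partial>M) = 0" by simp
  then have "AE x in M. \<bar>?w x - u x\<bar> = 0"
    using integral_nonneg_eq_0_iff_AE[of M "\<lambda>x. \<bar>?w x - u x\<bar>"] wi ui by simp
  then show "0 < t \<Longrightarrow> AE x in M. grad_diff f g (- t) x \<le> ?w x \<and> ?w x \<le> grad_diff f g t x"
    using u(2)[of t] by (auto elim!: eventually_elim2)
qed

lemma grad_inner_measurable: "f \<in> W12 M \<Longrightarrow> g \<in> W12 M \<Longrightarrow> grad_inner M f g \<in> borel_measurable M"
  using grad_inner_integrable by blast

text \<open>Unites the bounds from both sides, since multiplication by a negative s reverses the
  lower one. The inner product is thus a subgradient at 0 of the convex function s \<mapsto>
  |\<nabla>(f + s g)|^2 / 2.\<close>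

lemma grad_inner_subgradient:
  assumes f: "f \<in> W12 M" and g: "g \<in> W12 M"
  shows "AE x in M. s * grad_inner M f g x \<le> ((grad_norm M (\<lambda>y. f y + s * g y) x)\<^sup>2 - (grad_norm M f x)\<^sup>2) / 2"
proof (cases "s = 0")
  case False
  have "AE x in M. grad_diff f g (- \<bar>s\<bar>) x \<le> grad_inner M f g x \<and> grad_inner M f g x \<le> grad_diff f g \<bar>s\<bar> x"
    using False by (intro grad_inner_bounds[OF f g]) simp
  then show ?thesis
  proof eventually_elim
    case (elim x)
    have "s * grad_inner M f g x \<le> s * grad_diff f g s x"
      using elim by (cases "0 < s") (auto simp: abs_if mult_left_mono mult_left_mono_neg split: if_splits)
    then show ?case using False by (simp add: grad_diff_def)
  qed
qed simp

text \<open>Every subgradient lies between the left and right quotients, whose mean gap tends to 0.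
  Identities for the inner product are thereby reduced to checking one inequality.\<close>

lemma grad_inner_unique:
  assumes f: "f \<in> W12 M" and g: "g \<in> W12 M" and l: "l \<in> borel_measurable M"
    and sub: "\<And>s. AE x in M. s * l x \<le> ((grad_norm M (\<lambda>y. f y + s * g y) x)\<^sup>2 - (grad_norm M f x)\<^sup>2) / 2"
  shows "AE x in M. grad_inner M f g x = l x"
proof -
  let ?w = "grad_inner M f g"
  have lb: "AE x in M. grad_diff f g (- t) x \<le> l x \<and> l x \<le> grad_diff f g t x" if "0 < t" for t
    using sub[of t] sub[of "- t"] by eventually_elim (use that in \<open>auto simp: grad_diff_def field_simps\<close>)
  have "AE x in M. \<bar>?w x - l x\<bar> \<le> 0"
  proof (rule AE_le_0_of_integral_tendsto_0)
    let ?r = "\<lambda>n x. grad_diff f g (1 / real (Suc n)) x - grad_diff f g (- (1 / real (Suc n))) x"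
    show "(\<lambda>x. \<bar>?w x - l x\<bar>) \<in> borel_measurable M" using l grad_inner_measurable[OF f g] by measurable
    show "integrable M (?r n)" for n
      using grad_diff_integrable[OF f g] by auto
    have p: "0 < 1 / real (Suc n)" for n by simp
    show "AE x in M. 0 \<le> ?r n x \<and> \<bar>?w x - l x\<bar> \<le> ?r n x" for n
      using lb[OF p[of n]] grad_inner_bounds[OF f g p[of n]] by eventually_elim linarith
    show "(\<lambda>n. \<integral>x. ?r n x \<partial>M) \<longlonglongrightarrow> 0"
      unfolding grad_diff_gap[OF f g p] by (rule tendsto_inverse_Suc)
  qed
  then show ?thesis by eventually_elim simp
qed

lemma integral_grad_inner:
  assumes f: "f \<in> W12 M" and g: "g \<in> W12 M"
  shows "(\<integral>x. grad_inner M f g x \<partial>M) = energy f g"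
proof -
  have p: "0 < 1 / real (Suc n)" for n by simp
  let ?I = "\<integral>x. grad_inner M f g x \<partial>M"
  have "?I \<le> energy f g + 1 / real (Suc n) * (energy g g / 2)" for n
  proof -
    have "?I \<le> (\<integral>x. grad_diff f g (1 / real (Suc n)) x \<partial>M)"
      by (rule integral_mono_AE[OF grad_inner_integrable[OF f g] grad_diff_integrable[OF f g]])
         (use grad_inner_bounds[OF f g p[of n]] in \<open>eventually_elim, simp\<close>)
    then show ?thesis using integral_grad_diff[OF f g, of "1 / real (Suc n)"] by simp
  qed
  moreover have "energy f g - 1 / real (Suc n) * (energy g g / 2) \<le> ?I" for n
  proof -
    have "(\<integral>x. grad_diff f g (- (1 / real (Suc n))) x \<partial>M) \<le> ?I"
      by (rule integral_mono_AE[OF grad_diff_integrable[OF f g] grad_inner_integrable[OF f g]])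
         (use grad_inner_bounds[OF f g p[of n]] in \<open>eventually_elim, simp\<close>)
    then show ?thesis using integral_grad_diff[OF f g, of "- (1 / real (Suc n))"] by simp
  qed
  moreover have "(\<lambda>n. energy f g + 1 / real (Suc n) * (energy g g / 2)) \<longlonglongrightarrow> energy f g + 0"
    "(\<lambda>n. energy f g - 1 / real (Suc n) * (energy g g / 2)) \<longlonglongrightarrow> energy f g - 0"
    by (intro tendsto_intros tendsto_inverse_Suc)+
  ultimately show ?thesis
    by (intro antisym) (auto intro: LIMSEQ_le_const LIMSEQ_le_const2)
qed

section \<open>Calculus of the gradient inner product\<close>

lemma grad_inner_cong:
  assumes "g \<in> borel_measurable M" "g' \<in> borel_measurable M" "AE x in M. g x = g' x" "f \<in> borel_measurable M"
  shows "grad_inner M f g = grad_inner M f g'"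
proof -
  have "grad_norm M (\<lambda>y. f y + e * g y) = grad_norm M (\<lambda>y. f y + e * g' y)" for e
    by (rule grad_norm_cong) (use assms in \<open>auto elim: eventually_mono\<close>)
  then show ?thesis unfolding grad_inner_def is_grad_inner_def by simp
qed

lemma grad_inner_scale:
  assumes f: "f \<in> W12 M" and g: "g \<in> W12 M"
  shows "AE x in M. grad_inner M f (\<lambda>x. a * g x) x = a * grad_inner M f g x"
proof (rule grad_inner_unique[OF f W12_scale[OF g]])
  show "(\<lambda>x. a * grad_inner M f g x) \<in> borel_measurable M" using grad_inner_measurable[OF f g] by auto
  show "AE x in M. s * (a * grad_inner M f g x)
      \<le> ((grad_norm M (\<lambda>y. f y + s * (a * g y)) x)\<^sup>2 - (grad_norm M f x)\<^sup>2) / 2" for s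
    using grad_inner_subgradient[OF f g, of "s * a"] by (simp add: mult.assoc)
qed

text \<open>f + s (g + h) is the midpoint of f + 2 s g and f + 2 s h, so convexity bounds the
  quotient for g + h at s by the sum of the quotients for g and h at 2 s. That sum exceeds the sum
  of the inner products by an amount of mean s (energy g g + energy h h).\<close>

lemma grad_inner_subadd:
  assumes f: "f \<in> W12 M" and g: "g \<in> W12 M" and h: "h \<in> W12 M"
  shows "AE x in M. grad_inner M f (\<lambda>x. g x + h x) x \<le> grad_inner M f g x + grad_inner M f h x"
proof -
  let ?u = "grad_inner M f (\<lambda>x. g x + h x)" and ?v = "grad_inner M f g" and ?w = "grad_inner M f h"
  have gh: "(\<lambda>x. g x + h x) \<in> W12 M" by (rule W12_add[OF g h])
  have "AE x in M. ?u x - (?v x + ?w x) \<le> 0"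
  proof (rule AE_le_0_of_integral_tendsto_0)
    let ?t = "\<lambda>n. 1 / real (Suc n)"
    let ?r = "\<lambda>n x. (grad_diff f g (2 * ?t n) x - ?v x) + (grad_diff f h (2 * ?t n) x - ?w x)"
    have p: "0 < ?t n" "0 < 2 * ?t n" for n by simp_all
    show "(\<lambda>x. ?u x - (?v x + ?w x)) \<in> borel_measurable M"
      using grad_inner_measurable[OF f g] grad_inner_measurable[OF f h] grad_inner_measurable[OF f gh] by measurable
    note int = grad_inner_integrable[OF f g] grad_inner_integrable[OF f h] grad_diff_integrable[OF f g] grad_diff_integrable[OF f h]
    show "integrable M (?r n)" for n
      by (intro Bochner_Integration.integrable_add Bochner_Integration.integrable_diff int)
    show "AE x in M. 0 \<le> ?r n x \<and> ?u x - (?v x + ?w x) \<le> ?r n x" for n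
    proof -
      let ?s = "?t n"
      have "(1 - 1/2) * (a + (2 * s) * b) + 1/2 * (a + (2 * s) * c) = a + s * (b + c)" for a b c s :: real
        by (simp add: field_simps)
      note eq = this
      have "AE x in M. (grad_norm M (\<lambda>x. f x + ?s * (g x + h x)) x)\<^sup>2
          \<le> (1 - 1/2) * (grad_norm M (\<lambda>x. f x + (2 * ?s) * g x) x)\<^sup>2 + 1/2 * (grad_norm M (\<lambda>x. f x + (2 * ?s) * h x) x)\<^sup>2"
        using grad_sq_convex[OF W12_add_scale[OF f g, of "2 * ?s"] W12_add_scale[OF f h, of "2 * ?s"], of "1/2"]
        unfolding eq by simp
      then show ?thesis
        using grad_inner_bounds[OF f g p(2)[of n]] grad_inner_bounds[OF f h p(2)[of n]] grad_inner_bounds[OF f gh p(1)[of n]]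
      proof eventually_elim
        case (elim x)
        have "c / (2 * ?s) \<le> (a / (2 * (2 * ?s)) + b / (2 * (2 * ?s)))" if "c \<le> (a + b) / 2" for a b c
        proof -
          have "c / (2 * ?s) \<le> ((a + b) / 2) / (2 * ?s)" using that by (intro divide_right_mono) auto
          also have "\<dots> = a / (2 * (2 * ?s)) + b / (2 * (2 * ?s))" by (simp only: add_divide_distrib divide_divide_eq_left mult.left_commute mult.assoc)
          finally show ?thesis .
        qed
        note half = this
        have "grad_diff f (\<lambda>x. g x + h x) ?s x \<le> grad_diff f g (2 * ?s) x + grad_diff f h (2 * ?s) x"
          unfolding grad_diff_def by (rule half) (use elim(1) in argo)
        with elim(2-4) show ?case by linarith
      qed
    qed
    have "(\<integral>x. ?r n x \<partial>M) = ?t n * (energy g g + energy h h)" for n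
    proof -
      have "(\<integral>x. ?r n x \<partial>M) = ((\<integral>x. grad_diff f g (2 * ?t n) x \<partial>M) - (\<integral>x. ?v x \<partial>M))
          + ((\<integral>x. grad_diff f h (2 * ?t n) x \<partial>M) - (\<integral>x. ?w x \<partial>M))"
        using int by (simp only: Bochner_Integration.integral_add Bochner_Integration.integral_diff Bochner_Integration.integrable_diff)
      also have "\<dots> = (energy f g + 2 * ?t n / 2 * energy g g - energy f g) + (energy f h + 2 * ?t n / 2 * energy h h - energy f h)"
        using p(2)[of n] by (simp only: integral_grad_diff[OF f g] integral_grad_diff[OF f h]
          integral_grad_inner[OF f g] integral_grad_inner[OF f h])
      also have "(a + 2 * t / 2 * c - a) + (b + 2 * t / 2 * d - b) = t * (c + d)" for a b c d t :: real
        by (simp add: algebra_simps)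
      finally show ?thesis .
    qed
    then show "(\<lambda>n. \<integral>x. ?r n x \<partial>M) \<longlonglongrightarrow> 0" using tendsto_inverse_Suc by simp
  qed
  then show ?thesis by eventually_elim simp
qed

text \<open>Subadditivity for -g and -h gives the reverse inequality.\<close>

lemma grad_inner_add:
  assumes f: "f \<in> W12 M" and g: "g \<in> W12 M" and h: "h \<in> W12 M"
  shows "AE x in M. grad_inner M f (\<lambda>x. g x + h x) x = grad_inner M f g x + grad_inner M f h x"
proof -
  have "AE x in M. grad_inner M f (\<lambda>x. (-1) * g x + (-1) * h x) x
      \<le> grad_inner M f (\<lambda>x. (-1) * g x) x + grad_inner M f (\<lambda>x. (-1) * h x) x"
    by (rule grad_inner_subadd[OF f W12_scale[OF g] W12_scale[OF h]])
  moreover have "AE x in M. grad_inner M f (\<lambda>x. (-1) * g x + (-1) * h x) x = (-1) * grad_inner M f (\<lambda>x. g x + h x) x"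
    using grad_inner_scale[OF f W12_add[OF g h], of "-1"] by (simp add: add.commute)
  ultimately show ?thesis
    using grad_inner_subadd[OF f g h] grad_inner_scale[OF f g, of "-1"] grad_inner_scale[OF f h, of "-1"]
    by eventually_elim linarith
qed

lemma grad_inner_lincomb:
  assumes f: "f \<in> W12 M" and g: "g \<in> W12 M" and h: "h \<in> W12 M"
  shows "AE x in M. grad_inner M f (\<lambda>x. a * g x + b * h x) x = a * grad_inner M f g x + b * grad_inner M f h x"
  using grad_inner_add[OF f W12_scale[OF g, of a] W12_scale[OF h, of b]] grad_inner_scale[OF f g, of a] grad_inner_scale[OF f h, of b]
  by eventually_elim simp

lemma grad_inner_self:
  assumes f: "f \<in> W12 M"
  shows "AE x in M. grad_inner M f f x = (grad_norm M f x)\<^sup>2"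
proof (rule grad_inner_unique[OF f f])
  show "(\<lambda>x. (grad_norm M f x)\<^sup>2) \<in> borel_measurable M"
    using L2_measurable[OF grad_norm_L2[OF f]] by measurable
  fix s
  have eq: "(\<lambda>y. f y + s * f y) = (\<lambda>y. (1 + s) * f y)" by (simp add: algebra_simps)
  show "AE x in M. s * (grad_norm M f x)\<^sup>2 \<le> ((grad_norm M (\<lambda>y. f y + s * f y) x)\<^sup>2 - (grad_norm M f x)\<^sup>2) / 2"
    unfolding eq using grad_norm_scale[OF f, of "1 + s"]
  proof eventually_elim
    case (elim x)
    \<comment> \<open>Along its own direction |\<nabla>(f + s f)|^2 = (1 + s)^2 |\<nabla>f|^2, and
      (1 + s)^2 \<ge> 1 + 2 s is the subgradient inequality.\<close>
    have "(1 + 2 * s) * (grad_norm M f x)\<^sup>2 \<le> (1 + s)\<^sup>2 * (grad_norm M f x)\<^sup>2"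
      by (intro mult_right_mono) (auto simp: power2_eq_square algebra_simps)
    then show ?case unfolding elim by (simp add: power_mult_distrib algebra_simps)
  qed
qed

text \<open>Inserting |\<nabla>(f + s g)| \<le> |\<nabla>f| + s |\<nabla>g| in the subgradient
  inequality and dividing by s leaves an excess of s |\<nabla>g|^2 / 2. The countably many s = 1 /
  (n + 1) share one exceptional null set.\<close>

lemma grad_inner_le:
  assumes f: "f \<in> W12 M" and g: "g \<in> W12 M"
  shows "AE x in M. grad_inner M f g x \<le> grad_norm M f x * grad_norm M g x"
proof -
  have "AE x in M. \<forall>n. grad_inner M f g x \<le> grad_norm M f x * grad_norm M g x + 1 / real (Suc n) * ((grad_norm M g x)\<^sup>2 / 2)"
    unfolding AE_all_countable
  proof
    fix n
    let ?s = "1 / real (Suc n)"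
    have s: "0 < ?s" by simp
    have "AE x in M. grad_norm M (\<lambda>x. f x + ?s * g x) x \<le> \<bar>1\<bar> * grad_norm M f x + \<bar>?s\<bar> * grad_norm M g x"
      using W12_lincomb(2)[OF f g, of 1 ?s] by simp
    then show "AE x in M. grad_inner M f g x \<le> grad_norm M f x * grad_norm M g x + ?s * ((grad_norm M g x)\<^sup>2 / 2)"
      using grad_inner_subgradient[OF f g, of ?s] grad_norm_nonneg[OF W12_add_scale[OF f g, of ?s]]
    proof eventually_elim
      case (elim x)
      let ?a = "grad_norm M f x" and ?b = "grad_norm M g x" and ?c = "grad_norm M (\<lambda>x. f x + ?s * g x) x"
      have "?c\<^sup>2 \<le> (?a + ?s * ?b)\<^sup>2" using elim(1,3) s by (intro power_mono) auto
      also have "(a + s * b)\<^sup>2 = a\<^sup>2 + 2 * (s * (a * b + s * (b\<^sup>2 / 2)))" for a b s :: real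
        by (simp add: power2_eq_square algebra_simps)
      finally have "?s * grad_inner M f g x \<le> ?s * (?a * ?b + ?s * (?b\<^sup>2 / 2))"
        using elim(2) by argo
      then show ?case using s by (simp only: mult_le_cancel_left_pos)
    qed
  qed
  then show ?thesis
  proof eventually_elim
    case (elim x)
    have "(\<lambda>n. grad_norm M f x * grad_norm M g x + 1 / real (Suc n) * ((grad_norm M g x)\<^sup>2 / 2))
        \<longlonglongrightarrow> grad_norm M f x * grad_norm M g x + 0"
      by (intro tendsto_intros tendsto_inverse_Suc)
    then show ?case using elim by (intro LIMSEQ_le_const) auto
  qed
qed

lemma grad_inner_Cauchy_Schwarz:
  assumes f: "f \<in> W12 M" and g: "g \<in> W12 M"
  shows "AE x in M. \<bar>grad_inner M f g x\<bar> \<le> grad_norm M f x * grad_norm M g x"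
  using grad_inner_le[OF f g] grad_inner_le[OF f W12_scale[OF g, of "-1"]]
    grad_inner_scale[OF f g, of "-1"] grad_norm_scale[OF g, of "-1"]
  by eventually_elim simp

lemma grad_inner_const:
  assumes f: "f \<in> W12 M" shows "AE x in M. grad_inner M f (\<lambda>x. c) x = 0"
  using grad_inner_Cauchy_Schwarz[OF f W12_const[of c]] grad_norm_const[of c] by eventually_elim simp

lemma energy_Cauchy_Schwarz:
  assumes f: "f \<in> W12 M" and g: "g \<in> W12 M"
  shows "(\<integral>x. \<bar>grad_inner M f g x\<bar> \<partial>M) \<le> sqrt (energy f f) * sqrt (energy g g)"
proof -
  note L = grad_norm_L2[OF f] grad_norm_L2[OF g]
  have "(\<integral>x. \<bar>grad_inner M f g x\<bar> \<partial>M) \<le> (\<integral>x. grad_norm M f x * grad_norm M g x \<partial>M)"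
    by (rule integral_mono_AE) (use grad_inner_integrable[OF f g] L2_mult_integrable[OF L] grad_inner_Cauchy_Schwarz[OF f g] in auto)
  also have "\<dots> \<le> L2_norm M (grad_norm M f) * L2_norm M (grad_norm M g)"
    using L2_Cauchy_Schwarz[OF L] by linarith
  finally show ?thesis by (simp add: L2_norm_def energy_self f g)
qed

text \<open>The Leibniz rule follows from the product bound for \<open>(g - c)(h - d)\<close>, by letting the rational
  constants \<open>c\<close>, \<open>d\<close> tend to \<open>g x\<close>, \<open>h x\<close>.\<close>

lemma grad_inner_mult:
  assumes f: "f \<in> W12 M" and g: "g \<in> W12b" and h: "h \<in> W12b"
  shows "AE x in M. grad_inner M f (\<lambda>x. g x * h x) x = g x * grad_inner M f h x + h x * grad_inner M f g x"
proof -
  note gW = W12b_W12[OF g] and hW = W12b_W12[OF h] and ghW = W12b_W12[OF W12b_mult[OF g h]]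
  let ?N = "grad_norm M" and ?I = "grad_inner M f"
  have "AE x in M. \<bar>?I (\<lambda>x. g x * h x) x - c * ?I h x - d * ?I g x\<bar>
      \<le> ?N f x * (\<bar>g x - c\<bar> * ?N h x + \<bar>h x - d\<bar> * ?N g x)" for c d
  proof -
    have gc: "(\<lambda>x. g x - c) \<in> W12b" and hd: "(\<lambda>x. h x - d) \<in> W12b"
      using W12b_diff[OF g W12b_const] W12b_diff[OF h W12b_const] by auto
    have lW: "(\<lambda>x. c * h x + d * g x) \<in> W12 M" by (rule W12_lincomb(1)[OF hW gW])
    \<comment> \<open>The product becomes a linear combination of g h, h, g and a constant, so that
      linearity in the second argument applies; the constant contributes 0.\<close>
    have eq: "(\<lambda>x. (g x - c) * (h x - d)) = (\<lambda>x. 1 * (g x * h x) + 1 * ((-1) * (c * h x + d * g x) + (c * d) * 1))"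
      by (simp add: algebra_simps)
    have "AE x in M. ?I (\<lambda>x. (g x - c) * (h x - d)) x = ?I (\<lambda>x. g x * h x) x - c * ?I h x - d * ?I g x"
      unfolding eq
      using grad_inner_lincomb[OF f ghW W12_lincomb(1)[OF lW W12_const, of "-1" "c * d" 1], of 1 1]
        grad_inner_lincomb[OF f lW W12_const, of "-1" "c * d" 1] grad_inner_lincomb[OF f hW gW, of c d] grad_inner_const[OF f, of 1]
      by eventually_elim simp
    then show ?thesis
      using grad_inner_Cauchy_Schwarz[OF f W12b_W12[OF W12b_mult[OF gc hd]]] grad_norm_mult[OF gc hd]
        grad_norm_add_const[OF gW, of c] grad_norm_add_const[OF hW, of d] grad_norm_nonneg[OF f]
    proof eventually_elim
      case (elim x)
      have "?N (\<lambda>x. (g x - c) * (h x - d)) x \<le> \<bar>g x - c\<bar> * ?N (\<lambda>x. h x - d) x + \<bar>h x - d\<bar> * ?N (\<lambda>x. g x - c) x"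
        by (rule elim)
      also have "\<dots> \<le> \<bar>g x - c\<bar> * ?N h x + \<bar>h x - d\<bar> * ?N g x"
        using elim by (intro add_mono mult_left_mono) auto
      finally have "?N f x * ?N (\<lambda>x. (g x - c) * (h x - d)) x \<le> ?N f x * (\<bar>g x - c\<bar> * ?N h x + \<bar>h x - d\<bar> * ?N g x)"
        using elim by (intro mult_left_mono) auto
      then show ?case using elim(1,2) by simp
    qed
  qed
  then have "AE x in M. \<forall>c\<in>\<rat>. \<forall>d\<in>\<rat>. \<bar>?I (\<lambda>x. g x * h x) x - c * ?I h x - d * ?I g x\<bar>
      \<le> ?N f x * (\<bar>g x - c\<bar> * ?N h x + \<bar>h x - d\<bar> * ?N g x)"
    by (simp add: AE_ball_countable countable_rat)
  then show ?thesis
  proof eventually_elim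
    case (elim x)
    obtain c where c: "\<And>n::nat. c n \<in> \<rat>" "c \<longlonglongrightarrow> g x" by (rule rational_sequence, rule that)
    obtain d where d: "\<And>n::nat. d n \<in> \<rat>" "d \<longlonglongrightarrow> h x" by (rule rational_sequence, rule that)
    have "\<bar>?I (\<lambda>x. g x * h x) x - g x * ?I h x - h x * ?I g x\<bar>
        \<le> ?N f x * (\<bar>g x - g x\<bar> * ?N h x + \<bar>h x - h x\<bar> * ?N g x)"
    proof (rule LIMSEQ_le)
      show "(\<lambda>n. \<bar>?I (\<lambda>x. g x * h x) x - c n * ?I h x - d n * ?I g x\<bar>)
          \<longlonglongrightarrow> \<bar>?I (\<lambda>x. g x * h x) x - g x * ?I h x - h x * ?I g x\<bar>"
        by (intro tendsto_intros c d)
      show "(\<lambda>n. ?N f x * (\<bar>g x - c n\<bar> * ?N h x + \<bar>h x - d n\<bar> * ?N g x))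
          \<longlonglongrightarrow> ?N f x * (\<bar>g x - g x\<bar> * ?N h x + \<bar>h x - h x\<bar> * ?N g x)"
        by (intro tendsto_intros c d)
    qed (use elim c d in auto)
    then show ?case by simp
  qed
qed

text \<open>The chain rule in the first argument: \<open>2f\<langle>\<nabla>f, \<cdot>\<rangle>\<close> is a subgradient at \<open>f\<^sup>2\<close>.\<close>

lemma grad_inner_square_left:
  assumes f: "f \<in> W12b" and g: "g \<in> W12 M"
  shows "AE x in M. grad_inner M (\<lambda>x. f x * f x) g x = 2 * f x * grad_inner M f g x"
proof -
  note fW = W12b_W12[OF f] and FW = W12b_W12[OF W12b_mult[OF f f]]
  let ?F = "\<lambda>x. f x * f x" and ?N = "grad_norm M" and ?I = "grad_inner M f"
  show ?thesis
  proof (rule grad_inner_unique[OF FW g])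
    show "(\<lambda>x. 2 * f x * ?I g x) \<in> borel_measurable M"
      using W12b_measurable[OF f] grad_inner_measurable[OF fW g] by auto
    fix s
    let ?H = "\<lambda>x. f x * f x + s * g x"
    have HW: "?H \<in> W12 M" by (rule W12_add_scale[OF FW g])
    have "AE x in M. ?I ?H x = ?I ?F x + s * ?I g x"
      using grad_inner_lincomb[OF fW FW g, of 1 s] by simp
    then show "AE x in M. s * (2 * f x * ?I g x) \<le> ((?N ?H x)\<^sup>2 - (?N ?F x)\<^sup>2) / 2"
      using grad_inner_mult[OF fW f f] grad_inner_self[OF fW] grad_norm_mult[OF f f]
        grad_inner_Cauchy_Schwarz[OF fW HW] grad_norm_nonneg[OF fW] grad_norm_nonneg[OF FW] grad_norm_nonneg[OF HW]
    proof eventually_elim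
      case (elim x)
      \<comment> \<open>\<open>?a\<close> bounds |\<nabla>(f^2)|. Cauchy-Schwarz for f and f^2 + s g
        bounds a^2 + 2 s f \<langle>\<nabla>f, \<nabla>g\<rangle> by a |\<nabla>(f^2 + s g)|, and 2
        x y \<le> x^2 + y^2 then gives the subgradient inequality.\<close>
      let ?a = "2 * \<bar>f x\<bar> * ?N f x"
      have "(?N ?F x)\<^sup>2 \<le> ?a\<^sup>2" using elim by (intro power_mono) auto
      moreover have "?a\<^sup>2 + s * (2 * f x * ?I g x) \<le> ?a * ?N ?H x"
      proof -
        have "?a\<^sup>2 + s * (2 * f x * ?I g x) = 2 * f x * ?I ?H x"
          unfolding elim(1-3) by (simp add: power2_eq_square algebra_simps)
        also have "\<dots> \<le> \<bar>2 * f x\<bar> * \<bar>?I ?H x\<bar>" using abs_ge_self[of "2 * f x * ?I ?H x"] by (simp only: abs_mult)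
        also have "\<dots> \<le> \<bar>2 * f x\<bar> * (?N f x * ?N ?H x)" using elim by (intro mult_left_mono) auto
        finally show ?thesis by (simp add: abs_mult)
      qed
      moreover have "2 * (?a * ?N ?H x) \<le> ?a\<^sup>2 + (?N ?H x)\<^sup>2" using sum_squares_bound[of ?a "?N ?H x"] by simp
      ultimately show ?case by argo
    qed
  qed
qed

text \<open>The Leibniz rule for f p and the chain rule for f^2 express the weighted integral
  through the energy form alone. Since that form is bilinear, the right-hand side can be
  polarised.\<close>

lemma integral_test_grad_sq:
  assumes f: "f \<in> W12b" and p: "p \<in> W12b"
  shows "(\<integral>x. p x * (grad_norm M f x)\<^sup>2 \<partial>M) = energy f (\<lambda>x. f x * p x) - energy (\<lambda>x. f x * f x) p / 2"
proof -
  note fW = W12b_W12[OF f] and pW = W12b_W12[OF p]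
  have i1: "integrable M (\<lambda>x. f x * grad_inner M f p x)"
    by (rule W12b_mult_integrable[OF f grad_inner_integrable[OF fW pW]])
  have i2: "integrable M (\<lambda>x. p x * grad_inner M f f x)"
    by (rule W12b_mult_integrable[OF p grad_inner_integrable[OF fW fW]])
  have "energy f (\<lambda>x. f x * p x) = (\<integral>x. grad_inner M f (\<lambda>x. f x * p x) x \<partial>M)"
    by (rule integral_grad_inner[symmetric, OF fW W12b_W12[OF W12b_mult[OF f p]]])
  also have "\<dots> = (\<integral>x. f x * grad_inner M f p x + p x * grad_inner M f f x \<partial>M)"
    by (rule integral_cong_AE)
       (use grad_inner_mult[OF fW f p] grad_inner_measurable[OF fW W12b_W12[OF W12b_mult[OF f p]]] i1 i2 in auto)
  also have "\<dots> = (\<integral>x. f x * grad_inner M f p x \<partial>M) + (\<integral>x. p x * grad_inner M f f x \<partial>M)"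
    using i1 i2 by simp
  also have "(\<integral>x. p x * grad_inner M f f x \<partial>M) = (\<integral>x. p x * (grad_norm M f x)\<^sup>2 \<partial>M)"
  proof (rule integral_cong_AE)
    show "(\<lambda>x. p x * (grad_norm M f x)\<^sup>2) \<in> borel_measurable M"
      using W12b_measurable[OF p] L2_measurable[OF grad_norm_L2[OF fW]] by measurable
    show "AE x in M. p x * grad_inner M f f x = p x * (grad_norm M f x)\<^sup>2"
      using grad_inner_self[OF fW] by eventually_elim simp
  qed (use i2 in auto)
  also have "(\<integral>x. f x * grad_inner M f p x \<partial>M) = energy (\<lambda>x. f x * f x) p / 2"
  proof -
    have "energy (\<lambda>x. f x * f x) p = (\<integral>x. grad_inner M (\<lambda>x. f x * f x) p x \<partial>M)"
      by (rule integral_grad_inner[symmetric, OF W12b_W12[OF W12b_mult[OF f f]] pW])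
    also have "\<dots> = (\<integral>x. 2 * (f x * grad_inner M f p x) \<partial>M)"
      by (rule integral_cong_AE)
         (use grad_inner_square_left[OF f pW] grad_inner_measurable[OF W12b_W12[OF W12b_mult[OF f f]] pW] i1 in \<open>auto elim: eventually_mono\<close>)
    finally show ?thesis by simp
  qed
  finally show ?thesis by simp
qed

text \<open>Both sides are the derivative at s = 0 of the integral of p |\<nabla>(f + s g)|^2, the
  right one computed by \<open>integral_test_grad_sq\<close>. Because p \<ge> 0, the pointwise
  subgradient inequality may be integrated; positive and negative s give the two
  inequalities.\<close>

lemma integral_test_grad_inner:
  assumes f: "f \<in> W12b" and g: "g \<in> W12b" and p: "p \<in> W12b" "\<And>x. 0 \<le> p x"
  shows "2 * (\<integral>x. p x * grad_inner M f g x \<partial>M)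
    = energy f (\<lambda>x. g x * p x) + energy g (\<lambda>x. f x * p x) - energy (\<lambda>x. f x * g x) p"
proof -
  note fW = W12b_W12[OF f] and gW = W12b_W12[OF g] and pW = W12b_W12[OF p(1)]
  note fp = W12b_W12[OF W12b_mult[OF f p(1)]] and gp = W12b_W12[OF W12b_mult[OF g p(1)]]
  note ff = W12b_W12[OF W12b_mult[OF f f]] and fg = W12b_W12[OF W12b_mult[OF f g]] and gg = W12b_W12[OF W12b_mult[OF g g]]
  let ?b = "energy f (\<lambda>x. g x * p x) + energy g (\<lambda>x. f x * p x) - energy (\<lambda>x. f x * g x) p"
  let ?I = "\<integral>x. p x * grad_inner M f g x \<partial>M" and ?c = "\<integral>x. p x * (grad_norm M g x)\<^sup>2 \<partial>M"
  have i: "integrable M (\<lambda>x. p x * (grad_norm M h x)\<^sup>2)" if "h \<in> W12 M" for h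
    by (rule W12b_mult_integrable[OF p(1) L2_integrable_sq[OF grad_norm_L2[OF that]]])
  have iI: "integrable M (\<lambda>x. p x * grad_inner M f g x)"
    by (rule W12b_mult_integrable[OF p(1) grad_inner_integrable[OF fW gW]])
  have key: "2 * s * ?I \<le> s * ?b + s\<^sup>2 * ?c" for s
  proof -
    let ?h = "\<lambda>x. f x + s * g x"
    have h: "?h \<in> W12b" by (rule W12b_add_scale[OF f g])
    have "s * ?I = (\<integral>x. p x * (s * grad_inner M f g x) \<partial>M)"
      by (simp add: mult.left_commute)
    also have "\<dots> \<le> (\<integral>x. p x * (((grad_norm M ?h x)\<^sup>2 - (grad_norm M f x)\<^sup>2) / 2) \<partial>M)"
    proof (rule integral_mono_AE)
      show "integrable M (\<lambda>x. p x * (s * grad_inner M f g x))" using iI by (simp add: mult.left_commute)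
      show "integrable M (\<lambda>x. p x * (((grad_norm M ?h x)\<^sup>2 - (grad_norm M f x)\<^sup>2) / 2))"
        using i[OF W12b_W12[OF h]] i[OF fW] by (simp add: right_diff_distrib diff_divide_distrib)
      show "AE x in M. p x * (s * grad_inner M f g x) \<le> p x * (((grad_norm M ?h x)\<^sup>2 - (grad_norm M f x)\<^sup>2) / 2)"
        using grad_inner_subgradient[OF fW gW, of s] by eventually_elim (intro mult_left_mono p(2))
    qed
    also have "\<dots> = ((\<integral>x. p x * (grad_norm M ?h x)\<^sup>2 \<partial>M) - (\<integral>x. p x * (grad_norm M f x)\<^sup>2 \<partial>M)) / 2"
      using i[OF W12b_W12[OF h]] i[OF fW] by (simp add: right_diff_distrib diff_divide_distrib)
    also have "(\<integral>x. p x * (grad_norm M ?h x)\<^sup>2 \<partial>M) = (\<integral>x. p x * (grad_norm M f x)\<^sup>2 \<partial>M) + s * ?b + s\<^sup>2 * ?c"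
    proof -
      have e1: "(\<lambda>x. ?h x * p x) = (\<lambda>x. 1 * (f x * p x) + s * (g x * p x))" by (simp add: algebra_simps)
      have e2: "(\<lambda>x. ?h x * ?h x) = (\<lambda>x. 1 * (f x * f x) + s * (2 * (f x * g x) + s * (g x * g x)))" by (simp add: algebra_simps)
      have e3: "?h = (\<lambda>x. 1 * f x + s * g x)" by simp
      have "energy ?h (\<lambda>x. ?h x * p x) = energy f (\<lambda>x. f x * p x) + s * energy f (\<lambda>x. g x * p x)
          + s * (energy g (\<lambda>x. f x * p x) + s * energy g (\<lambda>x. g x * p x))"
        unfolding e1 energy_lincomb_right[OF fp gp W12b_W12[OF h]]
        unfolding e3 energy_lincomb[OF fW gW fp] energy_lincomb[OF fW gW gp] by (simp add: algebra_simps)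
      moreover have "energy (\<lambda>x. ?h x * ?h x) p = energy (\<lambda>x. f x * f x) p
          + s * (2 * energy (\<lambda>x. f x * g x) p + s * energy (\<lambda>x. g x * g x) p)"
        unfolding e2 energy_lincomb[OF ff W12_lincomb(1)[OF fg gg] pW] energy_lincomb[OF fg gg pW] by simp
      ultimately show ?thesis
        unfolding integral_test_grad_sq[OF h p(1)] integral_test_grad_sq[OF f p(1)] integral_test_grad_sq[OF g p(1)]
        by (simp add: power2_eq_square algebra_simps)
    qed
    finally show ?thesis by simp
  qed
  have lim: "((\<lambda>s. ?b + s * ?c) \<longlongrightarrow> ?b + 0 * ?c) F" if "((\<lambda>s. s) \<longlongrightarrow> 0) F" for F
    by (intro tendsto_intros that)
  have "2 * ?I \<le> ?b + 0 * ?c"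
  proof (rule tendsto_lowerbound[OF lim])
    have "2 * ?I \<le> ?b + s * ?c" if "0 < s" for s
    proof -
      have "s * (2 * ?I) \<le> s * (?b + s * ?c)" using key[of s] by (simp add: power2_eq_square algebra_simps)
      then show ?thesis using that by (simp only: mult_le_cancel_left_pos)
    qed
    then show "\<forall>\<^sub>F s in at_right 0. 2 * ?I \<le> ?b + s * ?c"
      by (auto simp: eventually_at_right_field intro!: exI[of _ 1])
  qed (auto intro: tendsto_ident_at)
  moreover have "?b + 0 * ?c \<le> 2 * ?I"
  proof (rule tendsto_upperbound[OF lim])
    have "?b + s * ?c \<le> 2 * ?I" if "s < 0" for s
    proof -
      have "s * (2 * ?I) \<le> s * (?b + s * ?c)" using key[of s] by (simp add: power2_eq_square algebra_simps)
      then show ?thesis using that by (simp only: mult_le_cancel_left_neg)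
    qed
    then show "\<forall>\<^sub>F s in at_left 0. ?b + s * ?c \<le> 2 * ?I"
      by (auto simp: eventually_at_left_field intro!: exI[of _ "-1"])
  qed (auto intro: tendsto_ident_at)
  ultimately show ?thesis by linarith
qed

text \<open>The inner product is defined as a derivative at f in the direction g, which treats the
  arguments differently. The formula of \<open>integral_test_grad_inner\<close> is symmetric in
  them, and Lipschitz test functions separate integrable functions.\<close>

lemma grad_inner_sym:
  assumes f: "f \<in> W12b" and g: "g \<in> W12b"
  shows "AE x in M. grad_inner M f g x = grad_inner M g f x"
proof -
  note fW = W12b_W12[OF f] and gW = W12b_W12[OF g]
  note int = grad_inner_integrable[OF fW gW] grad_inner_integrable[OF gW fW]
  have "AE x in M. grad_inner M f g x - grad_inner M g f x = 0"
  proof (rule Lip_test_eq_0)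
    show "integrable M (\<lambda>x. grad_inner M f g x - grad_inner M g f x)" using int by simp
    fix p :: "'a \<Rightarrow> real" assume p: "p \<in> Lip" "\<And>x. 0 \<le> p x" "\<And>x. p x \<le> 1"
    have pb: "p \<in> W12b" by (rule Lip_W12b[OF p(1)])
    have fg: "(\<lambda>x. f x * g x) = (\<lambda>x. g x * f x)" by (simp add: mult.commute)
    have "(\<integral>x. p x * grad_inner M f g x \<partial>M) = (\<integral>x. p x * grad_inner M g f x \<partial>M)"
      using integral_test_grad_inner[OF f g pb p(2)] integral_test_grad_inner[OF g f pb p(2)] fg by simp
    then show "(\<integral>x. p x * (grad_inner M f g x - grad_inner M g f x) \<partial>M) = 0"
      using W12b_mult_integrable[OF pb] int by (simp add: right_diff_distrib)
  qed
  then show ?thesis by eventually_elim simp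
qed

text \<open>For a constant c the function exp(2 v) - 2 exp(2 c) v has local Lipschitz constant at
  most |2 exp(2 v) - 2 exp(2 c)| L, which is small where v is close to c. Cauchy-Schwarz carries
  this over to the inner product, and rational c then approach v x.\<close>

lemma
  assumes v: "v \<in> Lip"
  shows W12b_exp: "(\<lambda>x. exp (2 * v x)) \<in> W12b"
    and grad_inner_exp: "f \<in> W12 M \<Longrightarrow> AE x in M. grad_inner M f (\<lambda>x. exp (2 * v x)) x = 2 * exp (2 * v x) * grad_inner M f v x"
proof -
  let ?F = "\<lambda>x. exp (2 * v x)" and ?N = "grad_norm M"
  obtain A where A: "0 \<le> A" "\<And>x. \<bar>v x\<bar> \<le> A" by (rule Lip_bounded[OF v], rule that)
  obtain K where K: "0 \<le> K" "\<And>x y. \<bar>v x - v y\<bar> \<le> K * dist x y" by (rule LipE[OF v], rule that)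
  obtain L where L: "0 \<le> L" "\<And>x. \<bar>lip v x\<bar> \<le> L" by (rule lip_bounded[OF v], rule that)
  have FL: "?F \<in> Lip"
  proof (rule Lip_I[of "exp (2 * A) * (2 * K)"])
    fix x y
    have "\<bar>exp (2 * v x) - exp (2 * v y)\<bar> \<le> exp (2 * A) * \<bar>2 * v x - 2 * v y\<bar>"
      by (rule exp_Lipschitz_on_bounded) (use A(2) in \<open>simp_all add: abs_mult\<close>)
    also have "\<dots> = exp (2 * A) * (2 * \<bar>v x - v y\<bar>)" by (simp only: abs_mult abs_numeral right_diff_distrib[symmetric])
    also have "\<dots> \<le> exp (2 * A) * (2 * (K * dist x y))" using K(2)[of x y] by (intro mult_left_mono) auto
    finally show "\<bar>exp (2 * v x) - exp (2 * v y)\<bar> \<le> exp (2 * A) * (2 * K) * dist x y" by simp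
  qed (use K in simp)
  show "?F \<in> W12b" by (rule Lip_W12b[OF FL])
  assume f: "f \<in> W12 M"
  note FW = Lip_W12[OF FL] and vW = Lip_W12[OF v]
  have "AE x in M. \<bar>grad_inner M f ?F x - 2 * exp (2 * c) * grad_inner M f v x\<bar>
      \<le> ?N f x * (\<bar>2 * exp (2 * v x) - 2 * exp (2 * c)\<bar> * L)" for c
  proof -
    let ?G = "\<lambda>x. 1 * exp (2 * v x) + (- 2 * exp (2 * c)) * v x"
    have GL: "?G \<in> Lip" by (rule Lip_lincomb[OF FL v])
    have lipG: "lip ?G x \<le> \<bar>2 * exp (2 * v x) - 2 * exp (2 * c)\<bar> * L" for x
    proof -
      have "((\<lambda>t. 1 * exp (2 * t) + (- 2 * exp (2 * c)) * t) has_real_derivative 2 * exp (2 * v x) - 2 * exp (2 * c)) (at (v x))"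
        by (auto intro!: derivative_eq_intros)
      from lip_compose[OF v this] have "lip ?G x \<le> \<bar>2 * exp (2 * v x) - 2 * exp (2 * c)\<bar> * lip v x" .
      also have "\<dots> \<le> \<bar>2 * exp (2 * v x) - 2 * exp (2 * c)\<bar> * L"
        using L(2)[of x] by (intro mult_left_mono) auto
      finally show ?thesis .
    qed
    show ?thesis
      using grad_inner_lincomb[OF f FW vW, of 1 "- 2 * exp (2 * c)"] grad_inner_Cauchy_Schwarz[OF f Lip_W12[OF GL]]
        grad_norm_Lip[OF GL] grad_norm_nonneg[OF f]
    proof eventually_elim
      case (elim x)
      have "?N f x * ?N ?G x \<le> ?N f x * (\<bar>2 * exp (2 * v x) - 2 * exp (2 * c)\<bar> * L)"
        using elim lipG[of x] by (intro mult_left_mono) auto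
      then show ?case using elim(1,2) by simp
    qed
  qed
  then have "AE x in M. \<forall>c\<in>\<rat>. \<bar>grad_inner M f ?F x - 2 * exp (2 * c) * grad_inner M f v x\<bar>
      \<le> ?N f x * (\<bar>2 * exp (2 * v x) - 2 * exp (2 * c)\<bar> * L)"
    by (simp add: AE_ball_countable countable_rat)
  then show "AE x in M. grad_inner M f ?F x = 2 * exp (2 * v x) * grad_inner M f v x"
  proof eventually_elim
    case (elim x)
    obtain c where c: "\<And>n::nat. c n \<in> \<rat>" "c \<longlonglongrightarrow> v x" by (rule rational_sequence, rule that)
    have "\<bar>grad_inner M f ?F x - 2 * exp (2 * v x) * grad_inner M f v x\<bar>
        \<le> ?N f x * (\<bar>2 * exp (2 * v x) - 2 * exp (2 * v x)\<bar> * L)"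
    proof (rule LIMSEQ_le)
      show "(\<lambda>n. \<bar>grad_inner M f ?F x - 2 * exp (2 * c n) * grad_inner M f v x\<bar>)
          \<longlonglongrightarrow> \<bar>grad_inner M f ?F x - 2 * exp (2 * v x) * grad_inner M f v x\<bar>"
        by (intro tendsto_intros c)
      show "(\<lambda>n. ?N f x * (\<bar>2 * exp (2 * v x) - 2 * exp (2 * c n)\<bar> * L))
          \<longlonglongrightarrow> ?N f x * (\<bar>2 * exp (2 * v x) - 2 * exp (2 * v x)\<bar> * L)"
        by (intro tendsto_intros c)
    qed (use elim c(1) in blast)
    then show ?case by simp
  qed
qed

section \<open>Weighted resolvents\<close>

lemma integrable_bounded_mult:
  assumes "h \<in> borel_measurable M" "AE x in M. \<bar>h x\<bar> \<le> C" "integrable M g"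
  shows "integrable M (\<lambda>x. h x * (g x :: real))"
proof (rule Bochner_Integration.integrable_bound)
  show "integrable M (\<lambda>x. C * g x)" using assms(3) by simp
  show "(\<lambda>x. h x * g x) \<in> borel_measurable M" using assms by auto
  show "AE x in M. norm (h x * g x) \<le> norm (C * g x)"
    using assms(2) by eventually_elim (auto simp: abs_mult intro!: mult_right_mono)
qed

lemma AE_abs_bound_nonneg:
  assumes "AE x in M. \<bar>h x\<bar> \<le> (C :: real)" shows "0 \<le> C"
proof -
  have "AE x in M. 0 \<le> C" using assms by eventually_elim (auto intro: order_trans[OF abs_ge_zero])
  then show ?thesis by simp
qed

lemma integral_bounded_mult_le:
  assumes "h \<in> borel_measurable M" "AE x in M. \<bar>h x\<bar> \<le> C" "integrable M g"
  shows "\<bar>\<integral>x. h x * (g x :: real) \<partial>M\<bar> \<le> C * (\<integral>x. \<bar>g x\<bar> \<partial>M)"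
proof -
  have "\<bar>\<integral>x. h x * g x \<partial>M\<bar> \<le> (\<integral>x. \<bar>h x * g x\<bar> \<partial>M)" by (rule integral_abs_bound)
  also have "\<dots> \<le> (\<integral>x. C * \<bar>g x\<bar> \<partial>M)"
  proof (rule integral_mono_AE)
    show "integrable M (\<lambda>x. \<bar>h x * g x\<bar>)" using integrable_bounded_mult[OF assms] by (rule integrable_abs)
    show "AE x in M. \<bar>h x * g x\<bar> \<le> C * \<bar>g x\<bar>"
      using assms(2) by eventually_elim (simp add: abs_mult mult_right_mono)
  qed (use assms(3) in simp)
  finally show ?thesis by simp
qed

text \<open>The direct method, with sqrt \<rho> |\<nabla>\<psi>| and sqrt \<sigma> (\<psi> - f) as
  the two components of \<open>L2_minimising_sequence\<close>. The infimum is taken over functions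
  with values between c and d; truncation does not increase the functional, so the minimiser also
  beats unbounded \<eta>.\<close>

lemma weighted_minimiser:
  assumes rho: "\<rho> \<in> borel_measurable M" "\<And>x. k \<le> \<rho> x" "\<And>x. \<rho> x \<le> K"
    and sig: "\<sigma> \<in> borel_measurable M" "\<And>x. k \<le> \<sigma> x" "\<And>x. \<sigma> x \<le> K"
    and k: "0 < k" and f: "f \<in> borel_measurable M" "\<And>x. c \<le> f x" "\<And>x. f x \<le> d"
  obtains \<psi> where "\<psi> \<in> W12 M" "\<And>x. c \<le> \<psi> x" "\<And>x. \<psi> x \<le> d"
    "\<And>\<eta>. \<eta> \<in> W12 M \<Longrightarrow> (\<integral>x. \<rho> x * (grad_norm M \<psi> x)\<^sup>2 \<partial>M) + (\<integral>x. \<sigma> x * (\<psi> x - f x)\<^sup>2 \<partial>M)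
        \<le> (\<integral>x. \<rho> x * (grad_norm M \<eta> x)\<^sup>2 \<partial>M) + (\<integral>x. \<sigma> x * (\<eta> x - f x)\<^sup>2 \<partial>M)"
proof -
  have cd: "c \<le> d" using f(2,3) order_trans by blast
  have fL: "f \<in> L2 M" by (rule L2_between[OF f])
  have K0: "0 \<le> K" using rho(2,3) k by (meson less_imp_le order_trans)
  let ?r = "\<lambda>x. sqrt (\<rho> x)" and ?s = "\<lambda>x. sqrt (\<sigma> x)" and ?N = "grad_norm M"
  have pos: "0 < \<rho> x" "0 < \<sigma> x" for x using rho(2)[of x] sig(2)[of x] k by linarith+
  have rm: "?r \<in> borel_measurable M" "?s \<in> borel_measurable M"
    "(\<lambda>x. 1 / ?r x) \<in> borel_measurable M" "(\<lambda>x. 1 / ?s x) \<in> borel_measurable M"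
    using rho(1) sig(1) by auto
  have rb: "AE x in M. \<bar>?r x\<bar> \<le> sqrt K" "AE x in M. \<bar>?s x\<bar> \<le> sqrt K"
    using rho(3) sig(3) pos by (auto intro!: AE_I2 simp: less_imp_le)
  have ib: "AE x in M. \<bar>1 / ?r x\<bar> \<le> 1 / sqrt k" "AE x in M. \<bar>1 / ?s x\<bar> \<le> 1 / sqrt k"
    using rho(2) sig(2) pos k by (auto intro!: AE_I2 divide_left_mono simp: less_imp_le)
  have k0: "0 \<le> 1 / sqrt k" "0 \<le> sqrt K" using k K0 by auto
  define P where "P \<psi> x = ?r x * ?N \<psi> x" for \<psi> x
  define Q where "Q \<psi> x = ?s x * (\<psi> x - f x)" for \<psi> x
  have PL: "P \<psi> \<in> L2 M" if "\<psi> \<in> W12 M" for \<psi>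
    unfolding P_def by (rule L2_norm_mult_bounded(1)[OF grad_norm_L2[OF that] rm(1) rb(1) k0(2)])
  have QL: "Q \<psi> \<in> L2 M" if "\<psi> \<in> W12 M" for \<psi>
    unfolding Q_def by (rule L2_norm_mult_bounded(1)[OF L2_diff[OF W12_L2[OF that] fL] rm(2) rb(2) k0(2)])
  have PQ: "(L2_norm M (P \<psi>))\<^sup>2 = (\<integral>x. \<rho> x * (?N \<psi> x)\<^sup>2 \<partial>M)" "(L2_norm M (Q \<psi>))\<^sup>2 = (\<integral>x. \<sigma> x * (\<psi> x - f x)\<^sup>2 \<partial>M)" for \<psi>
    unfolding L2_norm_sq P_def Q_def using pos by (simp_all add: power_mult_distrib less_imp_le)
  define I where "I = {\<psi> \<in> W12 M. \<forall>x. c \<le> \<psi> x \<and> \<psi> x \<le> d}"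
  have IW: "\<psi> \<in> W12 M" if "\<psi> \<in> I" for \<psi> using that by (simp add: I_def)
  obtain s p q where s: "\<And>n::nat. s n \<in> I" and p: "p \<in> L2 M" and q: "q \<in> L2 M"
    and sp: "(\<lambda>n. L2_norm M (\<lambda>x. P (s n) x - p x)) \<longlonglongrightarrow> 0" and sq: "(\<lambda>n. L2_norm M (\<lambda>x. Q (s n) x - q x)) \<longlonglongrightarrow> 0"
    and min: "\<And>i. i \<in> I \<Longrightarrow> (L2_norm M p)\<^sup>2 + (L2_norm M q)\<^sup>2 \<le> (L2_norm M (P i))\<^sup>2 + (L2_norm M (Q i))\<^sup>2"
  proof (rule L2_minimising_sequence[of I P Q])
    show "I \<noteq> {}" using W12_const[of c] cd by (auto simp: I_def)
    fix i j assume ij: "i \<in> I" "j \<in> I"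
    let ?m = "\<lambda>x. 1/2 * i x + 1/2 * j x"
    have mW: "?m \<in> W12 M" by (rule W12_lincomb(1)[OF IW IW]) (use ij in auto)
    have "c \<le> 1/2 * i x + 1/2 * j x \<and> 1/2 * i x + 1/2 * j x \<le> d" for x
    proof -
      have "c \<le> i x" "i x \<le> d" "c \<le> j x" "j x \<le> d" using ij by (auto simp: I_def)
      then show ?thesis by argo
    qed
    then have mI: "?m \<in> I" using mW by (simp add: I_def)
    have "Q ?m = (\<lambda>x. (Q i x + Q j x) / 2)" by (simp add: Q_def fun_eq_iff field_simps)
    moreover have "L2_norm M (P ?m) \<le> L2_norm M (\<lambda>x. (P i x + P j x) / 2)"
    proof (rule L2_bound(2))
      show "(\<lambda>x. (P i x + P j x) / 2) \<in> L2 M"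
        using L2_lincomb[OF PL[OF IW[OF ij(1)]] PL[OF IW[OF ij(2)]], of "1/2" "1/2"] by (simp add: add_divide_distrib)
      show "P ?m \<in> borel_measurable M" by (rule L2_measurable[OF PL[OF mW]])
      show "AE x in M. \<bar>P ?m x\<bar> \<le> \<bar>(P i x + P j x) / 2\<bar>"
        using W12_lincomb(2)[OF IW[OF ij(1)] IW[OF ij(2)], of "1/2" "1/2"] grad_norm_nonneg[OF mW]
      proof eventually_elim
        case (elim x)
        have "\<bar>P ?m x\<bar> = ?r x * ?N ?m x" using elim(2) pos[of x] by (simp add: P_def abs_mult)
        also have "\<dots> \<le> ?r x * (\<bar>1/2\<bar> * ?N i x + \<bar>1/2\<bar> * ?N j x)"
          using elim(1) pos[of x] by (intro mult_left_mono) auto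
        also have "\<dots> = (P i x + P j x) / 2" by (simp add: P_def algebra_simps add_divide_distrib)
        finally show ?case by linarith
      qed
    qed
    ultimately have "(L2_norm M (P ?m))\<^sup>2 + (L2_norm M (Q ?m))\<^sup>2
        \<le> (L2_norm M (\<lambda>x. (P i x + P j x) / 2))\<^sup>2 + (L2_norm M (\<lambda>x. (Q i x + Q j x) / 2))\<^sup>2"
      by (simp add: power_mono)
    with mI show "\<exists>k\<in>I. (L2_norm M (P k))\<^sup>2 + (L2_norm M (Q k))\<^sup>2
        \<le> (L2_norm M (\<lambda>x. (P i x + P j x) / 2))\<^sup>2 + (L2_norm M (\<lambda>x. (Q i x + Q j x) / 2))\<^sup>2" by blast
  qed (use PL QL IW that in auto)
  \<comment> \<open>Weights bounded below by k can be divided out, which turns the limits of the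
    weighted components into limits of |\<nabla>(s n)| and of s n. Truncating \<psi>0 then restores
    the bounds at every point.\<close>
  define G where "G x = 1 / ?r x * p x" for x
  define \<psi>0 where "\<psi>0 x = 1 / ?s x * q x + f x" for x
  define \<psi> where "\<psi> x = clip c d (\<psi>0 x)" for x
  have GL: "G \<in> L2 M" unfolding G_def by (rule L2_norm_mult_bounded(1)[OF p rm(3) ib(1) k0(1)])
  have \<psi>0L: "\<psi>0 \<in> L2 M" unfolding \<psi>0_def by (rule L2_add[OF L2_norm_mult_bounded(1)[OF q rm(4) ib(2) k0(1)] fL])
  have Gn: "L2_norm M (\<lambda>x. ?N (s n) x - G x) \<le> 1 / sqrt k * L2_norm M (\<lambda>x. P (s n) x - p x)" for n
  proof -
    have "?r x \<noteq> 0" for x using pos(1)[of x] by simp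
    then have "(\<lambda>x. ?N (s n) x - G x) = (\<lambda>x. 1 / ?r x * (P (s n) x - p x))"
      by (simp add: G_def P_def fun_eq_iff right_diff_distrib)
    then show ?thesis
      using L2_norm_mult_bounded(2)[OF L2_diff[OF PL[OF IW[OF s]] p] rm(3) ib(1) k0(1)] by simp
  qed
  have sn: "L2_norm M (\<lambda>x. s n x - \<psi> x) \<le> 1 / sqrt k * L2_norm M (\<lambda>x. Q (s n) x - q x)" for n
  proof -
    have "s n x = clip c d (s n x)" for x using s[of n] by (simp add: I_def clip_id)
    then have "L2_norm M (\<lambda>x. s n x - \<psi> x) \<le> L2_norm M (\<lambda>x. s n x - \<psi>0 x)"
      using L2_norm_clip_diff[OF W12_L2[OF IW[OF s]] \<psi>0L, of c d n] by (simp add: \<psi>_def)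
    also have "(\<lambda>x. s n x - \<psi>0 x) = (\<lambda>x. 1 / ?s x * (Q (s n) x - q x))"
    proof -
      have "?s x \<noteq> 0" for x using pos(2)[of x] by simp
      then show ?thesis by (simp add: \<psi>0_def Q_def fun_eq_iff right_diff_distrib)
    qed
    also have "L2_norm M \<dots> \<le> 1 / sqrt k * L2_norm M (\<lambda>x. Q (s n) x - q x)"
      by (rule L2_norm_mult_bounded(2)[OF L2_diff[OF QL[OF IW[OF s]] q] rm(4) ib(2) k0(1)])
    finally show ?thesis .
  qed
  have u: "upper_grad M \<psi> G"
  proof (rule upper_grad_closed)
    show "\<psi> \<in> L2 M" unfolding \<psi>_def by (rule clip_L2[OF \<psi>0L])
    fix e :: real assume e: "0 < e"
    have "(\<lambda>n. 1 / sqrt k * L2_norm M (\<lambda>x. P (s n) x - p x)) \<longlonglongrightarrow> 0" "(\<lambda>n. 1 / sqrt k * L2_norm M (\<lambda>x. Q (s n) x - q x)) \<longlonglongrightarrow> 0"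
      by (rule tendsto_mult_right_zero[OF sp], rule tendsto_mult_right_zero[OF sq])
    then have "\<forall>\<^sub>F n in sequentially. 1 / sqrt k * L2_norm M (\<lambda>x. P (s n) x - p x) < e \<and> 1 / sqrt k * L2_norm M (\<lambda>x. Q (s n) x - q x) < e"
      using e by (intro eventually_conj order_tendstoD(2)[where a = e]) auto
    then obtain n where "1 / sqrt k * L2_norm M (\<lambda>x. P (s n) x - p x) < e" "1 / sqrt k * L2_norm M (\<lambda>x. Q (s n) x - q x) < e"
      using eventually_happens'[OF sequentially_bot] by blast
    with Gn[of n] sn[of n] grad_norm_upper_grad[OF IW[OF s[of n]]]
    show "\<exists>f' G'. upper_grad M f' G' \<and> L2_norm M (\<lambda>x. f' x - \<psi> x) \<le> e \<and> L2_norm M (\<lambda>x. G' x - G x) \<le> e"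
      by (intro exI[of _ "s n"] exI[of _ "?N (s n)"]) linarith
  qed (rule GL)
  have \<psi>W: "\<psi> \<in> W12 M" by (rule W12_I[OF u])
  have \<psi>b: "c \<le> \<psi> x" "\<psi> x \<le> d" for x unfolding \<psi>_def by (rule clip_bounds[OF cd])+
  have "L2_norm M (P \<psi>) \<le> L2_norm M p"
  proof (rule L2_bound(2)[OF p L2_measurable[OF PL[OF \<psi>W]]])
    show "AE x in M. \<bar>P \<psi> x\<bar> \<le> \<bar>p x\<bar>"
      using grad_norm_le[OF u] grad_norm_nonneg[OF \<psi>W]
    proof eventually_elim
      case (elim x)
      have "\<bar>P \<psi> x\<bar> = ?r x * ?N \<psi> x" using elim(2) pos[of x] by (simp add: P_def abs_mult)
      also have "\<dots> \<le> ?r x * G x" using elim(1) pos[of x] by (intro mult_left_mono) auto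
      also have "\<dots> = p x" using pos(1)[of x] by (simp add: G_def)
      finally show ?case by linarith
    qed
  qed
  moreover have "L2_norm M (Q \<psi>) \<le> L2_norm M q"
  proof (rule L2_bound(2)[OF q L2_measurable[OF QL[OF \<psi>W]]], rule AE_I2)
    fix x
    have "\<bar>Q \<psi> x\<bar> = ?s x * \<bar>clip c d (\<psi>0 x) - clip c d (f x)\<bar>"
      using pos(2)[of x] f(2,3)[of x] by (simp add: Q_def \<psi>_def abs_mult clip_id)
    also have "\<dots> \<le> ?s x * \<bar>\<psi>0 x - f x\<bar>"
      using pos(2)[of x] by (intro mult_left_mono clip_nonexpansive) auto
    also have "\<dots> = \<bar>q x\<bar>" using pos(2)[of x] by (simp add: \<psi>0_def abs_mult)
    finally show "\<bar>Q \<psi> x\<bar> \<le> \<bar>q x\<bar>" .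
  qed
  ultimately have le: "(L2_norm M (P \<psi>))\<^sup>2 + (L2_norm M (Q \<psi>))\<^sup>2 \<le> (L2_norm M p)\<^sup>2 + (L2_norm M q)\<^sup>2"
    by (intro add_mono power_mono) auto
  have "(L2_norm M (P \<psi>))\<^sup>2 + (L2_norm M (Q \<psi>))\<^sup>2 \<le> (L2_norm M (P \<eta>))\<^sup>2 + (L2_norm M (Q \<eta>))\<^sup>2" if \<eta>: "\<eta> \<in> W12 M" for \<eta>
  proof -
    let ?\<eta> = "\<lambda>x. clip c d (\<eta> x)"
    have cW: "?\<eta> \<in> W12 M" by (rule W12_clip(1)[OF \<eta>])
    have "?\<eta> \<in> I" using cW clip_bounds[OF cd] by (simp add: I_def)
    from min[OF this] le
    have "(L2_norm M (P \<psi>))\<^sup>2 + (L2_norm M (Q \<psi>))\<^sup>2 \<le> (L2_norm M (P ?\<eta>))\<^sup>2 + (L2_norm M (Q ?\<eta>))\<^sup>2" by linarith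
    also have "\<dots> \<le> (L2_norm M (P \<eta>))\<^sup>2 + (L2_norm M (Q \<eta>))\<^sup>2"
    proof (intro add_mono power_mono)
      show "L2_norm M (P ?\<eta>) \<le> L2_norm M (P \<eta>)"
      proof (rule L2_bound(2)[OF PL[OF \<eta>] L2_measurable[OF PL[OF cW]]])
        show "AE x in M. \<bar>P ?\<eta> x\<bar> \<le> \<bar>P \<eta> x\<bar>"
          using W12_clip(2)[OF \<eta>, of c d] grad_norm_nonneg[OF cW]
          by eventually_elim (use pos in \<open>auto simp: P_def abs_mult intro!: mult_left_mono\<close>)
      qed
      show "L2_norm M (Q ?\<eta>) \<le> L2_norm M (Q \<eta>)"
      proof (rule L2_bound(2)[OF QL[OF \<eta>] L2_measurable[OF QL[OF cW]]], rule AE_I2)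
        fix x
        have "\<bar>clip c d (\<eta> x) - f x\<bar> \<le> \<bar>\<eta> x - f x\<bar>"
          using clip_nonexpansive[of c d "\<eta> x" "f x"] clip_id[OF f(2,3)] by simp
        then show "\<bar>Q ?\<eta> x\<bar> \<le> \<bar>Q \<eta> x\<bar>" by (auto simp: Q_def abs_mult intro!: mult_left_mono)
      qed
    qed auto
    finally show ?thesis .
  qed
  then show thesis using that[OF \<psi>W \<psi>b] unfolding PQ by blast
qed

text \<open>The weak form of -div(\<rho> \<nabla>\<psi>) + \<sigma> (\<psi> - f) = 0, the Euler
  equation of the functional in \<open>weighted_minimiser\<close>. That \<psi> keeps the bounds of f
  is the maximum principle.\<close>

lemma weighted_resolvent:
  assumes rho: "\<rho> \<in> borel_measurable M" "\<And>x. k \<le> \<rho> x" "\<And>x. \<rho> x \<le> K"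
    and sig: "\<sigma> \<in> borel_measurable M" "\<And>x. k \<le> \<sigma> x" "\<And>x. \<sigma> x \<le> K"
    and k: "0 < k" and f: "f \<in> borel_measurable M" "\<And>x. c \<le> f x" "\<And>x. f x \<le> d"
  obtains \<psi> where "\<psi> \<in> W12b" "\<And>x. c \<le> \<psi> x" "\<And>x. \<psi> x \<le> d"
    "\<And>\<phi>. \<phi> \<in> W12 M \<Longrightarrow> (\<integral>x. \<rho> x * grad_inner M \<psi> \<phi> x \<partial>M) + (\<integral>x. \<sigma> x * ((\<psi> x - f x) * \<phi> x) \<partial>M) = 0"
proof -
  obtain \<psi> where \<psi>: "\<psi> \<in> W12 M" "\<And>x. c \<le> \<psi> x" "\<And>x. \<psi> x \<le> d"
    and min: "\<And>\<eta>. \<eta> \<in> W12 M \<Longrightarrow> (\<integral>x. \<rho> x * (grad_norm M \<psi> x)\<^sup>2 \<partial>M) + (\<integral>x. \<sigma> x * (\<psi> x - f x)\<^sup>2 \<partial>M)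
        \<le> (\<integral>x. \<rho> x * (grad_norm M \<eta> x)\<^sup>2 \<partial>M) + (\<integral>x. \<sigma> x * (\<eta> x - f x)\<^sup>2 \<partial>M)"
    by (rule weighted_minimiser[OF rho sig k f], rule that) blast
  have K0: "0 \<le> K" using rho(2,3) k by (meson less_imp_le order_trans)
  have pos: "0 < \<rho> x" "0 < \<sigma> x" for x using rho(2)[of x] sig(2)[of x] k by linarith+
  have rb: "AE x in M. \<bar>\<rho> x\<bar> \<le> K" "AE x in M. \<bar>\<sigma> x\<bar> \<le> K"
    using rho(3) sig(3) pos by (auto intro!: AE_I2 simp: less_imp_le)
  note ir = integrable_bounded_mult[OF rho(1) rb(1)] and i\<sigma> = integrable_bounded_mult[OF sig(1) rb(2)]
  have \<psi>b: "\<psi> \<in> W12b"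
  proof (rule W12bI[OF \<psi>(1)])
    fix x show "\<bar>\<psi> x\<bar> \<le> \<bar>c\<bar> + \<bar>d\<bar>" using \<psi>(2,3)[of x] by linarith
  qed
  have fL: "f \<in> L2 M" by (rule L2_between[OF f])
  define A where "A \<phi> = (\<integral>x. \<rho> x * grad_inner M \<psi> \<phi> x \<partial>M) + (\<integral>x. \<sigma> x * ((\<psi> x - f x) * \<phi> x) \<partial>M)" for \<phi>
  have A0: "0 \<le> A \<phi>" if \<phi>: "\<phi> \<in> W12 M" for \<phi>
  proof -
    let ?C = "K * energy \<phi> \<phi> + (\<integral>x. \<sigma> x * (\<phi> x)\<^sup>2 \<partial>M) / 2"
    have t: "0 \<le> A \<phi> + t * ?C" if t: "0 < t" for t
    proof -
      let ?\<eta> = "\<lambda>x. \<psi> x + t * \<phi> x"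
      have \<eta>: "?\<eta> \<in> W12 M" by (rule W12_add_scale[OF \<psi>(1) \<phi>])
      note i1 = ir[OF L2_integrable_sq[OF grad_norm_L2[OF \<psi>(1)]]] ir[OF L2_integrable_sq[OF grad_norm_L2[OF \<eta>]]]
      note dL = L2_diff[OF W12_L2[OF \<psi>(1)] fL]
      note i2 = i\<sigma>[OF L2_integrable_sq[OF dL]] i\<sigma>[OF L2_mult_integrable[OF dL W12_L2[OF \<phi>]]] i\<sigma>[OF L2_integrable_sq[OF W12_L2[OF \<phi>]]]
      note gd = grad_diff_integrable[OF \<psi>(1) \<phi>]
      have e1: "(\<integral>x. \<rho> x * (grad_norm M ?\<eta> x)\<^sup>2 \<partial>M) - (\<integral>x. \<rho> x * (grad_norm M \<psi> x)\<^sup>2 \<partial>M)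
          = 2 * t * (\<integral>x. \<rho> x * grad_diff \<psi> \<phi> t x \<partial>M)"
      proof -
        have "2 * t * (\<integral>x. \<rho> x * grad_diff \<psi> \<phi> t x \<partial>M) = (\<integral>x. 2 * t * (\<rho> x * grad_diff \<psi> \<phi> t x) \<partial>M)" by simp
        also have "\<dots> = (\<integral>x. \<rho> x * (grad_norm M ?\<eta> x)\<^sup>2 - \<rho> x * (grad_norm M \<psi> x)\<^sup>2 \<partial>M)"
          using t by (intro Bochner_Integration.integral_cong refl) (simp add: grad_diff_def field_simps)
        finally show ?thesis using i1 by simp
      qed
      have e2: "(\<integral>x. \<sigma> x * (?\<eta> x - f x)\<^sup>2 \<partial>M) = (\<integral>x. \<sigma> x * (\<psi> x - f x)\<^sup>2 \<partial>M)
          + 2 * t * (\<integral>x. \<sigma> x * ((\<psi> x - f x) * \<phi> x) \<partial>M) + t\<^sup>2 * (\<integral>x. \<sigma> x * (\<phi> x)\<^sup>2 \<partial>M)"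
      proof -
        have "(\<integral>x. \<sigma> x * (?\<eta> x - f x)\<^sup>2 \<partial>M) = (\<integral>x. \<sigma> x * (\<psi> x - f x)\<^sup>2
          + 2 * t * (\<sigma> x * ((\<psi> x - f x) * \<phi> x)) + t\<^sup>2 * (\<sigma> x * (\<phi> x)\<^sup>2) \<partial>M)"
          by (intro Bochner_Integration.integral_cong refl) (simp add: power2_eq_square algebra_simps)
        then show ?thesis using i2 by simp
      qed
      \<comment> \<open>The weight \<rho> prevents a direct use of the mean of the quotient. The
        pointwise error is at most K times the gap between the right and left quotients, and that
        gap has mean t times the energy of \<phi>.\<close>
      have e3: "(\<integral>x. \<rho> x * grad_diff \<psi> \<phi> t x \<partial>M) \<le> (\<integral>x. \<rho> x * grad_inner M \<psi> \<phi> x \<partial>M) + K * (t * energy \<phi> \<phi>)"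
      proof -
        have "(\<integral>x. \<rho> x * grad_diff \<psi> \<phi> t x \<partial>M) \<le> (\<integral>x. \<rho> x * grad_inner M \<psi> \<phi> x + K * (grad_diff \<psi> \<phi> t x - grad_diff \<psi> \<phi> (- t) x) \<partial>M)"
        proof (rule integral_mono_AE)
          show "integrable M (\<lambda>x. \<rho> x * grad_diff \<psi> \<phi> t x)" by (rule ir[OF gd])
          show "integrable M (\<lambda>x. \<rho> x * grad_inner M \<psi> \<phi> x + K * (grad_diff \<psi> \<phi> t x - grad_diff \<psi> \<phi> (- t) x))"
            by (intro Bochner_Integration.integrable_add ir grad_inner_integrable[OF \<psi>(1) \<phi>] integrable_mult_right Bochner_Integration.integrable_diff gd)
          show "AE x in M. \<rho> x * grad_diff \<psi> \<phi> t x \<le> \<rho> x * grad_inner M \<psi> \<phi> x + K * (grad_diff \<psi> \<phi> t x - grad_diff \<psi> \<phi> (- t) x)"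
            using grad_inner_bounds[OF \<psi>(1) \<phi> t]
          proof eventually_elim
            case (elim x)
            have "\<rho> x * (grad_diff \<psi> \<phi> t x - grad_inner M \<psi> \<phi> x) \<le> K * (grad_diff \<psi> \<phi> t x - grad_diff \<psi> \<phi> (- t) x)"
              using elim rho(3)[of x] pos(1)[of x] K0 by (intro mult_mono) auto
            then show ?case by (simp add: right_diff_distrib)
          qed
        qed
        also have "\<dots> = (\<integral>x. \<rho> x * grad_inner M \<psi> \<phi> x \<partial>M) + K * (\<integral>x. grad_diff \<psi> \<phi> t x - grad_diff \<psi> \<phi> (- t) x \<partial>M)"
          using ir[OF grad_inner_integrable[OF \<psi>(1) \<phi>]] gd by (subst Bochner_Integration.integral_add) auto
        finally show ?thesis unfolding grad_diff_gap[OF \<psi>(1) \<phi> t] .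
      qed
      let ?X = "\<integral>x. \<rho> x * grad_diff \<psi> \<phi> t x \<partial>M" and ?Y = "\<integral>x. \<sigma> x * ((\<psi> x - f x) * \<phi> x) \<partial>M"
        and ?Z = "\<integral>x. \<sigma> x * (\<phi> x)\<^sup>2 \<partial>M"
      have "0 \<le> 2 * t * ?X + (2 * t * ?Y + t\<^sup>2 * ?Z)" using min[OF \<eta>] e1 e2 by linarith
      also have "\<dots> = 2 * t * (?X + ?Y + t * ?Z / 2)" by (simp add: power2_eq_square field_simps)
      finally have "0 \<le> ?X + ?Y + t * ?Z / 2" using t by (simp add: zero_le_mult_iff)
      with e3 show ?thesis by (simp add: A_def algebra_simps)
    qed
    have "((\<lambda>t. A \<phi> + t * ?C) \<longlongrightarrow> A \<phi> + 0 * ?C) (at_right 0)" by (intro tendsto_intros)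
    then have "0 \<le> A \<phi> + 0 * ?C"
      by (rule tendsto_lowerbound) (auto simp: eventually_at_right_field intro!: exI[of _ 1] t)
    then show ?thesis by simp
  qed
  have "A \<phi> = 0" if \<phi>: "\<phi> \<in> W12 M" for \<phi>
  proof -
    \<comment> \<open>A is odd, so nonnegativity for \<phi> and for -\<phi> gives equality.\<close>
    have "A (\<lambda>x. (-1) * \<phi> x) = - A \<phi>"
    proof -
      have "(\<integral>x. \<rho> x * grad_inner M \<psi> (\<lambda>x. (-1) * \<phi> x) x \<partial>M) = (\<integral>x. - (\<rho> x * grad_inner M \<psi> \<phi> x) \<partial>M)"
      proof (rule integral_cong_AE)
        show "AE x in M. \<rho> x * grad_inner M \<psi> (\<lambda>x. (-1) * \<phi> x) x = - (\<rho> x * grad_inner M \<psi> \<phi> x)"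
          using grad_inner_scale[OF \<psi>(1) \<phi>, of "-1"] by eventually_elim simp
      qed (use rho(1) grad_inner_measurable[OF \<psi>(1) \<phi>] grad_inner_measurable[OF \<psi>(1) W12_scale[OF \<phi>, of "-1"]] in auto)
      then show ?thesis by (simp add: A_def)
    qed
    with A0[OF \<phi>] A0[OF W12_scale[OF \<phi>, of "-1"]] show ?thesis by simp
  qed
  then show thesis using that[OF \<psi>b \<psi>(2,3)] by (simp add: A_def)
qed

text \<open>\<psi> = (1 - e \<Delta>)^(-1) f, the regularisation that makes both arguments of
  Bochner's inequality admissible.\<close>

lemma resolvent:
  assumes e: "0 < e" and f: "f \<in> borel_measurable M" "\<And>x. c \<le> f x" "\<And>x. f x \<le> d"
  obtains \<psi> where "\<psi> \<in> W12b" "\<And>x. c \<le> \<psi> x" "\<And>x. \<psi> x \<le> d"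
    "\<And>\<phi>. \<phi> \<in> W12 M \<Longrightarrow> e * energy \<psi> \<phi> + (\<integral>x. (\<psi> x - f x) * \<phi> x \<partial>M) = 0"
proof -
  obtain \<psi> where \<psi>: "\<psi> \<in> W12b" "\<And>x. c \<le> \<psi> x" "\<And>x. \<psi> x \<le> d"
    and el: "\<And>\<phi>. \<phi> \<in> W12 M \<Longrightarrow> (\<integral>x. e * grad_inner M \<psi> \<phi> x \<partial>M) + (\<integral>x. 1 * ((\<psi> x - f x) * \<phi> x) \<partial>M) = 0"
    by (rule weighted_resolvent[of "\<lambda>x. e" "min e 1" "max e 1" "\<lambda>x. 1" f c d]) (use e f that in auto)
  show thesis
    using that[OF \<psi>] el integral_grad_inner[OF W12b_W12[OF \<psi>(1)]] by simp
qed

text \<open>Strong convergence of resolvents in L2: Lipschitz \<eta> approximate p, and the error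
  for such \<eta> is controlled by d times the energy of \<eta>. The second limit holds because d
  energy(k) is at most the squared norm of p, which leaves a factor sqrt d. The equation is assumed
  only for bounded \<phi> because p may be a Laplacian known only against these.\<close>

lemma resolvent_tendsto:
  assumes p: "p \<in> L2 M" and k: "\<And>n. k n \<in> W12b" and d: "\<And>n. 0 < d n" "d \<longlonglongrightarrow> 0"
    and el: "\<And>n \<phi>. \<phi> \<in> W12b \<Longrightarrow> d n * energy (k n) \<phi> + (\<integral>x. (k n x - p x) * \<phi> x \<partial>M) = 0"
  shows "(\<lambda>n. L2_norm M (\<lambda>x. k n x - p x)) \<longlonglongrightarrow> 0" (is ?lim)
    and "(\<lambda>n. d n * sqrt (energy (k n) (k n))) \<longlonglongrightarrow> 0"
proof -
  note kW = W12b_W12[OF k] and kL = W12_L2[OF W12b_W12[OF k]]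
  have kE: "d n * energy (k n) (k n) \<le> (L2_norm M p)\<^sup>2" for n
  proof -
    have "(\<integral>x. (k n x - p x) * k n x \<partial>M) = (\<integral>x. k n x * k n x \<partial>M) - (\<integral>x. p x * k n x \<partial>M)"
      using L2_mult_integrable[OF kL kL, of n n] L2_mult_integrable[OF p kL, of n] by (simp add: left_diff_distrib)
    also have "(\<integral>x. k n x * k n x \<partial>M) = (L2_norm M (k n))\<^sup>2" unfolding L2_norm_sq by (simp only: power2_eq_square)
    finally have "d n * energy (k n) (k n) = (\<integral>x. p x * k n x \<partial>M) - (L2_norm M (k n))\<^sup>2"
      using el[OF k[of n], of n] by linarith
    moreover have "(\<integral>x. p x * k n x \<partial>M) \<le> L2_norm M p * L2_norm M (k n)"
      using L2_Cauchy_Schwarz[OF p kL, of n] by linarith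
    moreover have "2 * L2_norm M p * L2_norm M (k n) \<le> (L2_norm M p)\<^sup>2 + (L2_norm M (k n))\<^sup>2"
      by (rule sum_squares_bound)
    moreover have "0 \<le> (L2_norm M p)\<^sup>2" "0 \<le> (L2_norm M (k n))\<^sup>2" by simp_all
    ultimately show ?thesis by argo
  qed
  show "(\<lambda>n. d n * sqrt (energy (k n) (k n))) \<longlonglongrightarrow> 0"
  proof (rule Lim_null_comparison[OF always_eventually], rule allI)
    fix n
    have "d n * sqrt (energy (k n) (k n)) = sqrt (d n) * sqrt (d n * energy (k n) (k n))"
      unfolding real_sqrt_mult mult.assoc[symmetric] using d(1)[of n] by simp
    also have "\<dots> \<le> sqrt (d n) * L2_norm M p"
      using kE[of n] d(1)[of n] by (intro mult_left_mono real_le_lsqrt) auto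
    finally show "norm (d n * sqrt (energy (k n) (k n))) \<le> sqrt (d n) * L2_norm M p"
      using d(1)[of n] energy_nonneg[OF kW, of n] by (simp add: abs_mult)
  next
    have "(\<lambda>n. sqrt (d n) * L2_norm M p) \<longlonglongrightarrow> sqrt 0 * L2_norm M p"
      by (intro tendsto_intros d(2))
    then show "(\<lambda>n. sqrt (d n) * L2_norm M p) \<longlonglongrightarrow> 0" by simp
  qed
  show ?lim
  proof (rule LIMSEQ_I)
    fix e0 :: real assume e0: "0 < e0"
    \<comment> \<open>A third suffices: the distance from k n to \<eta> will be below 2 e, and that
      from \<eta> to p is below e.\<close>
    define e where "e = e0 / 3"
    have e: "0 < e" using e0 by (simp add: e_def)
    obtain \<eta> where \<eta>: "\<eta> \<in> Lip" "L2_norm M (\<lambda>x. \<eta> x - p x) < e" by (rule Lip_dense[OF p e], rule that)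
    have \<eta>b: "\<eta> \<in> W12b" by (rule Lip_W12b[OF \<eta>(1)])
    note \<eta>W = W12b_W12[OF \<eta>b] and \<eta>L = Lip_L2[OF \<eta>(1)]
    have "(\<lambda>n. d n * (energy \<eta> \<eta> / 2)) \<longlonglongrightarrow> 0" by (rule tendsto_mult_left_zero[OF d(2)])
    then have "\<forall>\<^sub>F n in sequentially. d n * (energy \<eta> \<eta> / 2) < e\<^sup>2" by (rule order_tendstoD(2)) (use e in simp)
    then obtain n0 where n0: "\<And>n. n0 \<le> n \<Longrightarrow> d n * (energy \<eta> \<eta> / 2) < e\<^sup>2" by (auto simp: eventually_sequentially)
    have "L2_norm M (\<lambda>x. k n x - p x) < e0" if n: "n0 \<le> n" for n
    proof -
      let ?d = "\<lambda>x. k n x - \<eta> x"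
      have db: "?d \<in> W12b" by (rule W12b_diff[OF k \<eta>b])
      note dW = W12b_W12[OF db] and dL = W12_L2[OF W12b_W12[OF db]]
      \<comment> \<open>Completing the square bounds the cross term from below without any control
        of the energy of k n - \<eta>.\<close>
      have "0 \<le> energy (\<lambda>x. ?d x + 1/2 * \<eta> x) (\<lambda>x. ?d x + 1/2 * \<eta> x)"
        by (rule energy_nonneg[OF W12_add_scale[OF dW \<eta>W]])
      also have "\<dots> = energy ?d ?d + energy ?d \<eta> + energy \<eta> \<eta> / 4"
        unfolding energy_add_scale[OF dW \<eta>W] by (simp add: power2_eq_square)
      finally have 1: "0 \<le> energy ?d ?d + energy ?d \<eta> + energy \<eta> \<eta> / 4" .
      have "energy (k n) ?d = energy ?d ?d + energy ?d \<eta>"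
        using energy_lincomb[OF dW \<eta>W dW, of 1 1] energy_sym[OF dW \<eta>W] by simp
      then have "- (energy \<eta> \<eta> / 4) \<le> energy (k n) ?d" using 1 by simp
      then have 2: "d n * (- (energy \<eta> \<eta> / 4)) \<le> d n * energy (k n) ?d"
        using d(1)[of n] by (intro mult_left_mono) auto
      have "(\<integral>x. (k n x - p x) * ?d x \<partial>M) = (\<integral>x. ?d x * ?d x + (\<eta> x - p x) * ?d x \<partial>M)"
        by (simp add: algebra_simps)
      also have "\<dots> = (\<integral>x. ?d x * ?d x \<partial>M) + (\<integral>x. (\<eta> x - p x) * ?d x \<partial>M)"
        by (rule Bochner_Integration.integral_add[OF L2_mult_integrable[OF dL dL] L2_mult_integrable[OF L2_diff[OF \<eta>L p] dL]])
      also have "(\<integral>x. ?d x * ?d x \<partial>M) = (L2_norm M ?d)\<^sup>2" unfolding L2_norm_sq by (simp only: power2_eq_square)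
      finally have 3: "(L2_norm M ?d)\<^sup>2 = - (d n * energy (k n) ?d) - (\<integral>x. (\<eta> x - p x) * ?d x \<partial>M)"
        using el[OF db, of n] by linarith
      have "- (\<integral>x. (\<eta> x - p x) * ?d x \<partial>M) \<le> L2_norm M (\<lambda>x. \<eta> x - p x) * L2_norm M ?d"
        using L2_Cauchy_Schwarz[OF L2_diff[OF \<eta>L p] dL] by linarith
      also have "\<dots> \<le> e * L2_norm M ?d" using \<eta>(2) by (intro mult_right_mono) auto
      also have "\<dots> \<le> (e\<^sup>2 + (L2_norm M ?d)\<^sup>2) / 2" using sum_squares_bound[of e "L2_norm M ?d"] by simp
      finally have "(L2_norm M ?d)\<^sup>2 \<le> d n * (energy \<eta> \<eta> / 4) + (e\<^sup>2 + (L2_norm M ?d)\<^sup>2) / 2"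
        using 2 3 by linarith
      moreover have "d n * (energy \<eta> \<eta> / 4) = d n * (energy \<eta> \<eta> / 2) / 2" by simp
      ultimately have "(L2_norm M ?d)\<^sup>2 \<le> d n * (energy \<eta> \<eta> / 2) + e\<^sup>2" by argo
      also have "\<dots> < 4 * e\<^sup>2" using n0[OF n] zero_less_power[OF e, of 2] by linarith
      also have "4 * e\<^sup>2 = (2 * e)\<^sup>2" by (simp add: power_mult_distrib)
      finally have "L2_norm M ?d < 2 * e" by (rule power2_less_imp_less) (use e in simp)
      moreover have "L2_norm M (\<lambda>x. k n x - p x) \<le> L2_norm M ?d + L2_norm M (\<lambda>x. \<eta> x - p x)"
        by (rule L2_norm_triangle_diff[OF kL \<eta>L p])
      ultimately show ?thesis using \<eta>(2) by (simp add: e_def)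
    qed
    then show "\<exists>n0. \<forall>n\<ge>n0. norm (L2_norm M (\<lambda>x. k n x - p x) - 0) < e0" by auto
  qed
qed

section \<open>The Bochner inequality for bounded Laplacians\<close>

lemma is_laplacian_iff:
  "is_laplacian M f h \<longleftrightarrow> f \<in> W12 M \<and> h \<in> L2 M \<and> (\<forall>g\<in>W12 M. energy f g = - (\<integral>x. h x * g x \<partial>M))"
  by (auto simp: is_laplacian_def integral_grad_inner)

lemma laplacian_AE_eq:
  assumes "is_laplacian M f h"
  shows "is_laplacian M f (laplacian M f)" "AE x in M. laplacian M f x = h x"
proof -
  show l: "is_laplacian M f (laplacian M f)"
    unfolding laplacian_def by (rule someI[of "is_laplacian M f", OF assms])
  have L: "laplacian M f \<in> L2 M" "h \<in> L2 M" using l assms by (auto simp: is_laplacian_def)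
  have "AE x in M. laplacian M f x - h x = 0"
  proof (rule Lip_test_eq_0[OF L2_integrable[OF L2_diff[OF L]]])
    fix \<eta> :: "'a \<Rightarrow> real" assume \<eta>: "\<eta> \<in> Lip"
    have "(\<integral>x. laplacian M f x * \<eta> x \<partial>M) = (\<integral>x. h x * \<eta> x \<partial>M)"
      using l assms Lip_W12[OF \<eta>] unfolding is_laplacian_iff by fastforce
    then show "(\<integral>x. \<eta> x * (laplacian M f x - h x) \<partial>M) = 0"
      using L2_mult_integrable[OF L(1) Lip_L2[OF \<eta>]] L2_mult_integrable[OF L(2) Lip_L2[OF \<eta>]]
      by (simp add: right_diff_distrib mult.commute)
  qed
  then show "AE x in M. laplacian M f x = h x" by eventually_elim simp
qed

text \<open>With d = f n - g, the difference of the squares is d^2 + 2 g d, and Cauchy-Schwarz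
  absorbs the bounded weight h.\<close>

lemma integral_bounded_sq_tendsto:
  assumes f: "\<And>n. f n \<in> L2 M" "g \<in> L2 M" "(\<lambda>n. L2_norm M (\<lambda>x. f n x - g x)) \<longlonglongrightarrow> 0"
    and h: "h \<in> borel_measurable M" "AE x in M. \<bar>h x\<bar> \<le> C" "0 \<le> C"
  shows "(\<lambda>n. \<integral>x. h x * (f n x)\<^sup>2 \<partial>M) \<longlonglongrightarrow> (\<integral>x. h x * (g x)\<^sup>2 \<partial>M)"
proof -
  let ?d = "\<lambda>n x. f n x - g x"
  have dL: "?d n \<in> L2 M" for n by (rule L2_diff[OF f(1,2)])
  note hd = L2_norm_mult_bounded[OF dL h] and hg = L2_norm_mult_bounded[OF f(2) h]
  have "(\<lambda>n. (\<integral>x. h x * (f n x)\<^sup>2 \<partial>M) - (\<integral>x. h x * (g x)\<^sup>2 \<partial>M)) \<longlonglongrightarrow> 0"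
  proof (rule Lim_null_comparison)
    have "norm ((\<integral>x. h x * (f n x)\<^sup>2 \<partial>M) - (\<integral>x. h x * (g x)\<^sup>2 \<partial>M))
        \<le> C * L2_norm M (?d n) * L2_norm M (?d n) + 2 * (C * L2_norm M g * L2_norm M (?d n))" for n
    proof -
      have "(\<integral>x. h x * (f n x)\<^sup>2 \<partial>M) - (\<integral>x. h x * (g x)\<^sup>2 \<partial>M) = (\<integral>x. h x * (f n x)\<^sup>2 - h x * (g x)\<^sup>2 \<partial>M)"
        by (rule Bochner_Integration.integral_diff[symmetric]; rule integrable_bounded_mult[OF h(1,2)];
            rule L2_integrable_sq; rule f)
      also have "\<dots> = (\<integral>x. (h x * ?d n x) * ?d n x + 2 * ((h x * g x) * ?d n x) \<partial>M)"
        by (rule Bochner_Integration.integral_cong) (auto simp: power2_eq_square algebra_simps)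
      also have "\<dots> = (\<integral>x. (h x * ?d n x) * ?d n x \<partial>M) + 2 * (\<integral>x. (h x * g x) * ?d n x \<partial>M)"
        using L2_mult_integrable[OF hd(1) dL, of n n] L2_mult_integrable[OF hg(1) dL, of n] by simp
      finally have "norm ((\<integral>x. h x * (f n x)\<^sup>2 \<partial>M) - (\<integral>x. h x * (g x)\<^sup>2 \<partial>M))
        \<le> \<bar>\<integral>x. (h x * ?d n x) * ?d n x \<partial>M\<bar> + 2 * \<bar>\<integral>x. (h x * g x) * ?d n x \<partial>M\<bar>" by simp
      also have "\<bar>\<integral>x. (h x * ?d n x) * ?d n x \<partial>M\<bar> \<le> C * L2_norm M (?d n) * L2_norm M (?d n)"
        by (rule order_trans[OF L2_Cauchy_Schwarz[OF hd(1) dL]]) (intro mult_right_mono hd(2), simp)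
      also have "\<bar>\<integral>x. (h x * g x) * ?d n x \<partial>M\<bar> \<le> C * L2_norm M g * L2_norm M (?d n)"
        by (rule order_trans[OF L2_Cauchy_Schwarz[OF hg(1) dL]]) (intro mult_right_mono hg(2), simp)
      finally show ?thesis by simp
    qed
    then show "\<forall>\<^sub>F n in sequentially. norm ((\<integral>x. h x * (f n x)\<^sup>2 \<partial>M) - (\<integral>x. h x * (g x)\<^sup>2 \<partial>M))
        \<le> C * L2_norm M (?d n) * L2_norm M (?d n) + 2 * (C * L2_norm M g * L2_norm M (?d n))" by simp
    have "(\<lambda>n. C * L2_norm M (?d n) * L2_norm M (?d n) + 2 * (C * L2_norm M g * L2_norm M (?d n)))
        \<longlonglongrightarrow> C * 0 * 0 + 2 * (C * L2_norm M g * 0)"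
      by (intro tendsto_intros f(3))
    then show "(\<lambda>n. C * L2_norm M (?d n) * L2_norm M (?d n) + 2 * (C * L2_norm M g * L2_norm M (?d n))) \<longlonglongrightarrow> 0" by simp
  qed
  then show ?thesis by (simp add: LIM_zero_iff)
qed

text \<open>A reverse triangle inequality: v is itself the sum of v + s z and -s z.\<close>

lemma grad_norm_diff_le:
  assumes v: "v \<in> W12 M" and z: "z \<in> W12 M"
  shows "L2_norm M (\<lambda>x. grad_norm M (\<lambda>y. v y + s * z y) x - grad_norm M v x) \<le> \<bar>s\<bar> * sqrt (energy z z)"
proof -
  let ?w = "\<lambda>y. v y + s * z y"
  have w: "?w \<in> W12 M" by (rule W12_add_scale[OF v z])
  have v_eq: "(\<lambda>y. 1 * ?w y + (- s) * z y) = v" by simp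
  have "L2_norm M (\<lambda>x. grad_norm M ?w x - grad_norm M v x) \<le> L2_norm M (\<lambda>x. s * grad_norm M z x)"
  proof (rule L2_bound(2)[OF L2_scale[OF grad_norm_L2[OF z]]])
    show "(\<lambda>x. grad_norm M ?w x - grad_norm M v x) \<in> borel_measurable M"
      by (rule L2_measurable[OF L2_diff[OF grad_norm_L2[OF w] grad_norm_L2[OF v]]])
    show "AE x in M. \<bar>grad_norm M ?w x - grad_norm M v x\<bar> \<le> \<bar>s * grad_norm M z x\<bar>"
      using W12_lincomb(2)[OF v z, of 1 s] W12_lincomb(2)[OF w z, of 1 "- s", unfolded v_eq] grad_norm_nonneg[OF z]
      by eventually_elim (simp add: abs_mult abs_le_iff)
  qed
  also have "\<dots> = \<bar>s\<bar> * sqrt (energy z z)"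
    by (simp add: L2_norm_scale) (simp add: L2_norm_def energy_self z)
  finally show ?thesis .
qed

end

section \<open>Bochner's inequality and its extension by regularisation\<close>

locale bochner_mms = hilbert_mms +
  fixes K N :: real
  assumes N_pos: "0 < N"
    and Bochner: "weak_Bochner M K (ereal N)"
begin

text \<open>Integration by parts turns \<integral>g \<langle>\<nabla>w, \<nabla>k\<rangle> into
  -\<integral>g k^2 - \<integral>k \<langle>\<nabla>g, \<nabla>w\<rangle>. This is the origin of 1 /
  N - 1, and it removes \<nabla>k, which would not survive a limit in which k loses its Sobolev
  regularity.\<close>

lemma Bochner_regular:
  assumes w: "w \<in> W12b" "k \<in> W12b" "is_laplacian M w k"
    and g: "g \<in> W12b" "\<And>x. 0 \<le> g x" "is_laplacian M g \<kappa>" "\<And>x. \<bar>\<kappa> x\<bar> \<le> C"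
  shows "(\<integral>x. g x * ((1 / N - 1) * (k x)\<^sup>2) \<partial>M) + (\<integral>x. (K * g x) * (grad_norm M w x)\<^sup>2 \<partial>M)
      - (\<integral>x. k x * grad_inner M g w x \<partial>M) \<le> (\<integral>x. \<kappa> x * (grad_norm M w x)\<^sup>2 \<partial>M) / 2"
proof -
  let ?L = "laplacian M w" and ?u = "\<lambda>x. (grad_norm M w x)\<^sup>2"
  note wW = W12b_W12[OF w(1)] and kW = W12b_W12[OF w(2)] and gW = W12b_W12[OF g(1)]
  note Lw = laplacian_AE_eq[OF w(3)] and Lg = laplacian_AE_eq[OF g(3)]
  have Lm: "?L \<in> borel_measurable M" "laplacian M g \<in> borel_measurable M" "\<kappa> \<in> borel_measurable M"
    using Lw(1) Lg(1) g(3) by (auto simp: is_laplacian_def intro: L2_measurable)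
  note km = W12b_measurable[OF w(2)] and gm = W12b_measurable[OF g(1)]
  have LW: "?L \<in> W12 M"
    by (rule W12_cong[OF kW Lm(1)]) (use Lw(2) in \<open>eventually_elim, simp\<close>)
  have gi: "grad_inner M w ?L = grad_inner M w k"
    by (rule grad_inner_cong[OF Lm(1) km Lw(2) W12b_measurable[OF w(1)]])
  have "AE x in M. ereal \<bar>laplacian M g x\<bar> \<le> ereal C"
    using Lg(2) by eventually_elim (use g(4) in simp)
  then have "Linf_norm M (laplacian M g) \<le> ereal C"
    unfolding Linf_norm_def by (intro esssup_I) (use Lm(2) in auto)
  then have Linf: "laplacian M g \<in> Linf M" using Lm(2) by (auto simp: Linf_def intro: order_le_less_trans)
  have ui: "integrable M ?u" by (rule L2_integrable_sq[OF grad_norm_L2[OF wW]])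
  note gii = grad_inner_integrable[OF wW kW]
  have ki: "integrable M (\<lambda>x. (k x)\<^sup>2)" by (rule L2_integrable_sq[OF W12_L2[OF kW]])
  have Li: "integrable M (\<lambda>x. (?L x)\<^sup>2)" using Lw(1) by (simp add: is_laplacian_def L2_integrable_sq)
  define R where "R = (\<lambda>x. g x * (real_of_ereal (1 / ereal N) * (?L x)\<^sup>2 + grad_inner M w ?L x + K * ?u x))"
  have N1: "real_of_ereal (1 / ereal N) = 1 / N" by (simp add: one_ereal_def)
  \<comment> \<open>The premise of \<open>weak_Bochner\<close> on integrability; it holds because g
    is bounded.\<close>
  have Ri: "integrable M R"
    unfolding R_def gi by (intro W12b_mult_integrable[OF g(1)] Bochner_Integration.integrable_add gii integrable_mult_right Li ui)
  have dom: "w \<in> dom_laplacian M" "g \<in> dom_laplacian M" using w(3) g(3) by (auto simp: dom_laplacian_def)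
  have main: "(\<integral>x. R x \<partial>M) \<le> (\<integral>x. laplacian M g x * (?u x / 2) \<partial>M)"
    using Bochner[unfolded weak_Bochner_def Let_def, rule_format, OF dom] LW Linf Ri g(2) by (simp add: R_def)
  have "(\<integral>x. laplacian M g x * (?u x / 2) \<partial>M) = (\<integral>x. \<kappa> x * ?u x / 2 \<partial>M)"
    by (rule integral_cong_AE) (use Lm L2_measurable[OF grad_norm_L2[OF wW]] Lg(2) in \<open>auto elim: eventually_mono\<close>)
  then have r: "(\<integral>x. laplacian M g x * (?u x / 2) \<partial>M) = (\<integral>x. \<kappa> x * ?u x \<partial>M) / 2" by simp
  have gk: "integrable M (\<lambda>x. g x * (k x)\<^sup>2)" "integrable M (\<lambda>x. g x * grad_inner M w k x)" "integrable M (\<lambda>x. g x * ?u x)"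
    using W12b_mult_integrable[OF g(1)] ki gii ui by auto
  have "(\<integral>x. R x \<partial>M) = (\<integral>x. 1 / N * (g x * (k x)\<^sup>2) + g x * grad_inner M w k x + K * (g x * ?u x) \<partial>M)"
  proof (rule integral_cong_AE)
    show "AE x in M. R x = 1 / N * (g x * (k x)\<^sup>2) + g x * grad_inner M w k x + K * (g x * ?u x)"
      using Lw(2) by eventually_elim (simp only: R_def gi N1 distrib_left mult.left_commute)
  qed (use Ri gk in auto)
  also have "\<dots> = 1 / N * (\<integral>x. g x * (k x)\<^sup>2 \<partial>M) + (\<integral>x. g x * grad_inner M w k x \<partial>M) + K * (\<integral>x. g x * ?u x \<partial>M)"
    using gk by simp
  finally have l: "(\<integral>x. R x \<partial>M) = 1 / N * (\<integral>x. g x * (k x)\<^sup>2 \<partial>M) + (\<integral>x. g x * grad_inner M w k x \<partial>M) + K * (\<integral>x. g x * ?u x \<partial>M)" .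
  have gkb: "(\<lambda>x. g x * k x) \<in> W12b" by (rule W12b_mult[OF g(1) w(2)])
  note gkW = W12b_W12[OF gkb]
  have kgw: "integrable M (\<lambda>x. k x * grad_inner M g w x)" by (rule W12b_mult_integrable[OF w(2) grad_inner_integrable[OF gW wW]])
  have "- (\<integral>x. g x * (k x)\<^sup>2 \<partial>M) = energy w (\<lambda>x. g x * k x)"
    using w(3) gkW by (simp add: is_laplacian_iff power2_eq_square mult.left_commute)
  also have "\<dots> = (\<integral>x. grad_inner M w (\<lambda>x. g x * k x) x \<partial>M)" by (rule integral_grad_inner[symmetric, OF wW gkW])
  also have "\<dots> = (\<integral>x. g x * grad_inner M w k x + k x * grad_inner M g w x \<partial>M)"
  proof (rule integral_cong_AE)
    show "AE x in M. grad_inner M w (\<lambda>x. g x * k x) x = g x * grad_inner M w k x + k x * grad_inner M g w x"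
      using grad_inner_mult[OF wW g(1) w(2)] grad_inner_sym[OF w(1) g(1)] by eventually_elim simp
  qed (use gk kgw grad_inner_measurable[OF wW gkW] in auto)
  also have "\<dots> = (\<integral>x. g x * grad_inner M w k x \<partial>M) + (\<integral>x. k x * grad_inner M g w x \<partial>M)"
    using gk kgw by simp
  finally have "(\<integral>x. g x * grad_inner M w k x \<partial>M) = - (\<integral>x. g x * (k x)\<^sup>2 \<partial>M) - (\<integral>x. k x * grad_inner M g w x \<partial>M)" by linarith
  with main r l have "1 / N * (\<integral>x. g x * (k x)\<^sup>2 \<partial>M) - (\<integral>x. g x * (k x)\<^sup>2 \<partial>M) - (\<integral>x. k x * grad_inner M g w x \<partial>M)
      + K * (\<integral>x. g x * ?u x \<partial>M) \<le> (\<integral>x. \<kappa> x * ?u x \<partial>M) / 2" by linarith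
  moreover have "(\<integral>x. g x * ((1 / N - 1) * (k x)\<^sup>2) \<partial>M) = (1 / N - 1) * (\<integral>x. g x * (k x)\<^sup>2 \<partial>M)"
    by (simp only: mult.left_commute[of _ "1 / N - 1"] integral_mult_right_zero)
  moreover have "(\<integral>x. (K * g x) * ?u x \<partial>M) = K * (\<integral>x. g x * ?u x \<partial>M)"
    by (simp add: mult.assoc)
  ultimately show ?thesis by (simp add: left_diff_distrib)
qed

text \<open>If k is the resolvent of h with parameter \<epsilon>, then w = v + \<epsilon> k
  satisfies \<Delta>w = h + (k - h) = k, which lies in W12. So w is admissible in
  \<open>Bochner_regular\<close>, and |\<nabla>w| returns to |\<nabla>v| in L2 because \<epsilon>
  times the energy norm of k tends to 0.\<close>

lemma Bochner_bounded_laplacian: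
  assumes v: "v \<in> W12b" "is_laplacian M v h" "AE x in M. \<bar>h x\<bar> \<le> C" "AE x in M. grad_norm M v x \<le> L"
    and g: "g \<in> W12b" "\<And>x. 0 \<le> g x" "is_laplacian M g \<kappa>" "\<And>x. \<bar>\<kappa> x\<bar> \<le> B"
  shows "(\<integral>x. g x * ((1 / N - 1) * (h x)\<^sup>2) \<partial>M) + (\<integral>x. (K * g x) * (grad_norm M v x)\<^sup>2 \<partial>M)
      - (\<integral>x. h x * grad_inner M g v x \<partial>M) \<le> (\<integral>x. \<kappa> x * (grad_norm M v x)\<^sup>2 \<partial>M) / 2"
proof -
  note vW = W12b_W12[OF v(1)] and gW = W12b_W12[OF g(1)]
  have hL: "h \<in> L2 M" using v(2) by (simp add: is_laplacian_def)
  have hE: "energy v \<phi> = - (\<integral>x. h x * \<phi> x \<partial>M)" if "\<phi> \<in> W12 M" for \<phi> using v(2) that by (simp add: is_laplacian_iff)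
  have gE: "\<kappa> \<in> borel_measurable M" using g(3) by (simp add: is_laplacian_def L2_measurable)
  have C0: "0 \<le> C" by (rule AE_abs_bound_nonneg[OF v(3)])
  have B0: "0 \<le> B" using order_trans[OF abs_ge_zero g(4)] .
  let ?e = "\<lambda>n. 1 / real (Suc n)"
  have e0: "0 < ?e n" for n by simp
  \<comment> \<open>h is bounded only a.e., while \<open>resolvent\<close> asks for bounds at every
    point.\<close>
  let ?h = "\<lambda>x. clip (- C) C (h x)"
  have hm: "?h \<in> borel_measurable M" using L2_measurable[OF hL] by measurable
  have hb: "- C \<le> ?h x" "?h x \<le> C" for x using clip_bounds[of "- C" C "h x"] C0 by auto
  have hh: "AE x in M. ?h x = h x" using v(3) by eventually_elim (simp add: clip_id abs_le_iff)
  have "\<exists>k. k \<in> W12b \<and> (\<forall>x. \<bar>k x\<bar> \<le> C) \<and> (\<forall>\<phi>\<in>W12 M. ?e n * energy k \<phi> + (\<integral>x. (k x - h x) * \<phi> x \<partial>M) = 0)" for n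
  proof -
    obtain k where k: "k \<in> W12b" "\<And>x. - C \<le> k x" "\<And>x. k x \<le> C"
      "\<And>\<phi>. \<phi> \<in> W12 M \<Longrightarrow> ?e n * energy k \<phi> + (\<integral>x. (k x - ?h x) * \<phi> x \<partial>M) = 0"
      by (rule resolvent[OF e0 hm hb], rule that) blast
    have "(\<integral>x. (k x - ?h x) * \<phi> x \<partial>M) = (\<integral>x. (k x - h x) * \<phi> x \<partial>M)" if "\<phi> \<in> W12 M" for \<phi>
    proof (rule integral_cong_AE)
      show "AE x in M. (k x - ?h x) * \<phi> x = (k x - h x) * \<phi> x" using hh by eventually_elim simp
    qed (use W12b_measurable[OF k(1)] hm L2_measurable[OF hL] L2_measurable[OF W12_L2[OF that]] in auto)
    then show ?thesis using k by (intro exI[of _ k]) (auto simp: abs_le_iff minus_le_iff)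
  qed
  then obtain k where k: "\<And>n. k n \<in> W12b" "\<And>n x. \<bar>k n x\<bar> \<le> C"
    and el: "\<And>n \<phi>. \<phi> \<in> W12 M \<Longrightarrow> ?e n * energy (k n) \<phi> + (\<integral>x. (k n x - h x) * \<phi> x \<partial>M) = 0" by metis
  note kW = W12b_W12[OF k(1)] and kL = W12_L2[OF W12b_W12[OF k(1)]]
  have klim: "(\<lambda>n. L2_norm M (\<lambda>x. k n x - h x)) \<longlonglongrightarrow> 0"
    and sqlim: "(\<lambda>n. ?e n * sqrt (energy (k n) (k n))) \<longlonglongrightarrow> 0"
    using resolvent_tendsto[OF hL k(1) e0 inverse_Suc_tendsto el[OF W12b_W12]] by blast+
  define w where "w n = (\<lambda>x. v x + ?e n * k n x)" for n
  have wb: "w n \<in> W12b" for n unfolding w_def by (rule W12b_add_scale[OF v(1) k(1)])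
  have wl: "is_laplacian M (w n) (k n)" for n
    unfolding is_laplacian_iff
  proof (intro conjI ballI W12b_W12[OF wb] kL)
    fix \<phi> assume \<phi>: "\<phi> \<in> W12 M"
    have "energy (w n) \<phi> = energy v \<phi> + ?e n * energy (k n) \<phi>"
      unfolding w_def using energy_lincomb[OF vW kW \<phi>, of 1 "?e n" n] by simp
    moreover have "(\<integral>x. (k n x - h x) * \<phi> x \<partial>M) = (\<integral>x. k n x * \<phi> x \<partial>M) - (\<integral>x. h x * \<phi> x \<partial>M)"
      using L2_mult_integrable[OF kL W12_L2[OF \<phi>], of n] L2_mult_integrable[OF hL W12_L2[OF \<phi>]]
      by (simp add: left_diff_distrib)
    ultimately show "energy (w n) \<phi> = - (\<integral>x. k n x * \<phi> x \<partial>M)" using hE[OF \<phi>] el[OF \<phi>, of n] by linarith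
  qed
  have wlim: "(\<lambda>n. L2_norm M (\<lambda>x. grad_norm M (w n) x - grad_norm M v x)) \<longlonglongrightarrow> 0"
  proof (rule Lim_null_comparison[OF always_eventually sqlim], rule allI)
    fix n
    show "norm (L2_norm M (\<lambda>x. grad_norm M (w n) x - grad_norm M v x)) \<le> ?e n * sqrt (energy (k n) (k n))"
      using grad_norm_diff_le[OF vW kW, of "?e n" n] by (simp add: w_def)
  qed
  note gsq = integral_bounded_sq_tendsto[OF grad_norm_L2[OF W12b_W12[OF wb]] grad_norm_L2[OF vW] wlim]
  obtain A where A: "0 \<le> A" "\<And>x. \<bar>g x\<bar> \<le> A" by (rule W12bE[OF g(1)], rule that)
  note gm = W12b_measurable[OF g(1)]
  have l1: "(\<lambda>n. \<integral>x. \<kappa> x * (grad_norm M (w n) x)\<^sup>2 \<partial>M) \<longlonglongrightarrow> (\<integral>x. \<kappa> x * (grad_norm M v x)\<^sup>2 \<partial>M)"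
    by (rule gsq[OF gE, of B]) (use g(4) B0 in auto)
  have l2: "(\<lambda>n. \<integral>x. (K * g x) * (grad_norm M (w n) x)\<^sup>2 \<partial>M) \<longlonglongrightarrow> (\<integral>x. (K * g x) * (grad_norm M v x)\<^sup>2 \<partial>M)"
    by (rule gsq[of _ "\<bar>K\<bar> * A"]) (use gm A in \<open>auto simp: abs_mult intro!: mult_left_mono\<close>)
  have "(\<lambda>n. \<integral>x. (g x * (1 / N - 1)) * (k n x)\<^sup>2 \<partial>M) \<longlonglongrightarrow> (\<integral>x. (g x * (1 / N - 1)) * (h x)\<^sup>2 \<partial>M)"
    by (rule integral_bounded_sq_tendsto[OF kL hL klim, of _ "A * \<bar>1 / N - 1\<bar>"])
       (use gm A in \<open>auto simp: abs_mult intro!: mult_right_mono\<close>)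
  then have l3: "(\<lambda>n. \<integral>x. g x * ((1 / N - 1) * (k n x)\<^sup>2) \<partial>M) \<longlonglongrightarrow> (\<integral>x. g x * ((1 / N - 1) * (h x)\<^sup>2) \<partial>M)"
    by (simp only: mult.assoc)
  have gvL: "grad_inner M g v \<in> L2 M"
  proof (rule L2_bound(1)[OF L2_scale[OF grad_norm_L2[OF gW], of L] grad_inner_measurable[OF gW vW]])
    show "AE x in M. \<bar>grad_inner M g v x\<bar> \<le> \<bar>L * grad_norm M g x\<bar>"
      using grad_inner_Cauchy_Schwarz[OF gW vW] v(4) grad_norm_nonneg[OF vW] grad_norm_nonneg[OF gW]
    proof eventually_elim
      case (elim x)
      have "grad_norm M g x * grad_norm M v x \<le> grad_norm M g x * L" using elim by (intro mult_left_mono) auto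
      with elim(1) show ?case by (simp add: mult.commute)
    qed
  qed
  \<comment> \<open>The summand v of w n gives a convergent term because \<langle>\<nabla>g,
    \<nabla>v\<rangle> is in L2, by the bound L on |\<nabla>v|. The summand with k n is at most C
    sqrt(energy g g) times the vanishing quantity in \<open>sqlim\<close>.\<close>
  have l4: "(\<lambda>n. \<integral>x. k n x * grad_inner M g (w n) x \<partial>M) \<longlonglongrightarrow> (\<integral>x. h x * grad_inner M g v x \<partial>M)"
  proof -
    have eq: "(\<integral>x. k n x * grad_inner M g (w n) x \<partial>M)
        = (\<integral>x. k n x * grad_inner M g v x \<partial>M) + ?e n * (\<integral>x. k n x * grad_inner M g (k n) x \<partial>M)" for n
    proof -
      have i: "integrable M (\<lambda>x. k n x * grad_inner M g v x)" "integrable M (\<lambda>x. k n x * grad_inner M g (k n) x)"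
        using W12b_mult_integrable[OF k(1)] grad_inner_integrable[OF gW vW] grad_inner_integrable[OF gW kW] by auto
      have "(\<integral>x. k n x * grad_inner M g (w n) x \<partial>M)
          = (\<integral>x. k n x * grad_inner M g v x + ?e n * (k n x * grad_inner M g (k n) x) \<partial>M)"
      proof (rule integral_cong_AE)
        show "AE x in M. k n x * grad_inner M g (w n) x = k n x * grad_inner M g v x + ?e n * (k n x * grad_inner M g (k n) x)"
          using grad_inner_lincomb[OF gW vW kW, of 1 "?e n" n, unfolded mult_1, folded w_def]
          by eventually_elim (simp add: distrib_left)
      qed (use i W12b_measurable[OF k(1)] grad_inner_measurable[OF gW W12b_W12[OF wb]] in auto)
      then show ?thesis using i by simp
    qed
    have "(\<lambda>n. ?e n * (\<integral>x. k n x * grad_inner M g (k n) x \<partial>M)) \<longlonglongrightarrow> 0"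
    proof (rule Lim_null_comparison[OF always_eventually])
      show "\<forall>n. norm (?e n * (\<integral>x. k n x * grad_inner M g (k n) x \<partial>M)) \<le> C * sqrt (energy g g) * (?e n * sqrt (energy (k n) (k n)))"
      proof
        fix n
        have "\<bar>\<integral>x. k n x * grad_inner M g (k n) x \<partial>M\<bar> \<le> C * (\<integral>x. \<bar>grad_inner M g (k n) x\<bar> \<partial>M)"
          by (rule integral_bounded_mult_le[OF W12b_measurable[OF k(1)] AE_I2 grad_inner_integrable[OF gW kW]]) (rule k(2))
        also have "\<dots> \<le> C * (sqrt (energy g g) * sqrt (energy (k n) (k n)))"
          by (rule mult_left_mono[OF energy_Cauchy_Schwarz[OF gW kW] C0])
        finally have "?e n * \<bar>\<integral>x. k n x * grad_inner M g (k n) x \<partial>M\<bar> \<le> ?e n * (C * (sqrt (energy g g) * sqrt (energy (k n) (k n))))"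
          by (rule mult_left_mono) simp
        then show "norm (?e n * (\<integral>x. k n x * grad_inner M g (k n) x \<partial>M)) \<le> C * sqrt (energy g g) * (?e n * sqrt (energy (k n) (k n)))"
          by (simp add: abs_mult mult_ac)
      qed
      show "(\<lambda>n. C * sqrt (energy g g) * (?e n * sqrt (energy (k n) (k n)))) \<longlonglongrightarrow> 0"
        by (rule tendsto_mult_right_zero[OF sqlim])
    qed
    from tendsto_add[OF L2_inner_tendsto[OF kL hL gvL klim] this] show ?thesis unfolding eq by simp
  qed
  show ?thesis
  proof (rule LIMSEQ_le)
    show "(\<lambda>n. (\<integral>x. g x * ((1 / N - 1) * (k n x)\<^sup>2) \<partial>M) + (\<integral>x. (K * g x) * (grad_norm M (w n) x)\<^sup>2 \<partial>M)
      - (\<integral>x. k n x * grad_inner M g (w n) x \<partial>M)) \<longlonglongrightarrow> (\<integral>x. g x * ((1 / N - 1) * (h x)\<^sup>2) \<partial>M) + (\<integral>x. (K * g x) * (grad_norm M v x)\<^sup>2 \<partial>M)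
      - (\<integral>x. h x * grad_inner M g v x \<partial>M)"
      by (intro tendsto_intros l2 l3 l4)
    show "(\<lambda>n. (\<integral>x. \<kappa> x * (grad_norm M (w n) x)\<^sup>2 \<partial>M) / 2) \<longlonglongrightarrow> (\<integral>x. \<kappa> x * (grad_norm M v x)\<^sup>2 \<partial>M) / 2"
      by (intro tendsto_intros l1) simp
    show "\<exists>n0. \<forall>n\<ge>n0. (\<integral>x. g x * ((1 / N - 1) * (k n x)\<^sup>2) \<partial>M) + (\<integral>x. (K * g x) * (grad_norm M (w n) x)\<^sup>2 \<partial>M)
      - (\<integral>x. k n x * grad_inner M g (w n) x \<partial>M) \<le> (\<integral>x. \<kappa> x * (grad_norm M (w n) x)\<^sup>2 \<partial>M) / 2"
      using Bochner_regular[OF wb k(1) wl g] by blast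
  qed
qed

text \<open>Here g has a Laplacian p merely in L2 and merely against bounded test functions. Its
  resolvents G n have bounded Laplacians k n = (G n - g) / \<epsilon>, and k n is in turn the
  resolvent of p, so k n converges to p in L2. This can be paired with |\<nabla>v|^2, which is
  bounded.\<close>

lemma Bochner_weak_laplacian:
  assumes v: "v \<in> W12b" "is_laplacian M v h" "AE x in M. \<bar>h x\<bar> \<le> C" "AE x in M. grad_norm M v x \<le> L"
    and g: "g \<in> W12b" "\<And>x. 0 \<le> g x" "p \<in> L2 M" "\<And>\<phi>. \<phi> \<in> W12b \<Longrightarrow> energy g \<phi> = - (\<integral>x. p x * \<phi> x \<partial>M)"
  shows "(\<integral>x. g x * ((1 / N - 1) * (h x)\<^sup>2 + K * (grad_norm M v x)\<^sup>2) \<partial>M)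
      - (\<integral>x. h x * grad_inner M v g x \<partial>M) \<le> (\<integral>x. p x * (grad_norm M v x)\<^sup>2 \<partial>M) / 2"
proof -
  note vW = W12b_W12[OF v(1)] and gW = W12b_W12[OF g(1)] and gm = W12b_measurable[OF g(1)]
  have hL: "h \<in> L2 M" using v(2) by (simp add: is_laplacian_def)
  note hm = L2_measurable[OF hL]
  have C0: "0 \<le> C" by (rule AE_abs_bound_nonneg[OF v(3)])
  let ?u = "\<lambda>x. (grad_norm M v x)\<^sup>2"
  have um: "?u \<in> borel_measurable M" using L2_measurable[OF grad_norm_L2[OF vW]] by measurable
  have ub: "AE x in M. \<bar>?u x\<bar> \<le> L\<^sup>2"
    using v(4) grad_norm_nonneg[OF vW] by eventually_elim (simp add: power_mono)
  have uL: "?u \<in> L2 M" by (rule L2_bounded[OF um ub])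
  have h2L: "(\<lambda>x. (h x)\<^sup>2) \<in> L2 M"
  proof (rule L2_bounded)
    show "AE x in M. \<bar>(h x)\<^sup>2\<bar> \<le> C\<^sup>2" using v(3) by eventually_elim (simp add: abs_le_square_iff[symmetric])
  qed (use hm in measurable)
  obtain A where A: "0 \<le> A" "\<And>x. \<bar>g x\<bar> \<le> A" by (rule W12bE[OF g(1)], rule that)
  let ?e = "\<lambda>n. 1 / real (Suc n)"
  have e0: "0 < ?e n" for n by simp
  have gA: "g x \<le> A" for x using A(2)[of x] by simp
  have "\<exists>k. k \<in> W12b \<and> (\<forall>x. 0 \<le> k x \<and> k x \<le> A) \<and> (\<forall>\<phi>\<in>W12 M. ?e n * energy k \<phi> + (\<integral>x. (k x - g x) * \<phi> x \<partial>M) = 0)" for n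
  proof -
    obtain k where k: "k \<in> W12b" "\<And>x. 0 \<le> k x" "\<And>x. k x \<le> A"
      "\<And>\<phi>. \<phi> \<in> W12 M \<Longrightarrow> ?e n * energy k \<phi> + (\<integral>x. (k x - g x) * \<phi> x \<partial>M) = 0"
      by (rule resolvent[OF e0 gm g(2) gA], rule that) blast
    then show ?thesis by blast
  qed
  then obtain G where G: "\<And>n. G n \<in> W12b" "\<And>n x. 0 \<le> G n x" "\<And>n x. G n x \<le> A"
    and el: "\<And>n \<phi>. \<phi> \<in> W12 M \<Longrightarrow> ?e n * energy (G n) \<phi> + (\<integral>x. (G n x - g x) * \<phi> x \<partial>M) = 0" by metis
  \<comment> \<open>The factor n + 1 is 1 / \<epsilon>; written as a linear combination, k n is
    visibly in \<open>W12b\<close>.\<close>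
  define k where "k n = (\<lambda>x. real (Suc n) * G n x + (- real (Suc n)) * g x)" for n
  have kb: "k n \<in> W12b" for n unfolding k_def by (rule W12b_lincomb[OF G(1) g(1)])
  note kW = W12b_W12[OF kb] and kL = W12_L2[OF W12b_W12[OF kb]]
  have Gk: "G n = (\<lambda>x. 1 * g x + ?e n * k n x)" for n by (simp add: k_def fun_eq_iff field_simps)
  have kint: "(\<integral>x. k n x * \<phi> x \<partial>M) = real (Suc n) * (\<integral>x. (G n x - g x) * \<phi> x \<partial>M)" for n \<phi>
  proof -
    have "k n x * \<phi> x = real (Suc n) * ((G n x - g x) * \<phi> x)" for x by (simp add: k_def algebra_simps)
    then show ?thesis by (simp only: integral_mult_right_zero)
  qed
  have Gl: "is_laplacian M (G n) (k n)" for n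
    unfolding is_laplacian_iff
  proof (intro conjI ballI W12b_W12[OF G(1)] kL)
    fix \<phi> assume \<phi>: "\<phi> \<in> W12 M"
    have "(\<integral>x. (G n x - g x) * \<phi> x \<partial>M) = - (?e n * energy (G n) \<phi>)" using el[OF \<phi>, of n] by linarith
    then show "energy (G n) \<phi> = - (\<integral>x. k n x * \<phi> x \<partial>M)" unfolding kint by simp
  qed
  have kbd: "\<bar>k n x\<bar> \<le> real (Suc n) * A" for n x
  proof -
    have "k n x = real (Suc n) * (G n x - g x)" by (simp add: k_def algebra_simps)
    moreover have "\<bar>G n x - g x\<bar> \<le> A" using G(2,3)[of n x] g(2)[of x] gA[of x] by linarith
    ultimately show ?thesis by (simp add: abs_mult mult_left_mono)
  qed
  \<comment> \<open>Since G n = g + \<epsilon> k n, subtracting the weak equation for g from that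
    for G n leaves the resolvent equation for k n with datum p.\<close>
  have kel: "?e n * energy (k n) \<phi> + (\<integral>x. (k n x - p x) * \<phi> x \<partial>M) = 0" if \<phi>: "\<phi> \<in> W12b" for n \<phi>
  proof -
    note \<phi>W = W12b_W12[OF \<phi>] and \<phi>L = W12_L2[OF W12b_W12[OF \<phi>]]
    have "energy (G n) \<phi> = 1 * energy g \<phi> + ?e n * energy (k n) \<phi>"
      by (subst Gk) (rule energy_lincomb[OF gW kW \<phi>W])
    moreover have "energy (G n) \<phi> = - (\<integral>x. k n x * \<phi> x \<partial>M)" using Gl[of n] \<phi>W by (simp add: is_laplacian_iff)
    moreover have "(\<integral>x. (k n x - p x) * \<phi> x \<partial>M) = (\<integral>x. k n x * \<phi> x \<partial>M) - (\<integral>x. p x * \<phi> x \<partial>M)"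
      using L2_mult_integrable[OF kL \<phi>L, of n] L2_mult_integrable[OF g(3) \<phi>L] by (simp add: left_diff_distrib)
    ultimately show ?thesis using g(4)[OF \<phi>] by linarith
  qed
  have klim: "(\<lambda>n. L2_norm M (\<lambda>x. k n x - p x)) \<longlonglongrightarrow> 0"
    and sqlim: "(\<lambda>n. ?e n * sqrt (energy (k n) (k n))) \<longlonglongrightarrow> 0"
    using resolvent_tendsto[OF g(3) kb e0 inverse_Suc_tendsto kel] by blast+
  have Glim: "(\<lambda>n. L2_norm M (\<lambda>x. G n x - g x)) \<longlonglongrightarrow> 0"
  proof -
    have "L2_norm M (\<lambda>x. G n x - g x) = ?e n * L2_norm M (k n)" for n
      by (subst Gk) (simp add: L2_norm_scale[of _ "?e n", simplified])
    moreover have "(\<lambda>n. ?e n * L2_norm M (k n)) \<longlonglongrightarrow> 0 * L2_norm M p"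
      by (intro tendsto_mult inverse_Suc_tendsto L2_norm_tendsto[OF kL g(3) klim])
    ultimately show ?thesis by simp
  qed
  let ?F = "\<lambda>x. (1 / N - 1) * (h x)\<^sup>2 + K * ?u x"
  have FL: "?F \<in> L2 M" by (rule L2_lincomb[OF h2L uL])
  have l1: "(\<lambda>n. \<integral>x. k n x * ?u x \<partial>M) \<longlonglongrightarrow> (\<integral>x. p x * ?u x \<partial>M)"
    by (rule L2_inner_tendsto[OF kL g(3) uL klim])
  have l2: "(\<lambda>n. \<integral>x. G n x * ?F x \<partial>M) \<longlonglongrightarrow> (\<integral>x. g x * ?F x \<partial>M)"
    by (rule L2_inner_tendsto[OF W12_L2[OF W12b_W12[OF G(1)]] W12_L2[OF gW] FL Glim])
  have l3: "(\<lambda>n. \<integral>x. h x * grad_inner M (G n) v x \<partial>M) \<longlonglongrightarrow> (\<integral>x. h x * grad_inner M v g x \<partial>M)"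
  proof -
    have i: "integrable M (\<lambda>x. h x * grad_inner M v \<phi> x)" if "\<phi> \<in> W12 M" for \<phi>
      by (rule integrable_bounded_mult[OF hm v(3) grad_inner_integrable[OF vW that]])
    have eq: "(\<integral>x. h x * grad_inner M (G n) v x \<partial>M) - (\<integral>x. h x * grad_inner M v g x \<partial>M)
        = ?e n * (\<integral>x. h x * grad_inner M v (k n) x \<partial>M)" for n
    proof -
      have "(\<integral>x. h x * grad_inner M (G n) v x \<partial>M) = (\<integral>x. h x * grad_inner M v g x + ?e n * (h x * grad_inner M v (k n) x) \<partial>M)"
      proof (rule integral_cong_AE)
        show "AE x in M. h x * grad_inner M (G n) v x = h x * grad_inner M v g x + ?e n * (h x * grad_inner M v (k n) x)"
          using grad_inner_sym[OF G(1)[of n] v(1)] grad_inner_lincomb[OF vW gW kW, of 1 "?e n" n, folded Gk]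
          by eventually_elim (simp add: distrib_left)
      qed (use i[OF gW] i[OF kW[of n]] hm grad_inner_measurable[OF W12b_W12[OF G(1)] vW] in auto)
      then show ?thesis using i[OF gW] i[OF kW[of n]] by simp
    qed
    have "(\<lambda>n. ?e n * (\<integral>x. h x * grad_inner M v (k n) x \<partial>M)) \<longlonglongrightarrow> 0"
    proof (rule Lim_null_comparison[OF always_eventually])
      show "\<forall>n. norm (?e n * (\<integral>x. h x * grad_inner M v (k n) x \<partial>M)) \<le> C * sqrt (energy v v) * (?e n * sqrt (energy (k n) (k n)))"
      proof
        fix n
        have "\<bar>\<integral>x. h x * grad_inner M v (k n) x \<partial>M\<bar> \<le> C * (\<integral>x. \<bar>grad_inner M v (k n) x\<bar> \<partial>M)"
          by (rule integral_bounded_mult_le[OF hm v(3) grad_inner_integrable[OF vW kW]])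
        also have "\<dots> \<le> C * (sqrt (energy v v) * sqrt (energy (k n) (k n)))"
          by (rule mult_left_mono[OF energy_Cauchy_Schwarz[OF vW kW] C0])
        finally have "?e n * \<bar>\<integral>x. h x * grad_inner M v (k n) x \<partial>M\<bar> \<le> ?e n * (C * (sqrt (energy v v) * sqrt (energy (k n) (k n))))"
          by (rule mult_left_mono) simp
        then show "norm (?e n * (\<integral>x. h x * grad_inner M v (k n) x \<partial>M)) \<le> C * sqrt (energy v v) * (?e n * sqrt (energy (k n) (k n)))"
          by (simp add: abs_mult mult_ac)
      qed
      show "(\<lambda>n. C * sqrt (energy v v) * (?e n * sqrt (energy (k n) (k n)))) \<longlonglongrightarrow> 0"
        by (rule tendsto_mult_right_zero[OF sqlim])
    qed
    then show ?thesis unfolding eq[symmetric] by (simp add: LIM_zero_iff)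
  qed
  show ?thesis
  proof (rule LIMSEQ_le)
    show "(\<lambda>n. (\<integral>x. G n x * ?F x \<partial>M) - (\<integral>x. h x * grad_inner M (G n) v x \<partial>M))
        \<longlonglongrightarrow> (\<integral>x. g x * ?F x \<partial>M) - (\<integral>x. h x * grad_inner M v g x \<partial>M)"
      by (intro tendsto_intros l2 l3)
    show "(\<lambda>n. (\<integral>x. k n x * ?u x \<partial>M) / 2) \<longlonglongrightarrow> (\<integral>x. p x * ?u x \<partial>M) / 2"
      by (intro tendsto_intros l1) simp
    have "(\<integral>x. G n x * ?F x \<partial>M) - (\<integral>x. h x * grad_inner M (G n) v x \<partial>M) \<le> (\<integral>x. k n x * ?u x \<partial>M) / 2" for n
    proof -
      have "(\<integral>x. G n x * ?F x \<partial>M) = (\<integral>x. G n x * ((1 / N - 1) * (h x)\<^sup>2) + (K * G n x) * ?u x \<partial>M)"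
        by (simp add: algebra_simps)
      also have "\<dots> = (\<integral>x. G n x * ((1 / N - 1) * (h x)\<^sup>2) \<partial>M) + (\<integral>x. (K * G n x) * ?u x \<partial>M)"
        by (rule Bochner_Integration.integral_add)
           (use W12b_mult_integrable[OF G(1)[of n]] L2_integrable[OF h2L] L2_integrable[OF uL] in \<open>auto simp: mult.assoc\<close>)
      finally show ?thesis using Bochner_bounded_laplacian[OF v G(1,2) Gl kbd, of n] by linarith
    qed
    then show "\<exists>n0. \<forall>n\<ge>n0. (\<integral>x. G n x * ?F x \<partial>M) - (\<integral>x. h x * grad_inner M (G n) v x \<partial>M) \<le> (\<integral>x. k n x * ?u x \<partial>M) / 2"
      by blast
  qed
qed

end

section \<open>The gradient estimate\<close>

context bochner_mms
begin

text \<open>The hypothesis \<open>w0\<close> is the pointwise quadratic inequality that turns the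
  lower bound for L w into b (w - w0). Keeping it abstract separates the analysis from the algebra
  of the constants.\<close>

theorem gradient_estimate:
  assumes v: "v \<in> Lip" "is_laplacian M v h" and \<alpha>: "0 < \<alpha>" and \<beta>: "0 < \<beta>" "\<beta> < 1"
    and eq: "AE x in M. - h x = (grad_norm M v x)\<^sup>2 + \<alpha> * v x"
    and b: "b = 2 * \<alpha> * (1 - \<beta>) / \<beta>"
    and w0: "\<And>u t. b * (u + (\<alpha> - \<beta> * K) * t - w0)
      \<le> 2 / N * (u + \<alpha> * t)\<^sup>2 + 2 * (K - \<alpha>) * u + (\<alpha> - \<beta> * K) * (u - \<alpha> * t)"
  shows "AE x in M. (grad_norm M v x)\<^sup>2 + (\<alpha> - \<beta> * K) * v x \<le> w0"
proof -
  let ?u = "\<lambda>x. (grad_norm M v x)\<^sup>2" and ?c = "\<alpha> - \<beta> * K"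
  have b0: "0 < b" using \<alpha> \<beta> by (simp add: b)
  have vb: "v \<in> W12b" by (rule Lip_W12b[OF v(1)])
  note vW = W12b_W12[OF vb] and vm = W12b_measurable[OF vb]
  obtain A where A: "0 \<le> A" "\<And>x. \<bar>v x\<bar> \<le> A" by (rule Lip_bounded[OF v(1)], rule that)
  obtain L where L: "0 \<le> L" "\<And>x. \<bar>lip v x\<bar> \<le> L" by (rule lip_bounded[OF v(1)], rule that)
  have hL: "h \<in> L2 M" using v(2) by (simp add: is_laplacian_def)
  note hm = L2_measurable[OF hL]
  have hE: "energy v \<phi> = - (\<integral>x. h x * \<phi> x \<partial>M)" if "\<phi> \<in> W12 M" for \<phi> using v(2) that by (simp add: is_laplacian_iff)
  have vN: "AE x in M. grad_norm M v x \<le> L"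
    using grad_norm_Lip[OF v(1)] by eventually_elim (use L(2) abs_le_D1 order_trans in blast)
  have um: "?u \<in> borel_measurable M" using L2_measurable[OF grad_norm_L2[OF vW]] by measurable
  have ub: "AE x in M. \<bar>?u x\<bar> \<le> L\<^sup>2"
    using vN grad_norm_nonneg[OF vW] by eventually_elim (simp add: power_mono)
  have hb: "AE x in M. \<bar>h x\<bar> \<le> L\<^sup>2 + \<alpha> * A"
    using eq ub
  proof eventually_elim
    case (elim x)
    have "\<bar>\<alpha> * v x\<bar> \<le> \<alpha> * A" using A(2)[of x] \<alpha> by (simp add: abs_mult)
    then show ?case using elim by linarith
  qed
  let ?w = "\<lambda>x. ?u x + ?c * v x"
  let ?\<chi> = "\<lambda>x. if w0 < ?w x then 1 else 0 :: real"
  have \<chi>m: "?\<chi> \<in> borel_measurable M" using um vm by measurable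
  define E where "E x = exp (2 * v x)" for x
  have Em: "E \<in> borel_measurable M" unfolding E_def using vm by measurable
  have Epos: "0 < E x" for x by (simp add: E_def)
  have Ebd: "exp (- 2 * A) \<le> E x" "E x \<le> exp (2 * A)" for x
    using A(2)[of x] by (auto simp: E_def abs_le_iff)
  have Eb: "E \<in> W12b" and Egrad: "\<And>f. f \<in> W12 M \<Longrightarrow> AE x in M. grad_inner M f E x = 2 * E x * grad_inner M f v x"
    unfolding E_def[abs_def] by (rule W12b_exp[OF v(1)], rule grad_inner_exp[OF v(1)])
  \<comment> \<open>The weights E and b E with the datum \<chi> / (b E) give -div(E \<nabla>\<psi>)
    + b E \<psi> = \<chi>. Since div(E \<nabla>\<psi>) = E L \<psi> formally, this is (b - L) \<psi>
    = \<chi> / E.\<close>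
  obtain \<psi> where \<psi>: "\<psi> \<in> W12b" "\<And>x. 0 \<le> \<psi> x"
    and el: "\<And>\<phi>. \<phi> \<in> W12 M \<Longrightarrow> (\<integral>x. E x * grad_inner M \<psi> \<phi> x \<partial>M)
      + (\<integral>x. (b * E x) * ((\<psi> x - ?\<chi> x / (b * E x)) * \<phi> x) \<partial>M) = 0"
  proof (rule weighted_resolvent[of E "min 1 b * exp (- 2 * A)" "max 1 b * exp (2 * A)" "\<lambda>x. b * E x" "\<lambda>x. ?\<chi> x / (b * E x)" 0 "1 / (b * exp (- 2 * A))"])
    fix x
    have "min 1 b * exp (- 2 * A) \<le> 1 * E x" "min 1 b * exp (- 2 * A) \<le> b * E x"
      using Ebd(1)[of x] b0 by (intro mult_mono; simp)+
    then show "min 1 b * exp (- 2 * A) \<le> E x" "min 1 b * exp (- 2 * A) \<le> b * E x" by simp_all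
    have "1 * E x \<le> max 1 b * exp (2 * A)" "b * E x \<le> max 1 b * exp (2 * A)"
      using Ebd(2)[of x] b0 Epos[of x] by (intro mult_mono; simp)+
    then show "E x \<le> max 1 b * exp (2 * A)" "b * E x \<le> max 1 b * exp (2 * A)" by simp_all
    show "0 \<le> ?\<chi> x / (b * E x)" using b0 Epos[of x] by simp
    have "?\<chi> x / (b * E x) \<le> 1 / (b * E x)" using b0 Epos[of x] by (intro divide_right_mono) auto
    also have "\<dots> \<le> 1 / (b * exp (- 2 * A))" using Ebd(1)[of x] b0 Epos[of x] by (intro divide_left_mono mult_left_mono) auto
    finally show "?\<chi> x / (b * E x) \<le> 1 / (b * exp (- 2 * A))" .
  qed (use Em \<chi>m b0 in auto)
  \<comment> \<open>Testing with \<psi> with respect to exp(2 v) m is testing with g with respect to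
    m, the measure of Bochner's inequality.\<close>
  define g where "g = (\<lambda>x. \<psi> x * E x)"
  have gb: "g \<in> W12b" unfolding g_def by (rule W12b_mult[OF \<psi>(1) Eb])
  have g0: "0 \<le> g x" for x using \<psi>(2)[of x] Epos[of x] by (simp add: g_def)
  note gW = W12b_W12[OF gb] and gm = W12b_measurable[OF gb] and gL = W12_L2[OF W12b_W12[OF gb]]
  let ?I = "grad_inner M v g"
  have IL: "?I \<in> L2 M"
  proof (rule L2_bound(1)[OF L2_scale[OF grad_norm_L2[OF gW], of L] grad_inner_measurable[OF vW gW]])
    show "AE x in M. \<bar>?I x\<bar> \<le> \<bar>L * grad_norm M g x\<bar>"
      using grad_inner_Cauchy_Schwarz[OF vW gW] vN grad_norm_nonneg[OF vW] grad_norm_nonneg[OF gW]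
    proof eventually_elim
      case (elim x)
      have "grad_norm M v x * grad_norm M g x \<le> L * grad_norm M g x" using elim by (intro mult_right_mono) auto
      with elim(1) show ?case by simp
    qed
  qed
  have \<chi>L: "?\<chi> \<in> L2 M" by (rule L2_bounded[OF \<chi>m, of 1]) auto
  have bound_L2: "(\<lambda>x. s x * t x) \<in> L2 M" if "s \<in> borel_measurable M" "AE x in M. \<bar>s x\<bar> \<le> B" "t \<in> L2 M" for s t B
  proof -
    have "AE x in M. \<bar>s x\<bar> \<le> \<bar>B\<bar>" using that(2) by eventually_elim linarith
    from L2_norm_mult_bounded(1)[OF that(3,1) this] show ?thesis by simp
  qed
  have hgL: "(\<lambda>x. h x * g x) \<in> L2 M" by (rule bound_L2[OF hm hb gL])
  have ugL: "(\<lambda>x. ?u x * g x) \<in> L2 M" by (rule bound_L2[OF um ub gL])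
  define q where "q x = b * g x - ?\<chi> x" for x
  have qL: "q \<in> L2 M" unfolding q_def by (intro L2_diff L2_scale gL \<chi>L)
  \<comment> \<open>p is the Laplacian of g: from \<nabla>g = E \<nabla>\<psi> + 2 g \<nabla>v
    follows \<Delta>g = (b g - \<chi>) + 2 div(g \<nabla>v), and div(g \<nabla>v) = h g +
    \<langle>\<nabla>v, \<nabla>g\<rangle>.\<close>
  define p where "p x = q x + 2 * (h x * g x + ?I x)" for x
  have pL: "p \<in> L2 M" unfolding p_def by (intro L2_add L2_scale qL hgL IL)
  \<comment> \<open>Integration by parts for the field g \<nabla>v; the product g \<phi> is an
    admissible test function because both factors are bounded.\<close>
  have vg: "(\<integral>x. g x * grad_inner M v \<phi> x \<partial>M) = - (\<integral>x. h x * g x * \<phi> x \<partial>M) - (\<integral>x. ?I x * \<phi> x \<partial>M)" if \<phi>: "\<phi> \<in> W12b" for \<phi>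
  proof -
    have gf: "(\<lambda>x. g x * \<phi> x) \<in> W12b" by (rule W12b_mult[OF gb \<phi>])
    have i: "integrable M (\<lambda>x. g x * grad_inner M v \<phi> x)" "integrable M (\<lambda>x. \<phi> x * ?I x)"
      using W12b_mult_integrable[OF gb grad_inner_integrable[OF vW W12b_W12[OF \<phi>]]]
        W12b_mult_integrable[OF \<phi> grad_inner_integrable[OF vW gW]] by auto
    have "- (\<integral>x. h x * (g x * \<phi> x) \<partial>M) = (\<integral>x. grad_inner M v (\<lambda>x. g x * \<phi> x) x \<partial>M)"
      using hE[OF W12b_W12[OF gf]] integral_grad_inner[OF vW W12b_W12[OF gf]] by simp
    also have "\<dots> = (\<integral>x. g x * grad_inner M v \<phi> x + \<phi> x * ?I x \<partial>M)"
      by (rule integral_cong_AE) (use grad_inner_mult[OF vW gb \<phi>] grad_inner_measurable[OF vW W12b_W12[OF gf]] i in auto)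
    also have "\<dots> = (\<integral>x. g x * grad_inner M v \<phi> x \<partial>M) + (\<integral>x. \<phi> x * ?I x \<partial>M)" using i by simp
    finally show ?thesis by (simp add: mult.assoc mult.commute[of "?I _"])
  qed
  have gE: "energy g \<phi> = - (\<integral>x. p x * \<phi> x \<partial>M)" if \<phi>: "\<phi> \<in> W12b" for \<phi>
  proof -
    note \<phi>W = W12b_W12[OF \<phi>] and \<phi>L = W12_L2[OF W12b_W12[OF \<phi>]]
    have i: "integrable M (\<lambda>x. E x * grad_inner M \<psi> \<phi> x)" "integrable M (\<lambda>x. g x * grad_inner M v \<phi> x)"
      using W12b_mult_integrable[OF Eb grad_inner_integrable[OF W12b_W12[OF \<psi>(1)] \<phi>W]]
        W12b_mult_integrable[OF gb grad_inner_integrable[OF vW \<phi>W]] by auto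
    have "energy g \<phi> = (\<integral>x. grad_inner M \<phi> g x \<partial>M)"
      using integral_grad_inner[OF \<phi>W gW] energy_sym[OF \<phi>W gW] by simp
    also have "\<dots> = (\<integral>x. E x * grad_inner M \<psi> \<phi> x + 2 * (g x * grad_inner M v \<phi> x) \<partial>M)"
    proof (rule integral_cong_AE)
      show "AE x in M. grad_inner M \<phi> g x = E x * grad_inner M \<psi> \<phi> x + 2 * (g x * grad_inner M v \<phi> x)"
        using grad_inner_mult[OF \<phi>W \<psi>(1) Eb, folded g_def] Egrad[OF \<phi>W] grad_inner_sym[OF \<phi> \<psi>(1)] grad_inner_sym[OF \<phi> vb]
        by eventually_elim (simp add: g_def)
    qed (use i grad_inner_measurable[OF \<phi>W gW] in auto)
    also have "\<dots> = (\<integral>x. E x * grad_inner M \<psi> \<phi> x \<partial>M) + 2 * (\<integral>x. g x * grad_inner M v \<phi> x \<partial>M)" using i by simp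
    also have "(\<integral>x. E x * grad_inner M \<psi> \<phi> x \<partial>M) = - (\<integral>x. q x * \<phi> x \<partial>M)"
    proof -
      have "(b * E x) * ((\<psi> x - ?\<chi> x / (b * E x)) * \<phi> x) = q x * \<phi> x" for x
        using Epos[of x] b0 by (simp add: q_def g_def field_simps)
      from el[OF \<phi>W, unfolded this] show ?thesis by linarith
    qed
    also have "(\<integral>x. g x * grad_inner M v \<phi> x \<partial>M) = - (\<integral>x. h x * g x * \<phi> x \<partial>M) - (\<integral>x. ?I x * \<phi> x \<partial>M)" by (rule vg[OF \<phi>])
    also have "- (\<integral>x. q x * \<phi> x \<partial>M) + 2 * (- (\<integral>x. h x * g x * \<phi> x \<partial>M) - (\<integral>x. ?I x * \<phi> x \<partial>M)) = - (\<integral>x. p x * \<phi> x \<partial>M)"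
    proof -
      have "(\<integral>x. p x * \<phi> x \<partial>M) = (\<integral>x. q x * \<phi> x + 2 * (h x * g x * \<phi> x + ?I x * \<phi> x) \<partial>M)"
        by (simp add: p_def algebra_simps)
      also have "\<dots> = (\<integral>x. q x * \<phi> x \<partial>M) + 2 * ((\<integral>x. h x * g x * \<phi> x \<partial>M) + (\<integral>x. ?I x * \<phi> x \<partial>M))"
        using L2_mult_integrable[OF qL \<phi>L] L2_mult_integrable[OF hgL \<phi>L] L2_mult_integrable[OF IL \<phi>L] by simp
      finally show ?thesis by simp
    qed
    finally show ?thesis .
  qed
  have Bo: "(\<integral>x. g x * ((1 / N - 1) * (h x)\<^sup>2 + K * ?u x) \<partial>M) - (\<integral>x. h x * ?I x \<partial>M) \<le> (\<integral>x. p x * ?u x \<partial>M) / 2"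
    by (rule Bochner_weak_laplacian[OF vb v(2) hb vN gb g0 pL gE])
  note ints = L2_integrable[OF bound_L2[OF um ub qL]] L2_integrable[OF bound_L2[OF um ub hgL]] L2_integrable[OF bound_L2[OF um ub IL]]
    L2_integrable[OF bound_L2[OF hm hb IL]] L2_integrable[OF bound_L2[OF hm hb hgL]] L2_integrable[OF ugL] L2_integrable[OF hgL] L2_integrable[OF IL]
    L2_integrable[OF gL] L2_integrable[OF qL] L2_mult_integrable[OF W12_L2[OF vW] IL] L2_mult_integrable[OF W12_L2[OF vW] hgL]
    L2_mult_integrable[OF W12_L2[OF vW] qL] L2_mult_integrable[OF W12_L2[OF vW] gL]
  \<comment> \<open>The case \<phi> = v of \<open>vg\<close>, which evaluates the integral of v
    \<langle>\<nabla>v, \<nabla>g\<rangle> without \<nabla>g.\<close>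
  have vI: "(\<integral>x. v x * ?I x \<partial>M) = - (\<integral>x. v x * (h x * g x) \<partial>M) - (\<integral>x. ?u x * g x \<partial>M)"
  proof -
    have "(\<integral>x. g x * grad_inner M v v x \<partial>M) = (\<integral>x. ?u x * g x \<partial>M)"
    proof (rule integral_cong_AE)
      show "AE x in M. g x * grad_inner M v v x = ?u x * g x" using grad_inner_self[OF vW] by eventually_elim simp
    qed (use gm um grad_inner_measurable[OF vW vW] in auto)
    then show ?thesis using vg[OF vb] by (simp add: mult.commute)
  qed
  have pu: "(\<integral>x. p x * ?u x \<partial>M) = (\<integral>x. ?u x * q x \<partial>M) + 2 * (\<integral>x. ?u x * (h x * g x) \<partial>M) + 2 * (\<integral>x. ?u x * ?I x \<partial>M)"
  proof -
    have "(\<integral>x. p x * ?u x \<partial>M) = (\<integral>x. ?u x * q x + 2 * (?u x * (h x * g x)) + 2 * (?u x * ?I x) \<partial>M)"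
      by (simp add: p_def algebra_simps)
    then show ?thesis using ints by simp
  qed
  \<comment> \<open>The equation gives u + h = -\<alpha> v, so the two integrals that contain
    \<nabla>g combine into the one evaluated by \<open>vI\<close>.\<close>
  have uI: "(\<integral>x. ?u x * ?I x \<partial>M) + (\<integral>x. h x * ?I x \<partial>M) = - \<alpha> * (\<integral>x. v x * ?I x \<partial>M)"
  proof -
    have "(\<integral>x. ?u x * ?I x \<partial>M) + (\<integral>x. h x * ?I x \<partial>M) = (\<integral>x. ?u x * ?I x + h x * ?I x \<partial>M)" using ints by simp
    also have "\<dots> = (\<integral>x. - \<alpha> * (v x * ?I x) \<partial>M)"
    proof (rule integral_cong_AE)
      show "AE x in M. ?u x * ?I x + h x * ?I x = - \<alpha> * (v x * ?I x)"
        using eq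
      proof eventually_elim
        case (elim x)
        have "?u x * ?I x + h x * ?I x = (?u x + h x) * ?I x" by (simp add: distrib_right)
        also have "?u x + h x = - \<alpha> * v x" using elim by simp
        finally show ?case by simp
      qed
    qed (use ints in auto)
    finally show ?thesis by simp
  qed
  \<comment> \<open>q is the adjoint of L applied to g, so the integral of v q is that of g L v, and
    L v = h + 2 u.\<close>
  have qv: "(\<integral>x. v x * q x \<partial>M) = (\<integral>x. h x * g x \<partial>M) + 2 * (\<integral>x. ?u x * g x \<partial>M)"
  proof -
    have "(\<integral>x. p x * v x \<partial>M) = (\<integral>x. v x * q x + 2 * (v x * (h x * g x)) + 2 * (v x * ?I x) \<partial>M)"
      by (simp add: p_def algebra_simps)
    also have "\<dots> = (\<integral>x. v x * q x \<partial>M) + 2 * (\<integral>x. v x * (h x * g x) \<partial>M) + 2 * (\<integral>x. v x * ?I x \<partial>M)"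
      using ints by simp
    finally show ?thesis using gE[OF vb] hE[OF gW] energy_sym[OF vW gW] vI by simp
  qed
  \<comment> \<open>The same pairing with the constant 1, for which L 1 = 0. It says that b
    \<integral>g = \<integral>\<chi>.\<close>
  have q0: "(\<integral>x. q x \<partial>M) = 0"
  proof -
    have "energy g (\<lambda>x. 1) = 0"
      using integral_grad_inner[OF gW W12_const[of 1]] grad_inner_const[OF gW, of 1] by (simp add: integral_eq_zero_AE)
    then have "(\<integral>x. p x * 1 \<partial>M) = 0" using gE[OF W12b_const[of 1]] by simp
    moreover have "(\<integral>x. p x * 1 \<partial>M) = (\<integral>x. q x + 2 * (h x * g x) + 2 * ?I x \<partial>M)"
      by (simp add: p_def algebra_simps)
    moreover have "(\<integral>x. q x + 2 * (h x * g x) + 2 * ?I x \<partial>M) = (\<integral>x. q x \<partial>M) + 2 * (\<integral>x. h x * g x \<partial>M) + 2 * (\<integral>x. ?I x \<partial>M)"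
      using ints by simp
    ultimately show ?thesis using integral_grad_inner[OF vW gW] hE[OF gW] by simp
  qed
  \<comment> \<open>T is g times the lower bound for L w, with h^2 in place of (u + \<alpha> v)^2
    and h + 2 u in place of u - \<alpha> v.\<close>
  define T where "T x = 2 / N * (h x * (h x * g x)) + 2 * (K - \<alpha>) * (?u x * g x) + ?c * (h x * g x + 2 * (?u x * g x))" for x
  have Ti: "integrable M T" unfolding T_def using ints by auto
  \<comment> \<open>The lower bound for L w in weak form: the part with u comes from Bochner's
    inequality, the part with v is the identity \<open>qv\<close>.\<close>
  have T_le: "(\<integral>x. T x \<partial>M) \<le> (\<integral>x. ?w x * q x \<partial>M)"
  proof -
    have e1: "(\<integral>x. g x * ((1 / N - 1) * (h x)\<^sup>2 + K * ?u x) \<partial>M)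
        = 1 / N * (\<integral>x. h x * (h x * g x) \<partial>M) - (\<integral>x. h x * (h x * g x) \<partial>M) + K * (\<integral>x. ?u x * g x \<partial>M)"
    proof -
      have "(\<integral>x. g x * ((1 / N - 1) * (h x)\<^sup>2 + K * ?u x) \<partial>M)
          = (\<integral>x. 1 / N * (h x * (h x * g x)) - h x * (h x * g x) + K * (?u x * g x) \<partial>M)"
        by (rule Bochner_Integration.integral_cong) (auto simp: power2_eq_square algebra_simps)
      then show ?thesis using ints by simp
    qed
    have e2: "(\<integral>x. ?u x * (h x * g x) \<partial>M) + \<alpha> * (\<integral>x. v x * (h x * g x) \<partial>M) = - (\<integral>x. h x * (h x * g x) \<partial>M)"
    proof -
      have "(\<integral>x. ?u x * (h x * g x) \<partial>M) + \<alpha> * (\<integral>x. v x * (h x * g x) \<partial>M)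
          = (\<integral>x. ?u x * (h x * g x) + \<alpha> * (v x * (h x * g x)) \<partial>M)" using ints by simp
      also have "\<dots> = (\<integral>x. - (h x * (h x * g x)) \<partial>M)"
      proof (rule integral_cong_AE)
        show "AE x in M. ?u x * (h x * g x) + \<alpha> * (v x * (h x * g x)) = - (h x * (h x * g x))"
          using eq
        proof eventually_elim
          case (elim x)
          have "?u x * (h x * g x) + \<alpha> * (v x * (h x * g x)) = (?u x + \<alpha> * v x) * (h x * g x)" by (simp add: distrib_right)
          also have "\<dots> = - (h x * (h x * g x))" unfolding elim[symmetric] by simp
          finally show ?case .
        qed
      qed (use ints in auto)
      finally show ?thesis by simp
    qed
    have e3: "(\<integral>x. T x \<partial>M) = 2 / N * (\<integral>x. h x * (h x * g x) \<partial>M) + 2 * (K - \<alpha>) * (\<integral>x. ?u x * g x \<partial>M)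
        + ?c * ((\<integral>x. h x * g x \<partial>M) + 2 * (\<integral>x. ?u x * g x \<partial>M))"
      unfolding T_def using ints by simp
    have e4: "(\<integral>x. ?w x * q x \<partial>M) = (\<integral>x. ?u x * q x \<partial>M) + ?c * (\<integral>x. v x * q x \<partial>M)"
    proof -
      have "(\<integral>x. ?w x * q x \<partial>M) = (\<integral>x. ?u x * q x + ?c * (v x * q x) \<partial>M)" by (simp only: distrib_right mult.assoc)
      then show ?thesis using ints by simp
    qed
    define Hh where "Hh = (\<integral>x. h x * (h x * g x) \<partial>M)"
    define U where "U = (\<integral>x. ?u x * g x \<partial>M)"
    define V where "V = (\<integral>x. v x * (h x * g x) \<partial>M)"
    \<comment> \<open>Two cancellations follow: -Hh stands on both sides, and \<alpha> V disappears
      once the terms with \<nabla>g are evaluated. What remains is half of the bound for the part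
      with u.\<close>
    have "1 / N * Hh - Hh + K * U - (\<integral>x. h x * ?I x \<partial>M) \<le> (\<integral>x. ?u x * q x \<partial>M) / 2 + (- Hh - \<alpha> * V) + (\<integral>x. ?u x * ?I x \<partial>M)"
      using Bo e2 unfolding e1 pu Hh_def[symmetric] U_def[symmetric] V_def[symmetric] by argo
    moreover have "(\<integral>x. ?u x * ?I x \<partial>M) + (\<integral>x. h x * ?I x \<partial>M) = \<alpha> * V + \<alpha> * U"
      unfolding uI vI Hh_def[symmetric] U_def[symmetric] V_def[symmetric] by (simp add: algebra_simps)
    ultimately have "1 / N * Hh + K * U \<le> (\<integral>x. ?u x * q x \<partial>M) / 2 + \<alpha> * U" by linarith
    moreover have "2 / N * Hh = 2 * (1 / N * Hh)" "2 * (K - \<alpha>) * U = 2 * (K * U) - 2 * (\<alpha> * U)"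
      by (simp_all add: algebra_simps)
    ultimately have "2 / N * Hh + 2 * (K - \<alpha>) * U \<le> (\<integral>x. ?u x * q x \<partial>M)" by linarith
    then show ?thesis unfolding e3 e4 qv Hh_def U_def by simp
  qed
  have uL: "?u \<in> L2 M" by (rule L2_bounded[OF um ub])
  have wL: "?w \<in> L2 M" using L2_lincomb[OF uL W12_L2[OF vW], of 1 ?c] by simp
  note wi = L2_mult_integrable[OF wL gL] L2_mult_integrable[OF wL \<chi>L] L2_integrable[OF gL] L2_integrable[OF \<chi>L]
  \<comment> \<open>Since g \<ge> 0, the pointwise inequality \<open>w0\<close> may be multiplied by
    g and integrated.\<close>
  have "(\<integral>x. b * (?w x * g x) - b * w0 * g x \<partial>M) \<le> (\<integral>x. T x \<partial>M)"
  proof (rule integral_mono_AE[OF _ Ti])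
    show "integrable M (\<lambda>x. b * (?w x * g x) - b * w0 * g x)" using wi by auto
    show "AE x in M. b * (?w x * g x) - b * w0 * g x \<le> T x"
      using eq
    proof eventually_elim
      case (elim x)
      have "g x * (b * (?w x - w0)) \<le> g x * (2 / N * (?u x + \<alpha> * v x)\<^sup>2 + 2 * (K - \<alpha>) * ?u x + ?c * (?u x - \<alpha> * v x))"
        by (rule mult_left_mono[OF w0 g0])
      also have "?u x + \<alpha> * v x = - h x" using elim by simp
      also have "?u x - \<alpha> * v x = h x + 2 * ?u x" using elim by simp
      also have "g x * (2 / N * (- h x)\<^sup>2 + 2 * (K - \<alpha>) * ?u x + ?c * (h x + 2 * ?u x)) = T x"
        by (simp add: T_def power2_eq_square algebra_simps)
      finally show ?case by (simp add: algebra_simps)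
    qed
  qed
  also note T_le
  also have "(\<integral>x. ?w x * q x \<partial>M) = (\<integral>x. b * (?w x * g x) - ?w x * ?\<chi> x \<partial>M)"
    by (rule Bochner_Integration.integral_cong) (auto simp: q_def algebra_simps)
  \<comment> \<open>The terms b \<integral>w g on the two sides cancel because q = b g -
    \<chi>.\<close>
  finally have "(\<integral>x. ?w x * ?\<chi> x \<partial>M) \<le> b * w0 * (\<integral>x. g x \<partial>M)" using wi by simp
  also have "\<dots> = w0 * (\<integral>x. ?\<chi> x \<partial>M)"
    using q0 wi unfolding q_def by simp
  finally have le: "(\<integral>x. ?w x * ?\<chi> x - w0 * ?\<chi> x \<partial>M) \<le> 0" using wi by simp
  have ii: "integrable M (\<lambda>x. ?w x * ?\<chi> x - w0 * ?\<chi> x)" using wi by (intro Bochner_Integration.integrable_diff integrable_mult_right)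
  \<comment> \<open>\<chi> is 1 exactly where w > w0, so the integrand is the positive part of w -
    w0.\<close>
  have nn: "0 \<le> ?w x * ?\<chi> x - w0 * ?\<chi> x" for x by simp
  have "0 \<le> (\<integral>x. ?w x * ?\<chi> x - w0 * ?\<chi> x \<partial>M)" by (rule integral_nonneg_AE[OF AE_I2[OF nn]])
  with le have "(\<integral>x. ?w x * ?\<chi> x - w0 * ?\<chi> x \<partial>M) = 0" by linarith
  then have "AE x in M. ?w x * ?\<chi> x - w0 * ?\<chi> x = 0"
    using integral_nonneg_eq_0_iff_AE[OF ii AE_I2[OF nn]] by blast
  then show ?thesis by eventually_elim (auto split: if_splits)
qed

end

theorem theorem4p1:
  fixes m :: "'a::metric_space measure"
    and K N \<alpha> :: real
    and v :: "'a \<Rightarrow> real"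
  assumes compact_X: "compact (UNIV :: 'a set)"
    and prob: "prob_space m"
    and N: "2 < N"
    and RCD: "RCD_star m K (ereal N)"
    and v: "v \<in> Lip \<inter> dom_laplacian m"
    and \<alpha>: "\<alpha> > 0"
    and eq: "AE x in m. - laplacian m v x = (grad_norm m v x)\<^sup>2 + \<alpha> * v x"
  shows "\<forall>\<beta>::real. 0 < \<beta> \<and> \<beta> < 1 \<longrightarrow>
    (AE x in m. (grad_norm m v x)\<^sup>2 + (\<alpha> - \<beta> * K) * v x
       \<le> N * \<alpha> * (1 - \<beta>) / (4 * \<beta>)
          * (1 - \<beta> * ((2 - \<beta>) * K - \<alpha>) / (2 * \<alpha> * (1 - \<beta>)))\<^sup>2)"
proof (intro allI impI)
  fix \<beta> :: real assume \<beta>: "0 < \<beta> \<and> \<beta> < 1"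
  have mms: "metric_measure_space m" using RCD by (simp add: RCD_star_def)
  interpret prob_space m by (rule prob)
  interpret bochner_mms m K N
  proof
    show "emeasure m A = (SUP C\<in>{C. compact C \<and> C \<subseteq> A}. emeasure m C)" if "A \<in> sets m" for A
      using mms that unfolding metric_measure_space_def by blast
  qed (use mms RCD compact_X N in \<open>auto simp: metric_measure_space_def RCD_star_def\<close>)
  have lap: "is_laplacian m v (laplacian m v)"
    using v laplacian_AE_eq(1) by (auto simp: dom_laplacian_def)
  \<comment> \<open>-A is the coefficient of u + \<alpha> t that remains when b (u + (\<alpha> -
    \<beta> K) t) is subtracted from the linear terms. The expression squared in the theorem is A /
    b.\<close>
  define A where "A = (\<alpha> - \<beta> * K) * (2 - \<beta>) / \<beta>"
  define b where "b = 2 * \<alpha> * (1 - \<beta>) / \<beta>"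
  define w0 where "w0 = N * \<alpha> * (1 - \<beta>) / (4 * \<beta>) * (1 - \<beta> * ((2 - \<beta>) * K - \<alpha>) / (2 * \<alpha> * (1 - \<beta>)))\<^sup>2"
  have nz: "\<beta> \<noteq> 0" "1 - \<beta> \<noteq> 0" "\<alpha> \<noteq> 0" "0 < N" using \<beta> \<alpha> N by auto
  have bw0: "b * w0 = N * A\<^sup>2 / 8"
  proof -
    have "1 - \<beta> * ((2 - \<beta>) * K - \<alpha>) / (2 * \<alpha> * (1 - \<beta>)) = A / b"
      using nz by (simp add: A_def b_def field_simps)
    then have "w0 = N * b / 8 * (A / b)\<^sup>2" using nz by (simp add: w0_def b_def field_simps)
    moreover have "b \<noteq> 0" using nz by (simp add: b_def)
    ultimately show ?thesis by (simp add: power2_eq_square)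
  qed
  have "b * (u + (\<alpha> - \<beta> * K) * t - w0)
      \<le> 2 / N * (u + \<alpha> * t)\<^sup>2 + 2 * (K - \<alpha>) * u + (\<alpha> - \<beta> * K) * (u - \<alpha> * t)" for u t
  proof -
    \<comment> \<open>For this b the coefficients of u and t become -A and -\<alpha> A.\<close>
    have "2 * (K - \<alpha>) * u + (\<alpha> - \<beta> * K) * (u - \<alpha> * t) - b * (u + (\<alpha> - \<beta> * K) * t) = - A * (u + \<alpha> * t)"
      using nz by (simp add: A_def b_def field_simps)
    \<comment> \<open>The minimum of 2 y^2 / N - A y is attained at y = N A / 4 and equals -N A^2 /
      8; this is the origin of b w0 = N A^2 / 8.\<close>
    moreover have "2 / N * (y - N * A / 4)\<^sup>2 = 2 / N * y\<^sup>2 - A * y + N * A\<^sup>2 / 8" for y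
      using nz by (simp add: power2_eq_square field_simps)
    moreover have "0 \<le> 2 / N * ((u + \<alpha> * t) - N * A / 4)\<^sup>2" using nz by simp
    ultimately show ?thesis using bw0 by (simp only: right_diff_distrib)
  qed
  then show "AE x in m. (grad_norm m v x)\<^sup>2 + (\<alpha> - \<beta> * K) * v x
       \<le> N * \<alpha> * (1 - \<beta>) / (4 * \<beta>) * (1 - \<beta> * ((2 - \<beta>) * K - \<alpha>) / (2 * \<alpha> * (1 - \<beta>)))\<^sup>2"
    unfolding w0_def[symmetric]
    by (intro gradient_estimate[of v "laplacian m v" \<alpha> \<beta> b]) (use v lap \<alpha> \<beta> eq b_def in auto)
qed

end
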